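(* Let $\Omega\subset\mathbb{R}^d$ be a bounded $C^{1,\gamma}$-domain, $\gamma\in(0,1)$, and $u\in L^1_{\mathrm{loc}}(\Omega)$. If $\int_\Omega u(x)(-\Delta\eta)(x)\,dx\le0$ for all $\eta\in C_c^\infty(\Omega)$ with $\eta\ge0$, and $$\lim_{\varepsilon\to0+}\varepsilon^{-1}\int_{\{x\in\Omega:\ \mathrm{dist}(x,\partial\Omega)<\varepsilon\}}u^+(x)\,dx=0,$$ then $u\le0$ a.e. on $\Omega$.
   Context: $u^+=\max\{u,0\}$. *)

theory Defs
  imports "HOL-Analysis.Analysis"
begin

fun pderivs :: "'a::euclidean_space list \<Rightarrow> ('a \<Rightarrow> real) \<Rightarrow> ('a \<Rightarrow> real)" where
  "pderivs [] f = f"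
| "pderivs (v # vs) f = (\<lambda>x. frechet_derivative (pderivs vs f) (at x) v)"

definition smooth_fun :: "('a::euclidean_space \<Rightarrow> real) \<Rightarrow> bool" where
  "smooth_fun f \<longleftrightarrow> (\<forall>vs. set vs \<subseteq> Basis \<longrightarrow> (\<forall>x. pderivs vs f differentiable (at x)))"

definition test_fun :: "'a::euclidean_space set \<Rightarrow> ('a \<Rightarrow> real) \<Rightarrow> bool" where
  "test_fun \<Omega> \<eta> \<longleftrightarrow> smooth_fun \<eta> \<and> compact (closure {x. \<eta> x \<noteq> 0})
      \<and> closure {x. \<eta> x \<noteq> 0} \<subseteq> \<Omega>"

definition laplacian :: "('a::euclidean_space \<Rightarrow> real) \<Rightarrow> 'a \<Rightarrow> real" where
  "laplacian f x = (\<Sum>i\<in>Basis. pderivs [i, i] f x)"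

text \<open>Bounded C^{1,gamma} domain: bounded connected open set whose boundary is locally,
  after a rotation, the graph of a C^{1,gamma} function.  The local coordinates are given by
  a unit vector nu (the "vertical" direction); the graph function g is evaluated on the
  hyperplane orthogonal to nu (g is given on the whole space, which is no restriction since
  a C^{1,gamma} function on the hyperplane extends via the orthogonal projection).\<close>
definition C1_holder_fun :: "real \<Rightarrow> ('a::euclidean_space \<Rightarrow> real) \<Rightarrow> bool" where
  "C1_holder_fun \<gamma> g \<longleftrightarrow> (\<exists>G C. (\<forall>x. (g has_derivative (\<lambda>h. G x \<bullet> h)) (at x)) \<and>
      (\<forall>x y. norm (G x - G y) \<le> C * dist x y powr \<gamma>))"

definition C1_gamma_domain :: "real \<Rightarrow> 'a::euclidean_space set \<Rightarrow> bool" where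
  "C1_gamma_domain \<gamma> \<Omega> \<longleftrightarrow> open \<Omega> \<and> connected \<Omega> \<and> \<Omega> \<noteq> {} \<and>
     (\<forall>p \<in> frontier \<Omega>. \<exists>r>0. \<exists>\<nu> g. norm \<nu> = 1 \<and> C1_holder_fun \<gamma> g \<and>
        \<Omega> \<inter> ball p r = {x \<in> ball p r. x \<bullet> \<nu> > g (x - (x \<bullet> \<nu>) *\<^sub>R \<nu>)})"

definition L1_loc :: "'a::euclidean_space set \<Rightarrow> ('a \<Rightarrow> real) \<Rightarrow> bool" where
  "L1_loc \<Omega> u \<longleftrightarrow> (\<forall>K. compact K \<and> K \<subseteq> \<Omega> \<longrightarrow> set_integrable lebesgue K u)"

end

(* The positive part V of a weakly subharmonic function satisfies V <= A_r V a.e., where A_r averages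
   against a rescaled radial bump.  Tested against a compactly supported eta >= 0, self-adjointness of
   A_r gives 0 <= INT V (A_r eta - eta).  Take eta = max (w - eps) 0 and r comparable to eps, where w is
   comparable to the distance d to the boundary and strictly superharmonic in the sense
   A_r w <= w - c r^2.  Then A_r eta - eta <= - c r^2 where d >= C eps, and A_r eta = O(eps) in the
   strip d < C eps, so that INT_{d >= C eps} V <= (C / eps) INT_{d < C eps} V, which tends to 0.

   The function w is an infimum of explicit local barriers and one paraboloid.  With t the normal
   coordinate and rho the distance to a boundary point p, the local barrier is
   t - t rho^a + b rho^(1+a) - b n t^2 rho^(a-1) with 0 < a < gamma: the first correction is
   superharmonic away from the tangent plane, the last one near it, and b rho^(1+a) keeps the barrier
   positive on the domain, which C^{1,gamma} regularity puts above -M rho^(1+gamma). *)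

theory Submission
  imports Defs
begin

section \<open>Smooth radial bumps\<close>

text \<open>The obstacle is regularity. \<open>u\<close> is only locally integrable, max (w - eps) 0
  is not an admissible test function, and a C^{1,\<gamma>} domain need satisfy neither an interior
  nor an exterior ball condition, so the distance to its boundary cannot serve as a C^2 barrier.
  Averages bypass all three points. The distributional inequality is tested only with explicit
  radial bumps, whose Laplacian is, up to a positive factor, the radius derivative of the averaging
  kernel. The inequality V <= A_r V passes from u to u^+ because averaging is monotone and positive.
  Finally A_r w <= w - c r^2 passes to infima, so w need not be differentiable. The two-sided
  comparison of w with the distance is what lets r be proportional to eps: the gain c r^2 is then of
  order eps^2 against a loss of order eps, and the ratio 1 / eps is exactly the scaling in the
  hypothesis. The exponent is a = \<gamma> / 2, so the deviation rho^(1+\<gamma>) of the boundary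
  from its tangent plane is of smaller order than the term b rho^(1+a).\<close>

fun exp_poly :: "nat \<Rightarrow> real poly" where
  "exp_poly 0 = 1"
| "exp_poly (Suc j) = [:0, 0, 1:] * (exp_poly j - pderiv (exp_poly j))"

text \<open>This is the \<open>j\<close>-th derivative of exp(-1/x), extended by 0. With z = 1/x one
  has d/dx = - z^2 d/dz, hence p(z) exp(-z) becomes z^2 (p - p') exp(-z), which is the recursion of
  \<open>exp_poly\<close>.\<close>

definition flat_exp :: "nat \<Rightarrow> real \<Rightarrow> real" where
  "flat_exp j x = (if x > 0 then poly (exp_poly j) (1 / x) * exp (- (1 / x)) else 0)"

text \<open>The free power \<open>k\<close> absorbs the factor z that each \<open>pCons\<close>
  contributes, so the induction reduces to the limits of z^k / exp z.\<close>

lemma poly_times_exp_tendsto_0: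
  fixes p :: "real poly"
  shows "((\<lambda>z. z ^ k * poly p z * exp (- z)) \<longlongrightarrow> 0) at_top"
proof (induction p arbitrary: k)
  case 0
  then show ?case by simp
next
  case (pCons a p)
  have 1: "((\<lambda>z::real. a * (z ^ k / exp z)) \<longlongrightarrow> a * 0) at_top"
    by (intro tendsto_mult tendsto_const tendsto_power_div_exp_0)
  have "((\<lambda>z. a * (z ^ k / exp z) + z ^ Suc k * poly p z * exp (- z)) \<longlongrightarrow> a * 0 + 0) at_top"
    by (intro tendsto_add 1 pCons.IH)
  then show ?case
    by (simp add: algebra_simps exp_minus divide_inverse)
qed

lemma flat_exp_deriv: "(flat_exp j has_real_derivative flat_exp (Suc j) x) (at x)"
proof (cases x "0::real" rule: linorder_cases)
  case less
  have "((\<lambda>_::real. 0::real) has_real_derivative 0) (at x)" by simp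
  then have "(flat_exp j has_real_derivative 0) (at x)"
    by (rule has_field_derivative_transform_within_open[where S="{..<0}"])
       (use less in \<open>auto simp: flat_exp_def\<close>)
  then show ?thesis
    using less by (simp add: flat_exp_def)
next
  case greater
  have "((\<lambda>x. poly (exp_poly j) (1 / x) * exp (- (1 / x))) has_real_derivative flat_exp (Suc j) x) (at x)"
    using greater
    by (auto intro!: derivative_eq_intros DERIV_chain'[OF _ poly_DERIV]
        simp: flat_exp_def power2_eq_square field_simps)
  then show ?thesis
    by (rule has_field_derivative_transform_within_open[where S="{0<..}"])
       (use greater in \<open>auto simp: flat_exp_def\<close>)
next
  case equal
  \<comment> \<open>The difference quotient at 0 from the right is z p(z) exp(-z) with z = 1/y, the
    growth lemma with \<open>k\<close> equal to 1.\<close>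
  have 0: "((\<lambda>y. flat_exp j y / y) \<longlongrightarrow> 0) (at_right 0)"
  proof -
    have "((\<lambda>y::real. (inverse y) ^ 1 * poly (exp_poly j) (inverse y) * exp (- inverse y)) \<longlongrightarrow> 0) (at_right 0)"
      by (rule filterlim_compose[OF poly_times_exp_tendsto_0 filterlim_inverse_at_top_right])
    moreover have "\<forall>\<^sub>F y in at_right 0. (inverse y) ^ 1 * poly (exp_poly j) (inverse y) * exp (- inverse y) = flat_exp j y / y"
      using eventually_at_right_less[of "0::real"]
      by eventually_elim (auto simp: flat_exp_def field_simps)
    ultimately show ?thesis
      by (rule Lim_transform_eventually)
  qed
  have 1: "((\<lambda>y. flat_exp j y / y) \<longlongrightarrow> 0) (at_left 0)"
    by (rule Lim_transform_eventually[OF tendsto_const])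
       (auto simp: eventually_at_left_field flat_exp_def intro!: exI[of _ "-1"])
  have "((\<lambda>y. flat_exp j y / y) \<longlongrightarrow> 0) (at 0)"
    using 0 1 filterlim_split_at by blast
  then show ?thesis
    using equal by (simp add: has_field_derivative_iff flat_exp_def)
qed

lemma flat_exp_continuous: "continuous_on UNIV (flat_exp j)"
  using flat_exp_deriv by (meson DERIV_continuous continuous_at_imp_continuous_on)

lemma flat_exp_nonpos_eq: "x \<le> 0 \<Longrightarrow> flat_exp j x = 0"
  by (simp add: flat_exp_def)

lemma flat_exp_0_nonneg: "0 \<le> flat_exp 0 x"
  by (simp add: flat_exp_def)

lemma flat_exp_1_nonneg: "0 \<le> flat_exp 1 x"
  by (simp add: flat_exp_def)

lemma flat_exp_1_pos: "0 < x \<Longrightarrow> 0 < flat_exp 1 x"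
  by (simp add: flat_exp_def)

text \<open>\<open>smooth_fun\<close> quantifies over all lists of basis directions. This ring
  contains the bumps and is closed under directional derivatives, since differentiating a
  \<open>flat_exp j\<close> term gives a \<open>flat_exp (Suc j)\<close> term times an affine
  function. Smoothness is then an induction on the list, with no formula for the higher
  derivatives.\<close>

inductive_set bump_ring :: "'a::euclidean_space \<Rightarrow> real \<Rightarrow> ('a \<Rightarrow> real) set" for a c where
  const: "(\<lambda>_. k) \<in> bump_ring a c"
| inner: "(\<lambda>x. x \<bullet> v) \<in> bump_ring a c"
| flat: "(\<lambda>x. flat_exp j (1 - c * ((x - a) \<bullet> (x - a)))) \<in> bump_ring a c"
| add: "f \<in> bump_ring a c \<Longrightarrow> g \<in> bump_ring a c \<Longrightarrow> (\<lambda>x. f x + g x) \<in> bump_ring a c"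
| mult: "f \<in> bump_ring a c \<Longrightarrow> g \<in> bump_ring a c \<Longrightarrow> (\<lambda>x. f x * g x) \<in> bump_ring a c"

lemma flat_exp_bump_has_derivative:
  "((\<lambda>x. flat_exp j (1 - c * ((x - a) \<bullet> (x - a)))) has_derivative
      (\<lambda>h. flat_exp (Suc j) (1 - c * ((x - a) \<bullet> (x - a))) * (- 2 * c * ((x - a) \<bullet> h)))) (at x)"
proof -
  have "((\<lambda>x. 1 - c * ((x - a) \<bullet> (x - a))) has_derivative (\<lambda>h. - 2 * c * ((x - a) \<bullet> h))) (at x)"
    by (auto intro!: derivative_eq_intros simp: inner_commute algebra_simps)
  from has_derivative_compose[OF this flat_exp_deriv[of j, unfolded has_field_derivative_def]]
  show ?thesis
    by (simp add: mult.commute)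
qed

lemma bump_ring_derivative:
  assumes "f \<in> bump_ring a c"
  shows "\<exists>f'. (\<forall>x. (f has_derivative f' x) (at x)) \<and> (\<forall>v. (\<lambda>x. f' x v) \<in> bump_ring a c)"
  using assms
proof induction
  case (const k)
  then show ?case
    by (intro exI[of _ "\<lambda>_ _. 0"]) (auto intro: bump_ring.const)
next
  case (inner v)
  then show ?case
    by (intro exI[of _ "\<lambda>_ h. h \<bullet> v"]) (auto intro!: bump_ring.const derivative_eq_intros)
next
  case (flat j)
  have "(\<lambda>x. flat_exp (Suc j) (1 - c * ((x - a) \<bullet> (x - a))) * ((- 2 * c) * (x \<bullet> v + (- (a \<bullet> v))))) \<in> bump_ring a c"
    for v
    by (intro bump_ring.mult bump_ring.flat bump_ring.const bump_ring.add bump_ring.inner)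
  then have "(\<lambda>x. flat_exp (Suc j) (1 - c * ((x - a) \<bullet> (x - a))) * ((- 2 * c) * ((x - a) \<bullet> v))) \<in> bump_ring a c"
    for v
    by (simp add: inner_diff_left)
  then show ?case
    by (intro exI[of _ "\<lambda>x h. flat_exp (Suc j) (1 - c * ((x - a) \<bullet> (x - a))) * (- 2 * c * ((x - a) \<bullet> h))"])
       (simp only: flat_exp_bump_has_derivative simp_thms)
next
  case (add f g)
  then obtain f' g' where
    "\<And>x. (f has_derivative f' x) (at x)" "\<And>v. (\<lambda>x. f' x v) \<in> bump_ring a c"
    "\<And>x. (g has_derivative g' x) (at x)" "\<And>v. (\<lambda>x. g' x v) \<in> bump_ring a c"
    by blast
  then have "(\<forall>x. ((\<lambda>x. f x + g x) has_derivative (\<lambda>v. f' x v + g' x v)) (at x)) \<and>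
      (\<forall>v. (\<lambda>x. f' x v + g' x v) \<in> bump_ring a c)"
    by (intro conjI allI has_derivative_add bump_ring.add)
  then show ?case
    by (intro exI[of _ "\<lambda>x v. f' x v + g' x v"])
next
  case (mult f g)
  then obtain f' g' where
    "\<And>x. (f has_derivative f' x) (at x)" "\<And>v. (\<lambda>x. f' x v) \<in> bump_ring a c"
    "\<And>x. (g has_derivative g' x) (at x)" "\<And>v. (\<lambda>x. g' x v) \<in> bump_ring a c"
    by blast
  with mult have "(\<forall>x. ((\<lambda>x. f x * g x) has_derivative (\<lambda>v. f x * g' x v + f' x v * g x)) (at x)) \<and>
      (\<forall>v. (\<lambda>x. f x * g' x v + f' x v * g x) \<in> bump_ring a c)"
    by (intro conjI allI has_derivative_mult bump_ring.add bump_ring.mult)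
  then show ?case
    by (intro exI[of _ "\<lambda>x v. f x * g' x v + f' x v * g x"])
qed

lemma bump_ring_smooth:
  assumes "f \<in> bump_ring a c"
  shows "smooth_fun f"
proof -
  have "pderivs vs f \<in> bump_ring a c" for vs
  proof (induction vs)
    case Nil
    then show ?case using assms by simp
  next
    case (Cons v vs)
    obtain f' where f': "\<forall>x. (pderivs vs f has_derivative f' x) (at x)" "\<forall>v. (\<lambda>x. f' x v) \<in> bump_ring a c"
      using bump_ring_derivative[OF Cons] by blast
    then have "frechet_derivative (pderivs vs f) (at x) = f' x" for x
      using frechet_derivative_at by metis
    with f' show ?case by simp
  qed
  then show ?thesis
    unfolding smooth_fun_def using bump_ring_derivative differentiable_def by blast
qed

section \<open>Bumps: gradient, Hessian and Laplacian\<close>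

definition bump :: "'a::euclidean_space \<Rightarrow> real \<Rightarrow> 'a \<Rightarrow> real" where
  "bump a t x = flat_exp 0 (1 - (1 / t\<^sup>2) * ((x - a) \<bullet> (x - a)))"

lemma bump_eq_0: "0 < t \<Longrightarrow> t \<le> dist x a \<Longrightarrow> bump a t x = 0"
  using power_mono[of t "norm (x - a)" 2]
  by (simp add: bump_def flat_exp_def power2_norm_eq_inner[symmetric] dist_norm not_less)

lemma bump_support:
  assumes "0 < t" shows "closure {x. bump a t x \<noteq> 0} \<subseteq> cball a t"
proof (rule closure_minimal)
  show "{x. bump a t x \<noteq> 0} \<subseteq> cball a t"
    using bump_eq_0[OF assms, where a=a] by (force simp: dist_commute)
qed simp

lemma bump_test_fun:
  assumes "0 < t" "cball a t \<subseteq> \<Omega>"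
  shows "test_fun \<Omega> (bump a t)"
proof -
  have "smooth_fun (bump a t)"
    unfolding bump_def[abs_def] by (rule bump_ring_smooth[OF bump_ring.flat])
  moreover have "compact (closure {x. bump a t x \<noteq> 0})"
    using bounded_subset[OF bounded_cball bump_support[OF assms(1)]] by (simp add: compact_eq_bounded_closed)
  ultimately show ?thesis
    using bump_support[OF assms(1)] assms(2) by (auto simp: test_fun_def)
qed

definition bump_grad :: "'a::euclidean_space \<Rightarrow> real \<Rightarrow> 'a \<Rightarrow> 'a" where
  "bump_grad a t x = (flat_exp 1 (1 - (1 / t\<^sup>2) * ((x - a) \<bullet> (x - a))) * (- 2 / t\<^sup>2)) *\<^sub>R (x - a)"

lemma bump_has_derivative: "(bump a t has_derivative (\<lambda>h. bump_grad a t x \<bullet> h)) (at x)"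
  unfolding bump_def[abs_def] bump_grad_def
  by (rule has_derivative_eq_rhs[OF flat_exp_bump_has_derivative]) (simp add: mult.assoc)

definition bump_hess :: "'a::euclidean_space \<Rightarrow> real \<Rightarrow> 'a \<Rightarrow> 'a \<Rightarrow> 'a" where
  "bump_hess a t x h =
     (flat_exp 1 (1 - (1 / t\<^sup>2) * ((x - a) \<bullet> (x - a))) * (- 2 / t\<^sup>2)) *\<^sub>R h
   + (flat_exp 2 (1 - (1 / t\<^sup>2) * ((x - a) \<bullet> (x - a))) * (2 / t\<^sup>2)\<^sup>2 * ((x - a) \<bullet> h)) *\<^sub>R (x - a)"

lemma bump_grad_has_derivative: "(bump_grad a t has_derivative bump_hess a t x) (at x)"
  unfolding bump_grad_def[abs_def] bump_hess_def[abs_def]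
  by (rule derivative_eq_intros flat_exp_bump_has_derivative refl)+
     (simp add: numeral_2_eq_2[symmetric] power2_eq_square mult_ac)

lemma continuous_on_bump: "continuous_on UNIV (bump a t)"
  by (rule has_derivative_continuous_on[OF has_derivative_at_withinI[OF bump_has_derivative]])

lemma continuous_on_bump_grad: "continuous_on UNIV (bump_grad a t)"
  by (rule has_derivative_continuous_on[OF has_derivative_at_withinI[OF bump_grad_has_derivative]])

lemma continuous_on_bump_hess: "continuous_on UNIV (\<lambda>x. bump_hess a t x h)"
  unfolding bump_hess_def
  by (intro continuous_intros continuous_on_compose2[OF flat_exp_continuous]) auto

text \<open>The Laplacian of the bump as a function of s = |x - a|^2 / t^2, up to the factor -2 /
  t^2. Up to sign and a power of t it is also the radius derivative of the rescaled profile
  \<open>flat_exp 1 (1 - s)\<close>, and this coincidence is what makes averages monotone in the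
  radius.\<close>

definition lap_profile :: "nat \<Rightarrow> real \<Rightarrow> real" where
  "lap_profile n s = real n * flat_exp 1 (1 - s) - 2 * s * flat_exp 2 (1 - s)"

lemma trace_bump_hess:
  fixes a :: "'a::euclidean_space"
  shows "(\<Sum>i\<in>Basis. bump_hess a t x i \<bullet> i) =
    - 2 / t\<^sup>2 * lap_profile DIM('a) ((1 / t\<^sup>2) * ((x - a) \<bullet> (x - a)))"
proof -
  have *: "(\<Sum>i\<in>Basis. (A *\<^sub>R i + (B * (y \<bullet> i)) *\<^sub>R y) \<bullet> i) = real DIM('a) * A + B * (y \<bullet> y)"
    for A B and y :: 'a
    by (simp add: inner_add_left sum.distrib euclidean_inner[of y y] sum_distrib_left mult.assoc)
  \<comment> \<open>The degenerate radius t = 0 is allowed; there both sides vanish because division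
    by zero gives 0.\<close>
  have key: "n * (F * (- 2 / T)) + G * (2 / T)\<^sup>2 * q = - 2 / T * (n * F - 2 * (1 / T * q) * G)"
    for F G q T n :: real
    by (cases "T = 0") (simp_all add: field_simps power2_eq_square)
  show ?thesis
    unfolding bump_hess_def * lap_profile_def by (rule key)
qed

lemma laplacian_bump:
  fixes a :: "'a::euclidean_space"
  shows "laplacian (bump a t) x = - 2 / t\<^sup>2 * lap_profile DIM('a) ((1 / t\<^sup>2) * ((x - a) \<bullet> (x - a)))"
proof -
  have 1: "frechet_derivative (bump a t) (at x) = (\<lambda>h. bump_grad a t x \<bullet> h)" for x
    using frechet_derivative_at[OF bump_has_derivative] by metis
  have "((\<lambda>x. bump_grad a t x \<bullet> i) has_derivative (\<lambda>h. bump_hess a t x h \<bullet> i)) (at x)" for i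
    by (intro derivative_intros bump_grad_has_derivative)
  then have 2: "frechet_derivative (\<lambda>x. bump_grad a t x \<bullet> i) (at x) = (\<lambda>h. bump_hess a t x h \<bullet> i)" for i
    using frechet_derivative_at by metis
  show ?thesis
    unfolding laplacian_def using trace_bump_hess by (simp add: 1 2)
qed

section \<open>Differentiation under the integral sign\<close>

lemma lborel_integral_affine:
  fixes g :: "'a::euclidean_space \<Rightarrow> real"
  assumes [measurable]: "g \<in> borel_measurable borel" and "c \<noteq> 0"
  shows "integral\<^sup>L lborel g = \<bar>c\<bar> ^ DIM('a) * (LINT y|lborel. g (a + c *\<^sub>R y))"
  by (subst lborel_affine[OF \<open>c \<noteq> 0\<close>, of a])
     (simp add: integral_density integral_distr)

lemma lborel_integrable_affine:
  fixes g :: "'a::euclidean_space \<Rightarrow> real"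
  assumes [measurable]: "g \<in> borel_measurable borel" and "c \<noteq> 0"
  shows "integrable lborel (\<lambda>y. g (a + c *\<^sub>R y)) \<longleftrightarrow> integrable lborel g"
proof -
  have "integrable lborel g \<longleftrightarrow> integrable (density (distr lborel borel (\<lambda>x. a + c *\<^sub>R x)) (\<lambda>_. \<bar>c\<bar> ^ DIM('a))) g"
    by (subst lborel_affine[OF \<open>c \<noteq> 0\<close>, of a]) simp
  also have "\<dots> \<longleftrightarrow> integrable lborel (\<lambda>y. \<bar>c\<bar> ^ DIM('a) *\<^sub>R g (a + c *\<^sub>R y))"
    by (subst integrable_density) (auto simp: integrable_distr_eq)
  finally show ?thesis
    using \<open>c \<noteq> 0\<close> by simp
qed

text \<open>\<open>U\<close> plays the role of a merely locally integrable weight, so smoothness in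
  t is asked of \<open>f\<close> alone: the mean value inequality bounds its difference quotients by
  \<open>B\<close> on \<open>K\<close> and by 0 elsewhere, and dominated convergence along sequences
  gives the limit.\<close>

lemma DERIV_weighted_integral:
  fixes f :: "real \<Rightarrow> 'a::euclidean_space \<Rightarrow> real"
  assumes [measurable]: "U \<in> borel_measurable borel" "\<And>t. f t \<in> borel_measurable borel"
      "\<And>t. f' t \<in> borel_measurable borel"
    and t0: "t0 \<in> {a<..<b}"
    and deriv: "\<And>t y. t \<in> {a<..<b} \<Longrightarrow> ((\<lambda>t. f t y) has_real_derivative f' t y) (at t)"
    and bound: "\<And>t y. t \<in> {a<..<b} \<Longrightarrow> \<bar>f' t y\<bar> \<le> B * indicator K y"
    and intK: "integrable lborel (\<lambda>y. indicator K y * U y)"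
    and intf: "\<And>t. t \<in> {a<..<b} \<Longrightarrow> integrable lborel (\<lambda>y. U y * f t y)"
  shows "((\<lambda>t. LINT y|lborel. U y * f t y) has_real_derivative (LINT y|lborel. U y * f' t0 y)) (at t0)"
proof -
  let ?S = "{a<..<b}"
  let ?G = "\<lambda>t. LINT y|lborel. U y * f t y"
  have quot: "\<bar>(f t y - f t0 y) / (t - t0)\<bar> \<le> B * indicator K y" if "t \<in> ?S - {t0}" for t y
  proof -
    have "norm (f t y - f t0 y) \<le> (B * indicator K y) * norm (t - t0)"
      by (rule field_differentiable_bound[where f'="\<lambda>s. f' s y" and S="?S"])
         (use that t0 bound in \<open>auto intro: has_field_derivative_at_within[OF deriv]\<close>)
    then show ?thesis
      using that by (simp add: abs_divide divide_le_eq)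
  qed
  \<comment> \<open>Working within the open interval keeps every sequence where the bound holds; as
    the interval is a neighbourhood of \<open>t0\<close>, the restriction is removed at the
    end.\<close>
  have "((\<lambda>t. (?G t - ?G t0) / (t - t0)) \<longlongrightarrow> (LINT y|lborel. U y * f' t0 y)) (at t0 within ?S)"
    unfolding tendsto_at_iff_sequentially
  proof (intro allI impI)
    fix X assume X: "\<forall>i. X i \<in> ?S - {t0}" "X \<longlonglongrightarrow> t0"
    have "(\<lambda>i. LINT y|lborel. U y * ((f (X i) y - f t0 y) / (X i - t0))) \<longlonglongrightarrow>
        (LINT y|lborel. U y * f' t0 y)"
    proof (rule integral_dominated_convergence[where w="\<lambda>y. \<bar>B\<bar> * \<bar>indicator K y * U y\<bar>"])
      show "integrable lborel (\<lambda>y. \<bar>B\<bar> * \<bar>indicator K y * U y\<bar>)"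
        using intK by (intro integrable_mult_right integrable_abs)
      have "(\<lambda>i. (f (X i) y - f t0 y) / (X i - t0)) \<longlonglongrightarrow> f' t0 y" for y
      proof -
        have "((\<lambda>t. (f t y - f t0 y) / (t - t0)) \<longlongrightarrow> f' t0 y) (at t0)"
          using deriv[OF t0] by (simp add: has_field_derivative_iff)
        then show ?thesis
          using X unfolding tendsto_at_iff_sequentially by (auto simp: o_def)
      qed
      then show "AE y in lborel. (\<lambda>i. U y * ((f (X i) y - f t0 y) / (X i - t0))) \<longlonglongrightarrow> U y * f' t0 y"
        by (intro AE_I2 tendsto_mult tendsto_const)
      show "AE y in lborel. norm (U y * ((f (X i) y - f t0 y) / (X i - t0))) \<le> \<bar>B\<bar> * \<bar>indicator K y * U y\<bar>" for i
      proof (rule AE_I2)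
        fix y
        have "\<bar>(f (X i) y - f t0 y) / (X i - t0)\<bar> \<le> \<bar>B\<bar> * indicator K y"
          using quot[of "X i" y] X by (cases "y \<in> K") auto
        then have "\<bar>U y\<bar> * \<bar>(f (X i) y - f t0 y) / (X i - t0)\<bar> \<le> \<bar>U y\<bar> * (\<bar>B\<bar> * indicator K y)"
          by (intro mult_left_mono) auto
        then show "norm (U y * ((f (X i) y - f t0 y) / (X i - t0))) \<le> \<bar>B\<bar> * \<bar>indicator K y * U y\<bar>"
          by (simp add: abs_mult mult_ac)
      qed
    qed measurable
    moreover have "(LINT y|lborel. U y * ((f (X i) y - f t0 y) / (X i - t0))) = (?G (X i) - ?G t0) / (X i - t0)" for i
    proof -
      have "(LINT y|lborel. U y * ((f (X i) y - f t0 y) / (X i - t0))) =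
          (LINT y|lborel. (U y * f (X i) y - U y * f t0 y) / (X i - t0))"
        by (intro Bochner_Integration.integral_cong) (simp_all add: right_diff_distrib diff_divide_distrib)
      also have "\<dots> = (?G (X i) - ?G t0) / (X i - t0)"
        using X(1) intf[of "X i"] intf[OF t0] by (subst integral_divide_zero) (simp add: Bochner_Integration.integral_diff)
      finally show ?thesis .
    qed
    ultimately show "((\<lambda>t. (?G t - ?G t0) / (t - t0)) \<circ> X) \<longlonglongrightarrow> (LINT y|lborel. U y * f' t0 y)"
      by (simp only: o_def)
  qed
  then have "(?G has_real_derivative (LINT y|lborel. U y * f' t0 y)) (at t0 within ?S)"
    by (simp add: has_field_derivative_iff)
  then show ?thesis
    using at_within_open[OF t0] by simp
qed

lemma integrable_continuous_compact_support:
  fixes F :: "'a::euclidean_space \<Rightarrow> real"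
  assumes "continuous_on UNIV F" "\<And>y. y \<notin> cball a R \<Longrightarrow> F y = 0"
  shows "integrable lborel F"
proof -
  have "integrable lborel (\<lambda>y. indicator (cball a R) y *\<^sub>R F y)"
    by (intro borel_integrable_compact continuous_on_subset[OF assms(1)]) auto
  moreover have "indicator (cball a R) y *\<^sub>R F y = F y" for y
    using assms(2)[of y] by (auto simp: indicator_def)
  ultimately show ?thesis by (simp only:)
qed

lemma continuous_compact_support_bounded:
  fixes F :: "'a::euclidean_space \<Rightarrow> real"
  assumes "continuous_on UNIV F" "\<And>y. y \<notin> cball a R \<Longrightarrow> F y = 0"
  obtains B where "0 \<le> B" "\<And>y. \<bar>F y\<bar> \<le> B"
proof -
  have "bounded (F ` cball a R)"
    by (intro compact_imp_bounded compact_continuous_image continuous_on_subset[OF assms(1)]) auto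
  then obtain B where B: "\<forall>z\<in>F ` cball a R. norm z \<le> B"
    unfolding bounded_iff by blast
  then have "\<bar>F y\<bar> \<le> max B 0" for y
    using B assms(2)[of y] by (cases "y \<in> cball a R") (auto simp: le_max_iff_disj)
  then show ?thesis
    using that[of "max B 0"] by auto
qed

text \<open>Translation invariance of Lebesgue measure replaces the divergence theorem.\<close>

lemma integral_directional_derivative_eq_0:
  fixes F :: "'a::euclidean_space \<Rightarrow> real"
  assumes deriv: "\<And>y. ((\<lambda>s. F (y + s *\<^sub>R v)) has_real_derivative F' y) (at 0)"
    and cont: "continuous_on UNIV F" "continuous_on UNIV F'"
    and supp: "\<And>y. y \<notin> cball a R \<Longrightarrow> F y = 0" "\<And>y. y \<notin> cball a R \<Longrightarrow> F' y = 0"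
  shows "integral\<^sup>L lborel F' = 0"
proof -
  obtain B where B: "0 \<le> B" "\<And>y. \<bar>F' y\<bar> \<le> B"
    using continuous_compact_support_bounded[OF cont(2) supp(2)] by blast
  have [measurable]: "F \<in> borel_measurable borel" "F' \<in> borel_measurable borel"
    using cont by (auto intro: borel_measurable_continuous_onI)
  \<comment> \<open>One set must carry the derivatives of all translates with |t| < 1, hence the
    enlarged radius.\<close>
  define K where "K = cball a (R + norm v)"
  have supp_K: "F' (y + t *\<^sub>R v) = 0" if "t \<in> {-1<..<1}" "y \<notin> K" for y t
  proof (rule supp(2), rule notI)
    assume "y + t *\<^sub>R v \<in> cball a R"
    moreover have "dist a y \<le> dist a (y + t *\<^sub>R v) + dist (y + t *\<^sub>R v) y"
      by (rule dist_triangle)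
    moreover have "\<bar>t\<bar> * norm v \<le> 1 * norm v"
      using that by (intro mult_right_mono) auto
    ultimately show False
      using that by (auto simp: K_def dist_norm)
  qed
  have int_shift: "(LINT y|lborel. F (y + t *\<^sub>R v)) = integral\<^sup>L lborel F" for t
    using lborel_integral_affine[of F 1 "t *\<^sub>R v"] by (simp add: add.commute)
  have "((\<lambda>t. LINT y|lborel. 1 * F (y + t *\<^sub>R v)) has_real_derivative
      (LINT y|lborel. 1 * F' (y + 0 *\<^sub>R v))) (at 0)"
  proof (rule DERIV_weighted_integral[where a="-1" and b=1 and B=B and K=K])
    show "((\<lambda>t. F (y + t *\<^sub>R v)) has_real_derivative F' (y + t *\<^sub>R v)) (at t)" for t y
    proof -
      have "((\<lambda>s. F (y + t *\<^sub>R v + s *\<^sub>R v)) has_real_derivative F' (y + t *\<^sub>R v)) (at 0)"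
        by (rule deriv)
      then have "((\<lambda>s. F (y + (s + t) *\<^sub>R v)) has_real_derivative F' (y + t *\<^sub>R v)) (at 0)"
        by (simp add: scaleR_left_distrib add_ac)
      then show ?thesis
        using DERIV_shift[of "\<lambda>s. F (y + s *\<^sub>R v)" _ 0 t] by simp
    qed
    show "\<bar>F' (y + t *\<^sub>R v)\<bar> \<le> B * indicator K y" if "t \<in> {-1<..<1}" for t y
      using supp_K[OF that, of y] B by (auto simp: indicator_def)
    show "integrable lborel (\<lambda>y. indicator K y * (1::real))"
      using integrable_real_indicator[of K lborel] emeasure_bounded_finite[of K] by (simp add: K_def)
    show "integrable lborel (\<lambda>y. 1 * F (y + t *\<^sub>R v))" for t
      using lborel_integrable_affine[of F 1 "t *\<^sub>R v"] integrable_continuous_compact_support[OF cont(1) supp(1)]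
      by (simp add: add.commute)
  qed measurable
  \<comment> \<open>The integral of the translates is constant in t, so its derivative at 0, the
    integral of \<open>F'\<close>, must vanish.\<close>
  then have "((\<lambda>t. integral\<^sup>L lborel F) has_real_derivative integral\<^sup>L lborel F') (at 0)"
    by (simp add: int_shift)
  then show ?thesis
    using DERIV_unique[OF DERIV_const] by metis
qed

section \<open>Radial averages\<close>

definition mass :: "'a::euclidean_space itself \<Rightarrow> real" where
  "mass _ = (LINT y|lborel. flat_exp 1 (1 - y \<bullet> (y::'a)))"

text \<open>The profile is \<open>flat_exp 1\<close>, the derivative of the one in
  \<open>bump\<close>, so that differentiating the rescaled kernel in the radius produces the
  Laplacian of \<open>bump\<close>.\<close>

definition mollifier :: "'a::euclidean_space \<Rightarrow> real" where
  "mollifier z = flat_exp 1 (1 - z \<bullet> z) / mass TYPE('a)"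

definition avg :: "('a::euclidean_space \<Rightarrow> real) \<Rightarrow> real \<Rightarrow> 'a \<Rightarrow> real" where
  "avg f r x = (LINT z|lborel. mollifier z * f (x + r *\<^sub>R z))"

lemma one_le_inner_self: "1 \<le> norm z \<Longrightarrow> 1 \<le> z \<bullet> z"
  by (simp add: power2_norm_eq_inner[symmetric])

lemma continuous_on_flat_exp_ball: "continuous_on UNIV (\<lambda>y. flat_exp j (1 - y \<bullet> y))"
  by (intro continuous_on_compose2[OF flat_exp_continuous] continuous_intros) auto

text \<open>The centre is excluded because the second moment integrand
  \<open>mollifier z * (z \<bullet> z)\<close> vanishes there. A point is a null set while a ball is
  not, so a zero integral is impossible.\<close>

lemma integral_pos_if_pos_on_ball:
  fixes F :: "'a::euclidean_space \<Rightarrow> real"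
  assumes "integrable lborel F" "\<And>z. 0 \<le> F z" "\<And>z. z \<in> ball a e - {a} \<Longrightarrow> 0 < F z" "0 < e"
  shows "0 < integral\<^sup>L lborel F"
proof -
  have "integral\<^sup>L lborel F \<noteq> 0"
  proof
    assume "integral\<^sup>L lborel F = 0"
    then have "AE z in lborel. F z = 0"
      using integral_nonneg_eq_0_iff_AE[OF assms(1)] assms(2) by simp
    moreover have "AE z in lborel. z \<noteq> a"
      by (rule AE_lborel_singleton)
    ultimately have "AE z in lborel. z \<notin> ball a e"
    proof eventually_elim
      case (elim z)
      then show "z \<notin> ball a e"
        using assms(3)[of z] by auto
    qed
    then have "ball a e \<in> null_sets lborel"
      by (subst (asm) AE_iff_null_sets[symmetric]) auto
    then have "negligible (ball a e)"
      unfolding negligible_iff_null_sets by (rule null_sets_completionI)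
    then show False
      using assms(4) by (simp add: open_not_negligible)
  qed
  moreover have "0 \<le> integral\<^sup>L lborel F"
    using assms(2) by simp
  ultimately show ?thesis by simp
qed

lemma mass_pos: "0 < mass TYPE('a::euclidean_space)"
  unfolding mass_def
proof (rule integral_pos_if_pos_on_ball[where a=0 and e=1])
  show "integrable lborel (\<lambda>y::'a. flat_exp 1 (1 - y \<bullet> y))"
    by (rule integrable_continuous_compact_support[OF continuous_on_flat_exp_ball, of 0 1])
       (auto simp: flat_exp_nonpos_eq one_le_inner_self)
  show "0 < flat_exp 1 (1 - z \<bullet> z)" if "z \<in> ball 0 1 - {0}" for z :: 'a
    using that by (intro flat_exp_1_pos) (simp add: power2_norm_eq_inner[symmetric] power_less_one_iff)
qed (simp_all add: flat_exp_1_nonneg del: One_nat_def)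

lemma mollifier_nonneg: "0 \<le> mollifier z"
  by (simp add: mollifier_def flat_exp_1_nonneg mass_pos less_imp_le del: One_nat_def)

lemma mollifier_pos: "norm z < 1 \<Longrightarrow> 0 < mollifier z"
  unfolding mollifier_def
  by (intro divide_pos_pos mass_pos flat_exp_1_pos)
     (simp add: power2_norm_eq_inner[symmetric] power_less_one_iff)

lemma mollifier_eq_0: "1 \<le> norm z \<Longrightarrow> mollifier z = 0"
  by (simp add: mollifier_def flat_exp_nonpos_eq one_le_inner_self)

lemma mollifier_minus: "mollifier (- z) = mollifier z"
  by (simp add: mollifier_def)

lemma continuous_on_mollifier: "continuous_on UNIV (mollifier :: 'a::euclidean_space \<Rightarrow> real)"
  unfolding mollifier_def[abs_def]
  by (intro continuous_intros continuous_on_flat_exp_ball) (use mass_pos[where 'a='a] in simp)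

lemma borel_measurable_mollifier [measurable]: "mollifier \<in> borel_measurable borel"
  using continuous_on_mollifier by (rule borel_measurable_continuous_onI)

lemma integrable_mollifier: "integrable lborel mollifier"
  by (rule integrable_continuous_compact_support[OF continuous_on_mollifier, of 0 1]) (auto simp: mollifier_eq_0)

lemma integral_mollifier: "integral\<^sup>L lborel (mollifier :: 'a::euclidean_space \<Rightarrow> real) = 1"
  unfolding mollifier_def using mass_pos[where 'a='a] by (simp add: mass_def)

lemma mollifier_bounded: obtains B where "0 < B" "\<And>z::'a::euclidean_space. mollifier z \<le> B"
proof -
  obtain B where B: "0 \<le> B" "\<And>z::'a. \<bar>mollifier z\<bar> \<le> B"
    by (rule continuous_compact_support_bounded[OF continuous_on_mollifier, of 0 1]) (auto simp: mollifier_eq_0)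
  have "mollifier z \<le> B + 1" for z :: 'a
    using B(2)[of z] by linarith
  then show ?thesis
    using that[of "B + 1"] B(1) by simp
qed

section \<open>Change of variables, monotonicity and limits of averages\<close>

lemma avg_integral_eq:
  fixes f :: "'a::euclidean_space \<Rightarrow> real"
  assumes [measurable]: "f \<in> borel_measurable borel" and "0 < r"
  shows "avg f r x = (LINT y|lborel. mollifier ((1 / r) *\<^sub>R (y - x)) * f y) / r ^ DIM('a)"
proof -
  have "avg f r x = \<bar>1 / r\<bar> ^ DIM('a) *
      (LINT y|lborel. mollifier (- (1 / r) *\<^sub>R x + (1 / r) *\<^sub>R y) * f (x + r *\<^sub>R (- (1 / r) *\<^sub>R x + (1 / r) *\<^sub>R y)))"
    unfolding avg_def using \<open>0 < r\<close>
    by (intro lborel_integral_affine) auto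
  also have "(\<lambda>y. mollifier (- (1 / r) *\<^sub>R x + (1 / r) *\<^sub>R y) * f (x + r *\<^sub>R (- (1 / r) *\<^sub>R x + (1 / r) *\<^sub>R y))) =
      (\<lambda>y. mollifier ((1 / r) *\<^sub>R (y - x)) * f y)"
    using \<open>0 < r\<close> by (auto simp: scaleR_right_diff_distrib scaleR_right_distrib)
  finally show ?thesis
    using \<open>0 < r\<close> by (simp add: power_one_over divide_inverse power_inverse)
qed

text \<open>The mollifier is bounded and vanishes off the unit ball, so only the behaviour of
  \<open>f\<close> on the averaging ball matters.\<close>

lemma avg_integrable:
  fixes f :: "'a::euclidean_space \<Rightarrow> real"
  assumes [measurable]: "f \<in> borel_measurable borel" and "0 < r"
    and "integrable lborel (\<lambda>y. indicator (ball x r) y * f y)"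
  shows "integrable lborel (\<lambda>z. mollifier z * f (x + r *\<^sub>R z))"
proof -
  obtain B where B: "0 < B" "\<And>z::'a. mollifier z \<le> B"
    using mollifier_bounded by blast
  have "integrable lborel (\<lambda>z. indicator (ball x r) (x + r *\<^sub>R z) * f (x + r *\<^sub>R z))"
    using lborel_integrable_affine[of "\<lambda>y. indicator (ball x r) y * f y" r x] assms by simp
  then have "integrable lborel (\<lambda>z. B * (indicator (ball x r) (x + r *\<^sub>R z) * f (x + r *\<^sub>R z)))"
    by (rule integrable_mult_right)
  then show ?thesis
  proof (rule Bochner_Integration.integrable_bound)
    show "AE z in lborel. norm (mollifier z * f (x + r *\<^sub>R z)) \<le>
        norm (B * (indicator (ball x r) (x + r *\<^sub>R z) * f (x + r *\<^sub>R z)))"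
    proof (rule AE_I2)
      fix z
      show "norm (mollifier z * f (x + r *\<^sub>R z)) \<le> norm (B * (indicator (ball x r) (x + r *\<^sub>R z) * f (x + r *\<^sub>R z)))"
      proof (cases "norm z < 1")
        case True
        then have "x + r *\<^sub>R z \<in> ball x r"
          using \<open>0 < r\<close> by (simp add: dist_norm)
        then show ?thesis
          using B mollifier_nonneg[of z] by (simp add: abs_mult mult_right_mono)
      qed (simp add: mollifier_eq_0)
    qed
  qed measurable
qed

lemma avg_mono:
  assumes "integrable lborel (\<lambda>z. mollifier z * f (x + r *\<^sub>R z))" "integrable lborel (\<lambda>z. mollifier z * g (x + r *\<^sub>R z))"
    and "\<And>y. y \<in> ball x r \<Longrightarrow> f y \<le> g y" "0 < r"
  shows "avg f r x \<le> avg g r x"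
  unfolding avg_def
proof (rule integral_mono[OF assms(1,2)])
  show "mollifier z * f (x + r *\<^sub>R z) \<le> mollifier z * g (x + r *\<^sub>R z)" for z
    using assms(3)[of "x + r *\<^sub>R z"] mollifier_nonneg[of z] \<open>0 < r\<close>
    by (cases "norm z < 1") (auto simp: dist_norm mult_left_mono mollifier_eq_0)
qed

lemma avg_cong:
  assumes "\<And>y. y \<in> ball x r \<Longrightarrow> f y = g y" "0 < r"
  shows "avg f r x = avg g r x"
  unfolding avg_def
proof (rule Bochner_Integration.integral_cong[OF refl])
  show "mollifier z * f (x + r *\<^sub>R z) = mollifier z * g (x + r *\<^sub>R z)" for z
    using assms(1)[of "x + r *\<^sub>R z"] \<open>0 < r\<close>
    by (cases "norm z < 1") (auto simp: dist_norm mollifier_eq_0)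
qed

text \<open>Continuity at the centre is enough: for each fixed z the points
  \<open>x + (r / Suc k) *\<^sub>R z\<close> tend to \<open>x\<close>, and for z in the unit ball
  they stay where \<open>f\<close> is bounded.\<close>

lemma avg_tendsto:
  fixes f :: "'a::euclidean_space \<Rightarrow> real"
  assumes [measurable]: "f \<in> borel_measurable borel"
    and "isCont f x" and B: "\<And>y. y \<in> ball x r \<Longrightarrow> \<bar>f y\<bar> \<le> B" and "0 < r"
  shows "(\<lambda>k. avg f (r / Suc k) x) \<longlonglongrightarrow> f x"
proof -
  have "(\<lambda>k. LINT z|lborel. mollifier z * f (x + (r / Suc k) *\<^sub>R z)) \<longlonglongrightarrow> (LINT (z::'a)|lborel. mollifier z * f x)"
  proof (rule integral_dominated_convergence[where w="\<lambda>z. mollifier z * \<bar>B\<bar>"])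
    show "integrable lborel (\<lambda>z::'a. mollifier z * \<bar>B\<bar>)"
      by (simp add: integrable_mollifier)
    have "(\<lambda>k. x + (r / Suc k) *\<^sub>R z) \<longlonglongrightarrow> x + 0 *\<^sub>R z" for z
      by (intro tendsto_intros LIMSEQ_Suc[OF lim_const_over_n])
    then have "(\<lambda>k. f (x + (r / Suc k) *\<^sub>R z)) \<longlonglongrightarrow> f x" for z
      using \<open>isCont f x\<close> isCont_tendsto_compose by fastforce
    then show "AE z in lborel. (\<lambda>k. mollifier z * f (x + (r / Suc k) *\<^sub>R z)) \<longlonglongrightarrow> mollifier z * f x"
      by (intro AE_I2 tendsto_mult tendsto_const)
    show "AE z in lborel. norm (mollifier z * f (x + (r / Suc k) *\<^sub>R z)) \<le> mollifier z * \<bar>B\<bar>" for k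
    proof (rule AE_I2)
      fix z
      show "norm (mollifier z * f (x + (r / Suc k) *\<^sub>R z)) \<le> mollifier z * \<bar>B\<bar>"
      proof (cases "norm z < 1")
        case True
        have "norm z * r < 1 * r"
          using True \<open>0 < r\<close> by (intro mult_strict_right_mono)
        also have "\<dots> \<le> r * Suc k"
          using \<open>0 < r\<close> by simp
        finally have "r / Suc k * norm z < r"
          by (simp add: field_simps)
        then have "x + (r / Suc k) *\<^sub>R z \<in> ball x r"
          using \<open>0 < r\<close> by (simp add: dist_norm)
        then have "\<bar>f (x + (r / Suc k) *\<^sub>R z)\<bar> \<le> \<bar>B\<bar>"
          using B by force
        then show ?thesis
          using mollifier_nonneg[of z] by (simp add: abs_mult mult_left_mono)
      qed (simp add: mollifier_eq_0)
    qed
  qed measurable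
  then show ?thesis
    using integral_mollifier[where 'a='a] by (simp add: avg_def)
qed

lemma lap_profile_bounded: obtains B where "0 \<le> B" "\<And>s. 0 \<le> s \<Longrightarrow> \<bar>lap_profile n s\<bar> \<le> B"
    "\<And>s. 1 \<le> s \<Longrightarrow> lap_profile n s = 0"
proof -
  have 0: "lap_profile n s = 0" if "1 \<le> s" for s
    using that by (simp add: lap_profile_def flat_exp_nonpos_eq)
  have "continuous_on {0..1} (lap_profile n)"
    unfolding lap_profile_def[abs_def]
    by (intro continuous_intros continuous_on_compose2[OF flat_exp_continuous]) auto
  then have "bounded (lap_profile n ` {0..1})"
    by (intro compact_imp_bounded compact_continuous_image) auto
  then obtain B where B: "\<forall>z\<in>lap_profile n ` {0..1}. norm z \<le> B"
    unfolding bounded_iff by blast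
  have "\<bar>lap_profile n s\<bar> \<le> max B 0" if "0 \<le> s" for s
    using B 0[of s] that by (cases "s \<le> 1") (auto simp: le_max_iff_disj)
  then show ?thesis
    using 0 that[of "max B 0"] by auto
qed

text \<open>The radius derivative of the rescaled mollifier is a positive multiple of the Laplacian of a
  bump, so averages of a weakly subharmonic function increase with the radius.\<close>

lemma avg_mono_radius:
  fixes U :: "'a::euclidean_space \<Rightarrow> real"
  assumes [measurable]: "U \<in> borel_measurable borel"
    and int: "integrable lborel (\<lambda>y. indicator (cball x R) y * U y)"
    and sub: "\<And>t. 0 < t \<Longrightarrow> t < R \<Longrightarrow> 0 \<le> (LINT y|lborel. U y * laplacian (bump x t) y)"
    and "0 < s" "s \<le> r" "r < R"
  shows "avg U s x \<le> avg U r x"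
proof -
  let ?n = "DIM('a)"
  define q where "q y = (y - x) \<bullet> (y - x)" for y
  define f where "f t y = flat_exp 1 (1 - (1 / t\<^sup>2) * q y) / t ^ ?n" for t y
  define f' where "f' t y = - lap_profile ?n ((1 / t\<^sup>2) * q y) / t ^ Suc ?n" for t y
  have [measurable]: "flat_exp j \<in> borel_measurable borel" for j
    using flat_exp_continuous by (rule borel_measurable_continuous_onI)
  have [measurable]: "f t \<in> borel_measurable borel" "f' t \<in> borel_measurable borel" for t
    unfolding f_def f'_def q_def lap_profile_def by measurable
  obtain B where B: "0 \<le> B" "\<And>s. 0 \<le> s \<Longrightarrow> \<bar>lap_profile ?n s\<bar> \<le> B"
    "\<And>s. 1 \<le> s \<Longrightarrow> lap_profile ?n s = 0"
    using lap_profile_bounded by blast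
  have q_ge: "1 \<le> (1 / t\<^sup>2) * q y" if "y \<notin> cball x R" "0 < t" "t < R" for t y
  proof -
    have "t\<^sup>2 \<le> (norm (y - x))\<^sup>2"
      using that by (intro power_mono) (auto simp: dist_norm norm_minus_commute)
    then show ?thesis
      using that by (simp add: q_def power2_norm_eq_inner)
  qed
  \<comment> \<open>The quotient rule for the kernel, with t^n written as t * T so that t^(n-1) is
    T.\<close>
  have alg: "(G * (2 * q / t ^ 3) * (t * T) - F * (n * T)) / ((t * T) * (t * T)) =
      - (n * F - 2 * ((1 / t\<^sup>2) * q) * G) / (t * (t * T))"
    if "t \<noteq> 0" "T \<noteq> 0" for F G q t T n :: real
    using that by (simp add: field_simps power2_eq_square power3_eq_cube)
  have deriv: "((\<lambda>t. LINT y|lborel. U y * f t y) has_real_derivative (LINT y|lborel. U y * f' t0 y)) (at t0)"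
    if t0: "0 < t0" "t0 < R" for t0
  \<comment> \<open>Radii below t0 / 2 are cut off so that the factor 1 / t^(n+1) in
    \<open>f'\<close> stays bounded; radii below \<open>R\<close> keep the kernel inside the ball on
    which \<open>U\<close> is integrable.\<close>
  proof (rule DERIV_weighted_integral[where a="t0/2" and b=R and B="B / (t0 / 2) ^ Suc ?n" and K="cball x R"])
    show "t0 \<in> {t0/2<..<R}"
      using t0 by simp
    show "((\<lambda>t. f t y) has_real_derivative f' t y) (at t)" if "t \<in> {t0/2<..<R}" for t y
    proof -
      have "t > 0"
        using that t0 by simp
      have "((\<lambda>t. 1 - (1 / t\<^sup>2) * q y) has_real_derivative 2 * q y / t ^ 3) (at t)"
        using \<open>t > 0\<close> by (auto intro!: derivative_eq_intros simp: field_simps eval_nat_numeral)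
      from DERIV_chain2[OF flat_exp_deriv[of 1] this]
      have 1: "((\<lambda>t. flat_exp 1 (1 - (1 / t\<^sup>2) * q y)) has_real_derivative
          flat_exp 2 (1 - (1 / t\<^sup>2) * q y) * (2 * q y / t ^ 3)) (at t)"
        by (simp add: numeral_2_eq_2)
      have 2: "((\<lambda>t. t ^ ?n) has_real_derivative real ?n * t ^ (?n - 1)) (at t)"
        by (auto intro!: derivative_eq_intros)
      obtain m where m: "?n = Suc m"
        using DIM_positive[where 'a='a] gr0_conv_Suc by blast
      have "(flat_exp 2 (1 - (1 / t\<^sup>2) * q y) * (2 * q y / t ^ 3) * t ^ ?n -
          flat_exp 1 (1 - (1 / t\<^sup>2) * q y) * (real ?n * t ^ (?n - 1))) / (t ^ ?n * t ^ ?n) = f' t y"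
        unfolding f'_def lap_profile_def m power_Suc diff_Suc_1 using \<open>t > 0\<close> by (intro alg) auto
      with DERIV_divide[OF 1 2] show ?thesis
        unfolding f_def using \<open>t > 0\<close> by simp
    qed
    show "\<bar>f' t y\<bar> \<le> B / (t0 / 2) ^ Suc ?n * indicator (cball x R) y" if "t \<in> {t0/2<..<R}" for t y
    proof (cases "y \<in> cball x R")
      case True
      have "\<bar>lap_profile ?n ((1 / t\<^sup>2) * q y)\<bar> / t ^ Suc ?n \<le> B / (t0 / 2) ^ Suc ?n"
        using that t0 B by (intro frac_le power_mono zero_less_power) (auto simp: q_def)
      then show ?thesis
        using True that t0 by (simp add: f'_def)
    next
      case False
      then have "f' t y = 0"
        using B(3)[OF q_ge[OF False, of t]] that t0 by (simp add: f'_def)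
      then show ?thesis
        using False by simp
    qed
    show "integrable lborel (\<lambda>y. U y * f t y)" if "t \<in> {t0/2<..<R}" for t
    proof -
      have "t > 0" "t < R"
        using that t0 by auto
      have "integrable lborel (\<lambda>y. indicator (ball x t) y * U y)"
        by (rule Bochner_Integration.integrable_bound[OF int])
           (use \<open>t < R\<close> in \<open>auto simp: indicator_def\<close>)
      from avg_integrable[OF assms(1) \<open>t > 0\<close> this]
      have "integrable lborel (\<lambda>z. mollifier z * U (x + t *\<^sub>R z))" .
      then have "integrable lborel (\<lambda>y. mollifier ((1 / t) *\<^sub>R (y - x)) * U y)"
        using lborel_integrable_affine[of "\<lambda>y. mollifier ((1 / t) *\<^sub>R (y - x)) * U y" t x] \<open>t > 0\<close> by simp
      then have "integrable lborel (\<lambda>y. mass TYPE('a) / t ^ ?n * (mollifier ((1 / t) *\<^sub>R (y - x)) * U y))"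
        by (rule integrable_mult_right)
      moreover have "mass TYPE('a) / t ^ ?n * (mollifier ((1 / t) *\<^sub>R (y - x)) * U y) = U y * f t y" for y
        using mass_pos[where 'a='a] by (simp add: mollifier_def f_def q_def power2_eq_square)
      ultimately show ?thesis by simp
    qed
  qed (use int in simp_all)
  have avg_eq: "avg U t x = (LINT y|lborel. U y * f t y) / mass TYPE('a)" if "0 < t" for t
  proof -
    have "(LINT y|lborel. U y * f t y) = (LINT y|lborel. mass TYPE('a) / t ^ ?n * (mollifier ((1 / t) *\<^sub>R (y - x)) * U y))"
      using mass_pos[where 'a='a]
      by (intro Bochner_Integration.integral_cong) (simp_all add: mollifier_def f_def q_def power2_eq_square)
    then show ?thesis
      using mass_pos[where 'a='a] by (simp add: avg_integral_eq[OF assms(1) that])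
  qed
  have nonneg: "0 \<le> (LINT y|lborel. U y * f' t y)" if t: "0 < t" "t < R" for t
  proof -
    \<comment> \<open>The radius derivative of the kernel is t / (2 t^n) times the Laplacian of the
      bump of the same radius.\<close>
    have "(LINT y|lborel. U y * f' t y) = (LINT y|lborel. (t / (2 * t ^ ?n)) * (U y * laplacian (bump x t) y))"
      using t by (intro Bochner_Integration.integral_cong)
        (simp_all add: laplacian_bump f'_def q_def power2_eq_square)
    also have "\<dots> = (t / (2 * t ^ ?n)) * (LINT y|lborel. U y * laplacian (bump x t) y)"
      by simp
    finally show ?thesis
      using sub[OF t] t by simp
  qed
  have "(LINT y|lborel. U y * f s y) \<le> (LINT y|lborel. U y * f r y)"
  proof (rule DERIV_nonneg_imp_nondecreasing[OF \<open>s \<le> r\<close>])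
    fix t assume "s \<le> t" "t \<le> r"
    then show "\<exists>y. ((\<lambda>t. LINT y|lborel. U y * f t y) has_real_derivative y) (at t) \<and> 0 \<le> y"
      using deriv nonneg assms(4-6) by force
  qed
  then show ?thesis
    using avg_eq assms(4-6) mass_pos[where 'a='a] by (simp add: divide_right_mono)
qed

section \<open>Averages of superharmonic functions\<close>

text \<open>A certificate that \<open>f\<close> is twice differentiable on \<open>S\<close> with
  Laplacian \<open>L\<close>, leaving \<open>L\<close> free off \<open>S\<close>. Continuity is
  asked of the diagonal second derivatives only, because the Green identity is proved one coordinate
  at a time.\<close>

definition c2_lap :: "'a::euclidean_space set \<Rightarrow> ('a \<Rightarrow> real) \<Rightarrow> ('a \<Rightarrow> real) \<Rightarrow> bool" where
  "c2_lap S f L \<longleftrightarrow> (\<exists>G H. (\<forall>y\<in>S. (f has_derivative (\<lambda>h. G y \<bullet> h)) (at y) \<and> (G has_derivative H y) (at y)) \<and>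
      (\<forall>i\<in>Basis. continuous_on S (\<lambda>y. H y i \<bullet> i)) \<and> (\<forall>y\<in>S. L y = (\<Sum>i\<in>Basis. H y i \<bullet> i)))"

lemma c2_lapI:
  assumes "\<And>y. y \<in> S \<Longrightarrow> (f has_derivative (\<lambda>h. G y \<bullet> h)) (at y)"
    and "\<And>y. y \<in> S \<Longrightarrow> (G has_derivative H y) (at y)"
    and "\<And>i. i \<in> Basis \<Longrightarrow> continuous_on S (\<lambda>y. H y i \<bullet> i)"
    and "\<And>y. y \<in> S \<Longrightarrow> L y = (\<Sum>i\<in>Basis. H y i \<bullet> i)"
  shows "c2_lap S f L"
  unfolding c2_lap_def using assms by (intro exI[of _ G] exI[of _ H]) simp

lemma c2_lapE:
  assumes "c2_lap S f L"
  obtains G H where "\<And>y. y \<in> S \<Longrightarrow> (f has_derivative (\<lambda>h. G y \<bullet> h)) (at y)"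
    and "\<And>y. y \<in> S \<Longrightarrow> (G has_derivative H y) (at y)"
    and "\<And>i. i \<in> Basis \<Longrightarrow> continuous_on S (\<lambda>y. H y i \<bullet> i)"
    and "\<And>y. y \<in> S \<Longrightarrow> L y = (\<Sum>i\<in>Basis. H y i \<bullet> i)"
proof -
  obtain G H where *: "\<forall>y\<in>S. (f has_derivative (\<lambda>h. G y \<bullet> h)) (at y) \<and> (G has_derivative H y) (at y)"
      "\<forall>i\<in>Basis. continuous_on S (\<lambda>y. H y i \<bullet> i)" "\<forall>y\<in>S. L y = (\<Sum>i\<in>Basis. H y i \<bullet> i)"
    using assms unfolding c2_lap_def by blast
  show thesis
    by (rule that[of G H]) (use * in simp_all)
qed

lemma c2_lap_add:
  assumes "c2_lap S f L" "c2_lap S g M"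
  shows "c2_lap S (\<lambda>x. f x + g x) (\<lambda>x. L x + M x)"
proof -
  obtain G H where 1: "\<And>y. y \<in> S \<Longrightarrow> (f has_derivative (\<lambda>h. G y \<bullet> h)) (at y)"
    "\<And>y. y \<in> S \<Longrightarrow> (G has_derivative H y) (at y)"
    "\<And>i. i \<in> Basis \<Longrightarrow> continuous_on S (\<lambda>y. H y i \<bullet> i)"
    "\<And>y. y \<in> S \<Longrightarrow> L y = (\<Sum>i\<in>Basis. H y i \<bullet> i)"
    by (rule c2_lapE[OF assms(1)]) (rule that; simp)
  obtain G' H' where 2: "\<And>y. y \<in> S \<Longrightarrow> (g has_derivative (\<lambda>h. G' y \<bullet> h)) (at y)"
    "\<And>y. y \<in> S \<Longrightarrow> (G' has_derivative H' y) (at y)"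
    "\<And>i. i \<in> Basis \<Longrightarrow> continuous_on S (\<lambda>y. H' y i \<bullet> i)"
    "\<And>y. y \<in> S \<Longrightarrow> M y = (\<Sum>i\<in>Basis. H' y i \<bullet> i)"
    by (rule c2_lapE[OF assms(2)]) (rule that; simp)
  show ?thesis
  proof (rule c2_lapI)
    fix y assume y: "y \<in> S"
    show "((\<lambda>x. f x + g x) has_derivative (\<lambda>h. (G y + G' y) \<bullet> h)) (at y)"
      using has_derivative_add[OF 1(1)[OF y] 2(1)[OF y]] by (simp add: inner_add_left)
    show "((\<lambda>y. G y + G' y) has_derivative (\<lambda>h. H y h + H' y h)) (at y)"
      by (rule has_derivative_add[OF 1(2)[OF y] 2(2)[OF y]])
    show "L y + M y = (\<Sum>i\<in>Basis. (H y i + H' y i) \<bullet> i)"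
      by (simp add: 1(4)[OF y] 2(4)[OF y] inner_add_left sum.distrib)
  next
    fix i :: 'a assume "i \<in> Basis"
    then show "continuous_on S (\<lambda>y. (H y i + H' y i) \<bullet> i)"
      unfolding inner_add_left by (intro continuous_on_add 1(3) 2(3))
  qed
qed

lemma c2_lap_cmult:
  assumes "c2_lap S f L"
  shows "c2_lap S (\<lambda>x. c * f x) (\<lambda>x. c * L x)"
proof -
  obtain G H where 1: "\<And>y. y \<in> S \<Longrightarrow> (f has_derivative (\<lambda>h. G y \<bullet> h)) (at y)"
    "\<And>y. y \<in> S \<Longrightarrow> (G has_derivative H y) (at y)"
    "\<And>i. i \<in> Basis \<Longrightarrow> continuous_on S (\<lambda>y. H y i \<bullet> i)"
    "\<And>y. y \<in> S \<Longrightarrow> L y = (\<Sum>i\<in>Basis. H y i \<bullet> i)"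
    by (rule c2_lapE[OF assms(1)]) (rule that; simp)
  show ?thesis
  proof (rule c2_lapI)
    fix y assume y: "y \<in> S"
    show "((\<lambda>x. c * f x) has_derivative (\<lambda>h. (c *\<^sub>R G y) \<bullet> h)) (at y)"
      using has_derivative_mult_right[OF 1(1)[OF y]] by simp
    show "((\<lambda>y. c *\<^sub>R G y) has_derivative (\<lambda>h. c *\<^sub>R H y h)) (at y)"
      by (rule has_derivative_scaleR_right[OF 1(2)[OF y]])
    show "c * L y = (\<Sum>i\<in>Basis. (c *\<^sub>R H y i) \<bullet> i)"
      by (simp add: 1(4)[OF y] sum_distrib_left)
  next
    fix i :: 'a assume "i \<in> Basis"
    then show "continuous_on S (\<lambda>y. (c *\<^sub>R H y i) \<bullet> i)"
      unfolding inner_scaleR_left by (intro continuous_on_mult continuous_on_const 1(3))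
  qed
qed

lemma c2_lap_subset: "c2_lap S f L \<Longrightarrow> T \<subseteq> S \<Longrightarrow> c2_lap T f L"
proof -
  assume "c2_lap S f L" and T: "T \<subseteq> S"
  then obtain G H where *: "\<And>y. y \<in> S \<Longrightarrow> (f has_derivative (\<lambda>h. G y \<bullet> h)) (at y)"
    "\<And>y. y \<in> S \<Longrightarrow> (G has_derivative H y) (at y)"
    "\<And>i. i \<in> Basis \<Longrightarrow> continuous_on S (\<lambda>y. H y i \<bullet> i)"
    "\<And>y. y \<in> S \<Longrightarrow> L y = (\<Sum>i\<in>Basis. H y i \<bullet> i)"
    by - (rule c2_lapE, assumption, rule that; simp)
  show "c2_lap T f L"
    by (rule c2_lapI[where G=G and H=H]) (use * T continuous_on_subset[OF *(3) T] in \<open>simp_all add: subsetD[OF T]\<close>)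
qed

lemma c2_lap_cong:
  assumes "\<And>y. y \<in> S \<Longrightarrow> f y = g y" "c2_lap S g M" "\<And>y. y \<in> S \<Longrightarrow> L y = M y" "open S"
  shows "c2_lap S f L"
proof -
  obtain G H where *: "\<And>y. y \<in> S \<Longrightarrow> (g has_derivative (\<lambda>h. G y \<bullet> h)) (at y)"
    "\<And>y. y \<in> S \<Longrightarrow> (G has_derivative H y) (at y)"
    "\<And>i. i \<in> Basis \<Longrightarrow> continuous_on S (\<lambda>y. H y i \<bullet> i)"
    "\<And>y. y \<in> S \<Longrightarrow> M y = (\<Sum>i\<in>Basis. H y i \<bullet> i)"
    by (rule c2_lapE[OF assms(2)]) (rule that; simp)
  show ?thesis
  proof (rule c2_lapI[where G=G and H=H])
    show "(f has_derivative (\<lambda>h. G y \<bullet> h)) (at y)" if "y \<in> S" for y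
      by (rule has_derivative_transform_within_open[OF *(1)[OF that] \<open>open S\<close> that]) (simp add: assms(1))
  qed (use * assms(3) in simp_all)
qed

lemma c2_lap_const: "c2_lap S (\<lambda>_. k) (\<lambda>_. 0)"
  by (rule c2_lapI[where G="\<lambda>_. 0" and H="\<lambda>_ _. 0"]) simp_all

lemma c2_lap_square_dist:
  fixes a :: "'a::euclidean_space"
  shows "c2_lap S (\<lambda>y. (y - a) \<bullet> (y - a)) (\<lambda>_. 2 * real DIM('a))"
proof (rule c2_lapI[where G="\<lambda>y. 2 *\<^sub>R (y - a)" and H="\<lambda>_ h. 2 *\<^sub>R h"])
  show "((\<lambda>y. (y - a) \<bullet> (y - a)) has_derivative (\<lambda>h. (2 *\<^sub>R (y - a)) \<bullet> h)) (at y)" for y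
    by (auto intro!: derivative_eq_intros simp: inner_commute)
  show "((\<lambda>y. 2 *\<^sub>R (y - a)) has_derivative (\<lambda>h. 2 *\<^sub>R h)) (at y)" for y
    by (auto intro!: derivative_eq_intros)
qed auto

lemma c2_lap_continuous:
  assumes "c2_lap S f L"
  shows "continuous_on S f"
proof -
  obtain G H where "\<And>y. y \<in> S \<Longrightarrow> (f has_derivative (\<lambda>h. G y \<bullet> h)) (at y)"
    "\<And>y. y \<in> S \<Longrightarrow> (G has_derivative H y) (at y)"
    "\<And>i. i \<in> Basis \<Longrightarrow> continuous_on S (\<lambda>y. H y i \<bullet> i)"
    "\<And>y. y \<in> S \<Longrightarrow> L y = (\<Sum>i\<in>Basis. H y i \<bullet> i)"
    by (rule c2_lapE[OF assms(1)]) (rule that; simp)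
  then show ?thesis
    by (intro has_derivative_continuous_on[OF has_derivative_at_withinI])
qed

section \<open>Green's identity against bumps, and mean value inequalities\<close>

lemma bump_outside:
  assumes "0 < t" "y \<notin> cball a t"
  shows "bump a t y = 0" "bump_grad a t y = 0" "bump_hess a t y h = 0"
proof -
  have "t\<^sup>2 \<le> (norm (y - a))\<^sup>2"
    using assms by (intro power_mono) (auto simp: dist_norm norm_minus_commute)
  then have "1 - (1 / t\<^sup>2) * ((y - a) \<bullet> (y - a)) \<le> 0"
    using assms by (simp add: power2_norm_eq_inner)
  then have "flat_exp j (1 - (1 / t\<^sup>2) * ((y - a) \<bullet> (y - a))) = 0" for j
    by (rule flat_exp_nonpos_eq)
  then show "bump a t y = 0" "bump_grad a t y = 0" "bump_hess a t y h = 0"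
    by (simp_all add: bump_def bump_grad_def bump_hess_def del: One_nat_def)
qed

lemma has_real_derivative_along:
  assumes "(f has_derivative f') (at y)"
  shows "((\<lambda>s. f (y + s *\<^sub>R v)) has_real_derivative f' v) (at 0)"
proof -
  have "((\<lambda>s. y + s *\<^sub>R v) has_derivative (\<lambda>s. s *\<^sub>R v)) (at 0)"
    by (auto intro!: derivative_eq_intros)
  moreover have "(f has_derivative f') (at (y + 0 *\<^sub>R v))"
    using assms by simp
  ultimately have "((\<lambda>s. f (y + s *\<^sub>R v)) has_derivative (\<lambda>s. f' (s *\<^sub>R v))) (at 0)"
    by (rule has_derivative_compose)
  moreover have "f' (s *\<^sub>R v) = s * f' v" for s
    using linear_scale[OF has_derivative_linear[OF assms]] by simp
  ultimately show ?thesis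
    by (simp add: has_field_derivative_def mult.commute[of _ "f' v"])
qed

lemma laplacian_bump_eq_trace: "laplacian (bump a t) y = (\<Sum>i\<in>Basis. bump_hess a t y i \<bullet> i)"
  by (simp add: laplacian_bump trace_bump_hess)

text \<open>With b the bump, the i-th derivative of f d_i b - b d_i f is f d_ii b - b d_ii f, as the
  mixed products cancel. The field has compact support, so this derivative integrates to 0, and
  summing over i gives the identity.\<close>

lemma green_bump:
  fixes f :: "'a::euclidean_space \<Rightarrow> real"
  assumes c2: "c2_lap S f L" and "open S" "cball x t \<subseteq> S" "0 < t"
  shows "(LINT y|lborel. f y * laplacian (bump x t) y) = (LINT y|lborel. L y * bump x t y)"
proof -
  obtain G H where f: "\<And>y. y \<in> S \<Longrightarrow> (f has_derivative (\<lambda>h. G y \<bullet> h)) (at y)"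
    and G: "\<And>y. y \<in> S \<Longrightarrow> (G has_derivative H y) (at y)"
    and contH: "\<And>i. i \<in> Basis \<Longrightarrow> continuous_on S (\<lambda>y. H y i \<bullet> i)"
    and L: "\<And>y. y \<in> S \<Longrightarrow> L y = (\<Sum>i\<in>Basis. H y i \<bullet> i)"
    by (rule c2_lapE[OF c2]) (rule that; simp)
  note zero = bump_outside[OF \<open>0 < t\<close>, of _ x]
  \<comment> \<open>\<open>f\<close> and \<open>L\<close> are arbitrary off \<open>S\<close>. Each
    function below has a factor that vanishes off the closed ball, so continuity on \<open>S\<close>
    and on the complement of the ball glue to continuity on the whole space.\<close>
  have UNIV_eq: "(UNIV :: 'a set) = S \<union> - cball x t"
    using assms(3) by auto
  have contf: "continuous_on S f" "continuous_on S G"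
    by (rule has_derivative_continuous_on[OF has_derivative_at_withinI[OF f]],
        assumption, rule has_derivative_continuous_on[OF has_derivative_at_withinI[OF G]])
  define F' where "F' i y = f y * (bump_hess x t y i \<bullet> i) - bump x t y * (H y i \<bullet> i)" for i y
  have cont: "continuous_on UNIV K"
    if "continuous_on S K" "\<And>y. y \<notin> cball x t \<Longrightarrow> K y = 0" for K :: "'a \<Rightarrow> real"
    unfolding UNIV_eq
  proof (rule continuous_on_open_Un)
    have "continuous_on (- cball x t) K \<longleftrightarrow> continuous_on (- cball x t) (\<lambda>_. 0::real)"
      by (rule continuous_on_cong) (simp_all add: that(2))
    then show "continuous_on (- cball x t) K"
      by simp
  qed (use that assms in auto)
  note conts = continuous_on_subset[OF continuous_on_bump] continuous_on_subset[OF continuous_on_bump_grad]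
    continuous_on_subset[OF continuous_on_bump_hess]
  have cont_F': "continuous_on UNIV (F' i)" if "i \<in> Basis" for i
  proof (rule cont)
    show "continuous_on S (F' i)"
      unfolding F'_def
      by (intro continuous_on_diff continuous_on_mult continuous_on_inner continuous_on_const contf contH conts that) auto
  qed (simp add: F'_def zero)
  have F'_0: "integral\<^sup>L lborel (F' i) = 0" if i: "i \<in> Basis" for i
  proof (rule integral_directional_derivative_eq_0[where v=i and a=x and R=t])
    let ?F = "\<lambda>y. f y * (bump_grad x t y \<bullet> i) - bump x t y * (G y \<bullet> i)"
    show "continuous_on UNIV ?F"
      by (rule cont) (intro continuous_on_diff continuous_on_mult continuous_on_inner continuous_on_const contf conts, auto simp: zero)
    show "continuous_on UNIV (F' i)"
      by (rule cont_F'[OF i])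
    show "((\<lambda>s. ?F (y + s *\<^sub>R i)) has_real_derivative F' i y) (at 0)" for y
    proof (cases "y \<in> cball x t")
      case True
      then have y: "y \<in> S"
        using assms(3) by auto
      have "(?F has_derivative (\<lambda>h. (f y * (bump_hess x t y h \<bullet> i) + (G y \<bullet> h) * (bump_grad x t y \<bullet> i)) -
          (bump x t y * (H y h \<bullet> i) + (bump_grad x t y \<bullet> h) * (G y \<bullet> i)))) (at y)"
        by (intro has_derivative_diff has_derivative_mult has_derivative_inner_left
            f[OF y] G[OF y] bump_has_derivative bump_grad_has_derivative)
      from has_real_derivative_along[OF this, of i] show ?thesis
        by (simp add: F'_def algebra_simps)
    next
      case False
      have "((\<lambda>_. 0::real) has_derivative (\<lambda>_. 0)) (at y)"
        by simp
      then have "(?F has_derivative (\<lambda>_. 0)) (at y)"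
        by (rule has_derivative_transform_within_open[where s="- cball x t"])
           (use False zero in auto)
      from has_real_derivative_along[OF this, of i] show ?thesis
        using False zero by (simp add: F'_def)
    qed
  qed (simp_all add: F'_def zero)
  have int_F': "integrable lborel (F' i)" if "i \<in> Basis" for i
    by (rule integrable_continuous_compact_support[OF cont_F'[OF that], of x t]) (simp add: F'_def zero)
  have sum_F': "(\<Sum>i\<in>Basis. F' i y) = f y * laplacian (bump x t) y - L y * bump x t y" for y
  proof (cases "y \<in> S")
    case True
    then show ?thesis
      by (simp add: F'_def L laplacian_bump_eq_trace sum_subtractf sum_distrib_left mult.commute)
  next
    case False
    then have "y \<notin> cball x t"
      using assms(3) by auto
    then show ?thesis
      by (simp add: F'_def laplacian_bump_eq_trace zero)
  qed
  have lap: "integrable lborel (\<lambda>y. f y * laplacian (bump x t) y)"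
    by (rule integrable_continuous_compact_support[OF cont, where a=x and R=t])
       (unfold laplacian_bump_eq_trace,
        intro continuous_on_mult continuous_on_sum continuous_on_inner continuous_on_const contf conts,
        auto simp: zero)
  have "continuous_on S L \<longleftrightarrow> continuous_on S (\<lambda>y. \<Sum>i\<in>Basis. H y i \<bullet> i)"
    by (rule continuous_on_cong) (simp_all add: L)
  then have "continuous_on S L"
    by (simp add: continuous_on_sum contH)
  then have bmp: "integrable lborel (\<lambda>y. L y * bump x t y)"
    by (intro integrable_continuous_compact_support[OF cont, where a=x and R=t] continuous_on_mult conts) (auto simp: zero)
  have "0 = (LINT y|lborel. (\<Sum>i\<in>Basis. F' i y))"
    by (simp add: Bochner_Integration.integral_sum int_F' F'_0)
  also have "\<dots> = (LINT y|lborel. f y * laplacian (bump x t) y) - (LINT y|lborel. L y * bump x t y)"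
    unfolding sum_F' by (rule Bochner_Integration.integral_diff[OF lap bmp])
  finally show ?thesis by simp
qed

lemma continuous_imp_integrable_cball:
  fixes f :: "'a::euclidean_space \<Rightarrow> real"
  assumes "continuous_on (cball x r) f"
  shows "integrable lborel (\<lambda>y. indicator (cball x r) y * f y)"
  using borel_integrable_compact[OF compact_cball assms] by simp

lemma avg_integrable_continuous:
  fixes f :: "'a::euclidean_space \<Rightarrow> real"
  assumes [measurable]: "f \<in> borel_measurable borel" and "continuous_on (cball x r) f" "0 < r"
  shows "integrable lborel (\<lambda>z. mollifier z * f (x + r *\<^sub>R z))"
proof (rule avg_integrable[OF assms(1,3)])
  show "integrable lborel (\<lambda>y. indicator (ball x r) y * f y)"
    by (rule Bochner_Integration.integrable_bound[OF continuous_imp_integrable_cball[OF assms(2)]])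
       (auto simp: indicator_def)
qed

text \<open>The bump is nonnegative, so the Green identity gives the sign required by
  \<open>avg_mono_radius\<close>, and continuity identifies the limit of the averages at vanishing
  radius with \<open>f x\<close>.\<close>

lemma avg_subharmonic:
  fixes f :: "'a::euclidean_space \<Rightarrow> real"
  assumes c2: "c2_lap S f L" and "open S" "cball x R \<subseteq> S" "0 < r" "r < R"
    and [measurable]: "f \<in> borel_measurable borel" and nonneg: "\<And>y. y \<in> S \<Longrightarrow> 0 \<le> L y"
  shows "f x \<le> avg f r x"
proof -
  have cont: "continuous_on (cball x R) f"
    by (rule continuous_on_subset[OF c2_lap_continuous[OF c2] assms(3)])
  have mono: "avg f (r / Suc k) x \<le> avg f r x" for k
  proof (rule avg_mono_radius[OF assms(6) continuous_imp_integrable_cball[OF cont]])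
    fix t assume t: "0 < t" "t < R"
    then have "cball x t \<subseteq> S"
      using assms(3) by auto
    then have "(LINT y|lborel. f y * laplacian (bump x t) y) = (LINT y|lborel. L y * bump x t y)"
      using green_bump[OF c2 \<open>open S\<close> _ t(1)] by simp
    also have "\<dots> \<ge> 0"
    proof (rule Bochner_Integration.integral_nonneg)
      fix y show "0 \<le> L y * bump x t y"
        using nonneg[of y] bump_outside(1)[OF t(1), of y x] \<open>cball x t \<subseteq> S\<close> flat_exp_0_nonneg
        by (cases "y \<in> cball x t") (auto simp: bump_def)
    qed
    finally show "0 \<le> (LINT y|lborel. f y * laplacian (bump x t) y)" .
  qed (use assms in \<open>simp_all add: divide_le_eq mult_le_cancel_left1\<close>)
  have "bounded (f ` cball x R)"
    by (intro compact_imp_bounded compact_continuous_image cont) auto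
  then obtain B where B: "\<forall>z\<in>f ` cball x R. norm z \<le> B"
    unfolding bounded_iff by blast
  have "x \<in> S"
    using assms(3-5) by force
  then have "isCont f x"
    using c2_lap_continuous[OF c2] \<open>open S\<close> by (simp add: continuous_on_eq_continuous_at)
  then have "(\<lambda>k. avg f (r / Suc k) x) \<longlonglongrightarrow> f x"
    by (rule avg_tendsto[OF assms(6), where B=B]) (use B assms(4,5) in auto)
  then show ?thesis
    using mono by (intro LIMSEQ_le_const2) auto
qed

definition mollifier_moment :: "'a::euclidean_space itself \<Rightarrow> real" where
  "mollifier_moment _ = (LINT z|lborel. mollifier (z::'a) * (z \<bullet> z))"

lemma integrable_mollifier_moment: "integrable lborel (\<lambda>z::'a::euclidean_space. mollifier z * (z \<bullet> z))"
  by (rule integrable_continuous_compact_support[of _ 0 1])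
     (auto simp: mollifier_eq_0 intro!: continuous_on_mult continuous_on_inner continuous_on_mollifier continuous_on_id)

lemma mollifier_moment_pos: "0 < mollifier_moment TYPE('a::euclidean_space)"
  unfolding mollifier_moment_def
  by (rule integral_pos_if_pos_on_ball[where a=0 and e=1])
     (use integrable_mollifier_moment in \<open>auto simp: mollifier_nonneg mollifier_pos\<close>)

text \<open>Adding k |y - x|^2 with 2 n k = c leaves the Laplacian nonpositive, and the average of
  the added term at x is exactly k r^2 times the second moment. This is the source of the strict
  gain.\<close>

lemma avg_superharmonic:
  fixes f :: "'a::euclidean_space \<Rightarrow> real"
  assumes c2: "c2_lap S f L" and "open S" "cball x R \<subseteq> S" "0 < r" "r < R"
    and [measurable]: "f \<in> borel_measurable borel" and le: "\<And>y. y \<in> S \<Longrightarrow> L y \<le> - c"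
  shows "avg f r x \<le> f x - c * mollifier_moment TYPE('a) / (2 * real DIM('a)) * r\<^sup>2"
proof -
  define k where "k = c / (2 * real DIM('a))"
  let ?g = "\<lambda>y. (-1) * (f y + k * ((y - x) \<bullet> (y - x)))"
  have g: "c2_lap S ?g (\<lambda>y. (-1) * (L y + k * (2 * real DIM('a))))"
    by (intro c2_lap_cmult c2_lap_add c2 c2_lap_square_dist)
  have cont: "continuous_on (cball x r) f"
    by (rule continuous_on_subset[OF c2_lap_continuous[OF c2]]) (use assms(3,5) in force)
  have int: "integrable lborel (\<lambda>z. mollifier z * f (x + r *\<^sub>R z))"
    by (rule avg_integrable_continuous[OF assms(6) cont \<open>0 < r\<close>])
  have "?g x \<le> avg ?g r x"
  proof (rule avg_subharmonic[OF g assms(2-5)])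
    show "0 \<le> (-1) * (L y + k * (2 * real DIM('a)))" if "y \<in> S" for y
      using le[OF that] by (simp add: k_def)
  qed measurable
  also have "avg ?g r x =
      (LINT z|lborel. - (mollifier z * f (x + r *\<^sub>R z)) - (k * r\<^sup>2) * (mollifier z * (z \<bullet> z)))"
    unfolding avg_def
    by (intro Bochner_Integration.integral_cong) (simp_all add: algebra_simps power2_eq_square)
  also have "\<dots> = - avg f r x - (k * r\<^sup>2) * mollifier_moment TYPE('a)"
    unfolding avg_def mollifier_moment_def
    using int integrable_mollifier_moment[where 'a='a] by (simp add: Bochner_Integration.integral_diff)
  finally show ?thesis
    by (simp add: k_def mult_ac)
qed

section \<open>The local barrier\<close>

text \<open>Every term of the barrier has this form. Powers of the squared distance q avoid
  differentiating the norm; the formula is the product rule with |grad q|^2 = 4 q, grad q . \<nu> =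
  2 t and Laplacian of q equal to 2 n.\<close>

lemma c2_lap_monomial:
  fixes \<nu> p :: "'a::euclidean_space" and P P' P'' :: "real \<Rightarrow> real"
  assumes P: "\<And>t. (P has_real_derivative P' t) (at t)" "\<And>t. (P' has_real_derivative P'' t) (at t)"
    and P'': "continuous_on UNIV P''" and \<nu>: "norm \<nu> = 1"
  defines "t \<equiv> \<lambda>y. (y - p) \<bullet> \<nu>" and "q \<equiv> \<lambda>y. (y - p) \<bullet> (y - p)"
  shows "c2_lap (- {p}) (\<lambda>y. P (t y) * q y powr s)
    (\<lambda>y. P'' (t y) * q y powr s + 4 * s * P' (t y) * t y * q y powr (s - 1) +
      P (t y) * (4 * s * (s - 1) + 2 * s * real DIM('a)) * q y powr (s - 1))"
proof -
  define G where "G y = (P' (t y) * q y powr s) *\<^sub>R \<nu> + (2 * s * (P (t y) * q y powr (s - 1))) *\<^sub>R (y - p)" for y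
  define H where "H y h =
      (P' (t y) * (2 * s * q y powr (s - 1) * ((y - p) \<bullet> h)) + P'' (t y) * (h \<bullet> \<nu>) * q y powr s) *\<^sub>R \<nu> +
      ((2 * s * (P (t y) * q y powr (s - 1))) *\<^sub>R h +
       (2 * s * (P (t y) * (2 * (s - 1) * q y powr (s - 2) * ((y - p) \<bullet> h)) +
          P' (t y) * (h \<bullet> \<nu>) * q y powr (s - 1))) *\<^sub>R (y - p))" for y h
  have q_pos: "0 < q y" if "y \<in> - {p}" for y
    using that by (simp add: q_def)
  have dt: "(t has_derivative (\<lambda>h. h \<bullet> \<nu>)) (at y)" for y
    unfolding t_def by (auto intro!: derivative_eq_intros)
  have dq: "(q has_derivative (\<lambda>h. 2 * ((y - p) \<bullet> h))) (at y)" for y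
    unfolding q_def by (auto intro!: derivative_eq_intros simp: inner_commute)
  have dP: "((\<lambda>y. P (t y)) has_derivative (\<lambda>h. P' (t y) * (h \<bullet> \<nu>))) (at y)" for y
    using has_derivative_compose[OF dt P(1)[unfolded has_field_derivative_def]] .
  have dP': "((\<lambda>y. P' (t y)) has_derivative (\<lambda>h. P'' (t y) * (h \<bullet> \<nu>))) (at y)" for y
    using has_derivative_compose[OF dt P(2)[unfolded has_field_derivative_def]] .
  have dpow: "((\<lambda>y. q y powr r) has_derivative (\<lambda>h. 2 * r * q y powr (r - 1) * ((y - p) \<bullet> h))) (at y)"
    if "y \<in> - {p}" for y r
  proof -
    have "((\<lambda>z. z powr r) has_real_derivative r * q y powr (r - 1)) (at (q y))"
      by (rule has_real_derivative_powr[OF q_pos[OF that]])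
    from has_derivative_compose[OF dq this[unfolded has_field_derivative_def]] show ?thesis
      by (simp add: mult_ac)
  qed
  show ?thesis
  proof (rule c2_lapI[where G=G and H=H])
    fix y assume y: "y \<in> - {p}"
    show "((\<lambda>y. P (t y) * q y powr s) has_derivative (\<lambda>h. G y \<bullet> h)) (at y)"
      by (rule has_derivative_eq_rhs[OF has_derivative_mult[OF dP dpow[OF y]]])
         (simp add: G_def inner_add_left inner_commute[of \<nu>] mult_ac add.commute)
    have "((\<lambda>y. 2 * s * (P (t y) * q y powr (s - 1))) has_derivative
        (\<lambda>h. 2 * s * (P (t y) * (2 * (s - 1) * q y powr (s - 1 - 1) * ((y - p) \<bullet> h)) +
          P' (t y) * (h \<bullet> \<nu>) * q y powr (s - 1)))) (at y)"
      by (intro has_derivative_mult_right has_derivative_mult dP dpow[OF y])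
    then have 1: "((\<lambda>y. 2 * s * (P (t y) * q y powr (s - 1))) has_derivative
        (\<lambda>h. 2 * s * (P (t y) * (2 * (s - 1) * q y powr (s - 2) * ((y - p) \<bullet> h)) +
          P' (t y) * (h \<bullet> \<nu>) * q y powr (s - 1)))) (at y)"
      by simp
    have 2: "((\<lambda>y. y - p) has_derivative (\<lambda>h. h)) (at y)"
      by (auto intro!: derivative_eq_intros)
    have 3: "((\<lambda>y. (P' (t y) * q y powr s) *\<^sub>R \<nu>) has_derivative
      (\<lambda>h. (P' (t y) * (2 * s * q y powr (s - 1) * ((y - p) \<bullet> h)) + P'' (t y) * (h \<bullet> \<nu>) * q y powr s) *\<^sub>R \<nu>)) (at y)"
      by (intro has_derivative_scaleR_left has_derivative_mult dP' dpow[OF y])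
    show "(G has_derivative H y) (at y)"
      unfolding G_def[abs_def] H_def
      by (rule has_derivative_add[OF 3 has_derivative_scaleR[OF 1 2]])
    \<comment> \<open>The trace of a combination of rank-one maps and the identity: summing (a . i)
      (b . i) over the basis gives a . b.\<close>
    have *: "(\<Sum>i\<in>Basis. ((A * ((y - p) \<bullet> i) + B * (i \<bullet> \<nu>) * B') *\<^sub>R \<nu> + (E *\<^sub>R i +
        (C * (D * ((y - p) \<bullet> i) + F * (i \<bullet> \<nu>) * F')) *\<^sub>R (y - p))) \<bullet> i) =
        A * t y + B * B' + E * real DIM('a) + C * D * q y + C * F * F' * t y" for A B B' C D E F F'
    proof -
      have "(\<Sum>i\<in>Basis. ((A * ((y - p) \<bullet> i) + B * (i \<bullet> \<nu>) * B') *\<^sub>R \<nu> + (E *\<^sub>R i +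
        (C * (D * ((y - p) \<bullet> i) + F * (i \<bullet> \<nu>) * F')) *\<^sub>R (y - p))) \<bullet> i) =
        (\<Sum>i\<in>Basis. A * (((y - p) \<bullet> i) * (\<nu> \<bullet> i)) + B * B' * ((\<nu> \<bullet> i) * (\<nu> \<bullet> i)) + E +
          C * D * (((y - p) \<bullet> i) * ((y - p) \<bullet> i)) + C * F * F' * (((y - p) \<bullet> i) * (\<nu> \<bullet> i)))"
        by (intro sum.cong refl) (simp add: inner_add_left inner_commute[of _ \<nu>] algebra_simps)
      also have "\<dots> = A * ((y - p) \<bullet> \<nu>) + B * B' * (\<nu> \<bullet> \<nu>) + E * real DIM('a) +
          C * D * ((y - p) \<bullet> (y - p)) + C * F * F' * ((y - p) \<bullet> \<nu>)"
        by (simp only: sum.distrib sum_distrib_left[symmetric] euclidean_inner[symmetric]) simp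
      also have "\<nu> \<bullet> \<nu> = 1"
        using \<nu> by (simp add: norm_eq_1)
      finally show ?thesis
        by (simp add: t_def q_def)
    qed
    have pw: "q y powr (s - 2) * q y = q y powr (s - 1)"
      using q_pos[OF y] powr_add[of "q y" "s - 2" 1] by simp
    have "(\<Sum>i\<in>Basis. H y i \<bullet> i) = P' (t y) * (2 * s * q y powr (s - 1)) * t y + P'' (t y) * q y powr s +
        2 * s * (P (t y) * q y powr (s - 1)) * real DIM('a) +
        2 * s * (P (t y) * (2 * (s - 1))) * (q y powr (s - 2) * q y) + 2 * s * P' (t y) * q y powr (s - 1) * t y"
      unfolding H_def using *[of "P' (t y) * (2 * s * q y powr (s - 1))" "P'' (t y)" "q y powr s"
          "2 * s * (P (t y) * q y powr (s - 1))" "2 * s" "P (t y) * (2 * (s - 1) * q y powr (s - 2))" "P' (t y)" "q y powr (s - 1)"]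
      by (simp add: mult.assoc)
    also have "\<dots> = P'' (t y) * q y powr s + 4 * s * P' (t y) * t y * q y powr (s - 1) +
      P (t y) * (4 * s * (s - 1) + 2 * s * real DIM('a)) * q y powr (s - 1)"
      unfolding pw by (simp add: algebra_simps)
    finally show "P'' (t y) * q y powr s + 4 * s * P' (t y) * t y * q y powr (s - 1) +
      P (t y) * (4 * s * (s - 1) + 2 * s * real DIM('a)) * q y powr (s - 1) = (\<Sum>i\<in>Basis. H y i \<bullet> i)" ..
  next
    fix i :: 'a assume "i \<in> Basis"
    have "continuous_on (- {p}) t" "continuous_on (- {p}) q"
      unfolding t_def q_def by (intro continuous_intros)+
    moreover have "continuous_on (- {p}) (\<lambda>y. K (t y))" if "continuous_on UNIV K" for K :: "real \<Rightarrow> real"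
      by (rule continuous_on_compose2[OF that]) (use calculation in auto)
    moreover have "continuous_on UNIV P" "continuous_on UNIV P'"
      using P by (auto intro!: continuous_at_imp_continuous_on DERIV_isCont)
    ultimately show "continuous_on (- {p}) (\<lambda>y. H y i \<bullet> i)"
      unfolding H_def using P'' q_pos
      by (intro continuous_intros) (auto simp: less_imp_neq[symmetric])
  qed
qed

text \<open>Exponents are halved because q is the squared distance. Let \<tau> = t / \<rho>. With b
  = \<alpha> / (n + 1) the unfavourable part of the last term's Laplacian is at most \<alpha> n
  \<tau>^2 \<rho>^(\<alpha>-1), and for 0 <= \<tau> <= 1 it is absorbed by the contribution -
  \<alpha> (\<alpha> + n) \<tau> \<rho>^(\<alpha>-1) of the first correction.\<close>

definition barrier :: "real \<Rightarrow> 'a::euclidean_space \<Rightarrow> 'a \<Rightarrow> 'a \<Rightarrow> real" where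
  "barrier \<alpha> \<nu> p y = (let t = (y - p) \<bullet> \<nu>; q = (y - p) \<bullet> (y - p); n = real DIM('a); b = \<alpha> / (n + 1) in
     t - t * q powr (\<alpha> / 2) + b * q powr ((1 + \<alpha>) / 2) - b * n * t\<^sup>2 * q powr ((\<alpha> - 1) / 2))"

definition barrier_lap :: "real \<Rightarrow> 'a::euclidean_space \<Rightarrow> 'a \<Rightarrow> 'a \<Rightarrow> real" where
  "barrier_lap \<alpha> \<nu> p y = (let t = (y - p) \<bullet> \<nu>; q = (y - p) \<bullet> (y - p); n = real DIM('a); b = \<alpha> / (n + 1) in
     - \<alpha> * (\<alpha> + n) * t * q powr (\<alpha> / 2 - 1) + b * (1 + \<alpha>) * (n - 1 + \<alpha>) * q powr ((\<alpha> - 1) / 2) -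
     b * n * (2 * q powr ((\<alpha> - 1) / 2) - (1 - \<alpha>) * (n + 1 + \<alpha>) * t\<^sup>2 * q powr ((\<alpha> - 1) / 2 - 1)))"

lemma barrier_c2_lap:
  fixes \<nu> p :: "'a::euclidean_space"
  assumes "norm \<nu> = 1"
  shows "c2_lap (- {p}) (barrier \<alpha> \<nu> p) (barrier_lap \<alpha> \<nu> p)"
proof -
  define n where "n = real DIM('a)"
  define b where "b = \<alpha> / (n + 1)"
  let ?t = "\<lambda>y. (y - p) \<bullet> \<nu>" and ?q = "\<lambda>y. (y - p) \<bullet> (y - p)"
  note mono = c2_lap_monomial[OF _ _ _ assms, of _ _ _ p, folded n_def]
  have 1: "c2_lap (- {p}) (\<lambda>y. ?t y * ?q y powr s)
      (\<lambda>y. 0 * ?q y powr s + 4 * s * 1 * ?t y * ?q y powr (s - 1) +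
        ?t y * (4 * s * (s - 1) + 2 * s * n) * ?q y powr (s - 1))" for s
    by (rule mono) (auto intro!: derivative_eq_intros)
  have 2: "c2_lap (- {p}) (\<lambda>y. 1 * ?q y powr s)
      (\<lambda>y. 0 * ?q y powr s + 4 * s * 0 * ?t y * ?q y powr (s - 1) +
        1 * (4 * s * (s - 1) + 2 * s * n) * ?q y powr (s - 1))" for s
    by (rule mono) (auto intro!: derivative_eq_intros)
  have 3: "c2_lap (- {p}) (\<lambda>y. (?t y)\<^sup>2 * ?q y powr s)
      (\<lambda>y. 2 * ?q y powr s + 4 * s * (2 * ?t y) * ?t y * ?q y powr (s - 1) +
        (?t y)\<^sup>2 * (4 * s * (s - 1) + 2 * s * n) * ?q y powr (s - 1))" for s
    by (rule mono) (auto intro!: derivative_eq_intros)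
  \<comment> \<open>The linear term t also enters as a monomial, with exponent 0;
    \<open>q powr 0\<close> is 1 only away from \<open>p\<close>, where the identity is
    needed.\<close>
  note sum = c2_lap_add[OF c2_lap_add[OF 1[of 0] c2_lap_cmult[OF 1[of "\<alpha> / 2"], of "-1"]]
      c2_lap_add[OF c2_lap_cmult[OF 2[of "(1 + \<alpha>) / 2"], of b] c2_lap_cmult[OF 3[of "(\<alpha> - 1) / 2"], of "- b * n"]]]
  show ?thesis
  proof (rule c2_lap_cong[OF _ sum])
    fix y assume "y \<in> - {p}"
    then have "?q y powr 0 = 1"
      by simp
    then show "barrier \<alpha> \<nu> p y = ?t y * ?q y powr 0 + (-1) * (?t y * ?q y powr (\<alpha> / 2)) +
        (b * (1 * ?q y powr ((1 + \<alpha>) / 2)) + (- b * n) * ((?t y)\<^sup>2 * ?q y powr ((\<alpha> - 1) / 2)))"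
      unfolding barrier_def Let_def n_def[symmetric] b_def[symmetric] by (simp add: mult.assoc)
    have e: "(1 + \<alpha>) / 2 - 1 = (\<alpha> - 1) / 2"
      by simp
    have X: "4 * (\<alpha> / 2) * 1 + (4 * (\<alpha> / 2) * (\<alpha> / 2 - 1) + 2 * (\<alpha> / 2) * n) = \<alpha> * (\<alpha> + n)"
      "4 * ((1 + \<alpha>) / 2) * ((\<alpha> - 1) / 2) + 2 * ((1 + \<alpha>) / 2) * n = (1 + \<alpha>) * (n - 1 + \<alpha>)"
      "4 * ((\<alpha> - 1) / 2) * 2 + (4 * ((\<alpha> - 1) / 2) * ((\<alpha> - 1) / 2 - 1) + 2 * ((\<alpha> - 1) / 2) * n) = - ((1 - \<alpha>) * (n + 1 + \<alpha>))"
      by (simp_all add: field_simps power2_eq_square)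
    define t Q1 Q2 Q3 where "t = ?t y" "Q1 = ?q y powr (\<alpha> / 2 - 1)" "Q2 = ?q y powr ((\<alpha> - 1) / 2)"
      "Q3 = ?q y powr ((\<alpha> - 1) / 2 - 1)"
    have "barrier_lap \<alpha> \<nu> p y = - (\<alpha> * (\<alpha> + n)) * t * Q1 + b * ((1 + \<alpha>) * (n - 1 + \<alpha>) * Q2) -
       b * n * (2 * Q2 + - ((1 - \<alpha>) * (n + 1 + \<alpha>)) * t\<^sup>2 * Q3)"
      unfolding barrier_lap_def Let_def n_def[symmetric] b_def[symmetric] t_Q1_Q2_Q3_def
      by (simp add: mult.assoc)
    also have "\<dots> = (-1) * (0 + 4 * (\<alpha> / 2) * 1 * t * Q1 + t * (4 * (\<alpha> / 2) * (\<alpha> / 2 - 1) + 2 * (\<alpha> / 2) * n) * Q1) +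
        (b * (1 * (4 * ((1 + \<alpha>) / 2) * ((\<alpha> - 1) / 2) + 2 * ((1 + \<alpha>) / 2) * n) * Q2) +
         (- b * n) * (2 * Q2 + 4 * ((\<alpha> - 1) / 2) * (2 * t) * t * Q3 +
            t\<^sup>2 * (4 * ((\<alpha> - 1) / 2) * ((\<alpha> - 1) / 2 - 1) + 2 * ((\<alpha> - 1) / 2) * n) * Q3))"
      unfolding X[symmetric] by (simp add: field_simps power2_eq_square)
    finally show "barrier_lap \<alpha> \<nu> p y =
      (0 * ?q y powr 0 + 4 * 0 * 1 * ?t y * ?q y powr (0 - 1) + ?t y * (4 * 0 * (0 - 1) + 2 * 0 * n) * ?q y powr (0 - 1)) +
      (-1) * (0 * ?q y powr (\<alpha> / 2) + 4 * (\<alpha> / 2) * 1 * ?t y * ?q y powr (\<alpha> / 2 - 1) +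
        ?t y * (4 * (\<alpha> / 2) * (\<alpha> / 2 - 1) + 2 * (\<alpha> / 2) * n) * ?q y powr (\<alpha> / 2 - 1)) +
      (b * (0 * ?q y powr ((1 + \<alpha>) / 2) + 4 * ((1 + \<alpha>) / 2) * 0 * ?t y * ?q y powr ((1 + \<alpha>) / 2 - 1) +
        1 * (4 * ((1 + \<alpha>) / 2) * ((1 + \<alpha>) / 2 - 1) + 2 * ((1 + \<alpha>) / 2) * n) * ?q y powr ((1 + \<alpha>) / 2 - 1)) +
       (- b * n) * (2 * ?q y powr ((\<alpha> - 1) / 2) + 4 * ((\<alpha> - 1) / 2) * (2 * ?t y) * ?t y * ?q y powr ((\<alpha> - 1) / 2 - 1) +
        (?t y)\<^sup>2 * (4 * ((\<alpha> - 1) / 2) * ((\<alpha> - 1) / 2 - 1) + 2 * ((\<alpha> - 1) / 2) * n) * ?q y powr ((\<alpha> - 1) / 2 - 1)))"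
      unfolding e t_Q1_Q2_Q3_def by simp
  qed auto
qed

text \<open>By homogeneity the Laplacian is X(\<tau>) \<rho>^(\<alpha>-1) with \<tau> = t / \<rho>,
  and \<rho>^(\<alpha>-1) >= 1 because \<rho> <= 1. Since (1 + \<alpha>) (n - 1 + \<alpha>) <= 3 n /
  2, the terms without \<tau> give at most - b n / 2. The terms in \<tau> are nonpositive for \<tau>
  >= 0; in the thin cone below the tangent plane each is at most \<alpha>^2 / 16, and \<alpha>^2 / 8
  <= b n / 4.\<close>

lemma barrier_lap_le:
  fixes \<nu> p y :: "'a::euclidean_space"
  defines "n \<equiv> real DIM('a)"
  assumes \<nu>: "norm \<nu> = 1" and \<alpha>: "0 < \<alpha>" "\<alpha> \<le> 1 / 2"
    and y: "y \<noteq> p" "norm (y - p) \<le> 1" and t: "- (\<alpha> / (16 * (n + 1))) * norm (y - p) \<le> (y - p) \<bullet> \<nu>"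
  shows "barrier_lap \<alpha> \<nu> p y \<le> - (\<alpha> / (n + 1) * n / 4)"
proof -
  define b where "b = \<alpha> / (n + 1)"
  define \<rho> where "\<rho> = norm (y - p)"
  define \<tau> where "\<tau> = ((y - p) \<bullet> \<nu>) / \<rho>"
  have "1 \<le> n"
    using DIM_positive[where 'a='a] by (simp add: n_def Suc_le_eq)
  have "0 < \<rho>" "\<rho> \<le> 1"
    using y by (auto simp: \<rho>_def)
  have bn: "b * (n + 1) = \<alpha>" "0 < b"
    using \<open>1 \<le> n\<close> \<alpha> by (simp_all add: b_def)
  have t_eq: "(y - p) \<bullet> \<nu> = \<tau> * \<rho>"
    using \<open>0 < \<rho>\<close> by (simp add: \<tau>_def)
  have q_eq: "(y - p) \<bullet> (y - p) = \<rho> powr 2"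
    using \<open>0 < \<rho>\<close> by (simp add: \<rho>_def power2_norm_eq_inner[symmetric])
  have "\<bar>(y - p) \<bullet> \<nu>\<bar> \<le> \<rho>"
    using Cauchy_Schwarz_ineq2[of "y - p" \<nu>] \<nu> by (simp add: \<rho>_def)
  then have "\<tau> \<le> 1"
    using \<open>0 < \<rho>\<close> by (simp add: \<tau>_def divide_le_eq)
  have \<tau>_ge: "- (\<alpha> / (16 * (n + 1))) \<le> \<tau>"
    using t \<open>0 < \<rho>\<close> by (simp add: \<tau>_def \<rho>_def le_divide_eq)
  define X where "X = - \<alpha> * (\<alpha> + n) * \<tau> + b * ((1 + \<alpha>) * (n - 1 + \<alpha>)) - b * n * (2 - (1 - \<alpha>) * (n + 1 + \<alpha>) * \<tau>\<^sup>2)"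
  have pw: "\<rho> * \<rho> powr (\<alpha> - 2) = \<rho> powr (\<alpha> - 1)" "\<rho>\<^sup>2 * \<rho> powr (\<alpha> - 3) = \<rho> powr (\<alpha> - 1)"
  proof -
    have "\<rho> powr 1 * \<rho> powr (\<alpha> - 2) = \<rho> powr (\<alpha> - 1)" "\<rho> powr 2 * \<rho> powr (\<alpha> - 3) = \<rho> powr (\<alpha> - 1)"
      by (simp_all only: powr_add[symmetric]) (simp_all add: algebra_simps)
    then show "\<rho> * \<rho> powr (\<alpha> - 2) = \<rho> powr (\<alpha> - 1)" "\<rho>\<^sup>2 * \<rho> powr (\<alpha> - 3) = \<rho> powr (\<alpha> - 1)"
      using \<open>0 < \<rho>\<close> by simp_all
  qed
  have ex: "2 * (\<alpha> / 2 - 1) = \<alpha> - 2" "2 * ((\<alpha> - 1) / 2) = \<alpha> - 1" "2 * ((\<alpha> - 1) / 2 - 1) = \<alpha> - 3"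
    by (simp_all add: field_simps)
  have "barrier_lap \<alpha> \<nu> p y = - \<alpha> * (\<alpha> + n) * \<tau> * (\<rho> * \<rho> powr (\<alpha> - 2)) + b * ((1 + \<alpha>) * (n - 1 + \<alpha>)) * \<rho> powr (\<alpha> - 1) -
     b * n * (2 * \<rho> powr (\<alpha> - 1) - (1 - \<alpha>) * (n + 1 + \<alpha>) * \<tau>\<^sup>2 * (\<rho>\<^sup>2 * \<rho> powr (\<alpha> - 3)))"
    unfolding barrier_lap_def Let_def t_eq q_eq powr_powr n_def[symmetric] b_def[symmetric] ex
    by (simp add: power_mult_distrib mult.assoc)
  also have "\<dots> = X * \<rho> powr (\<alpha> - 1)"
    unfolding pw X_def by (simp add: algebra_simps)
  finally have lap_eq: "barrier_lap \<alpha> \<nu> p y = X * \<rho> powr (\<alpha> - 1)" .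
  have \<alpha>2: "\<alpha>\<^sup>2 \<le> 1"
    using \<alpha> by (intro power_le_one) auto
  have "\<alpha> * n \<le> 1 / 2 * n"
    using \<alpha> \<open>1 \<le> n\<close> by (intro mult_right_mono) auto
  then have 1: "(1 + \<alpha>) * (n - 1 + \<alpha>) \<le> 3 * n / 2"
    using \<alpha>2 by (simp add: algebra_simps power2_eq_square)
  have "0 \<le> \<alpha> * n"
    using \<alpha> \<open>1 \<le> n\<close> by simp
  then have 2: "(1 - \<alpha>) * (n + 1 + \<alpha>) \<le> n + 1"
    using zero_le_power2[of \<alpha>] by (simp add: algebra_simps power2_eq_square)
  have "b * ((1 + \<alpha>) * (n - 1 + \<alpha>)) \<le> b * (3 * n / 2)"
    using 1 bn by (intro mult_left_mono) auto
  moreover have "b * n * ((1 - \<alpha>) * (n + 1 + \<alpha>) * \<tau>\<^sup>2) \<le> b * n * ((n + 1) * \<tau>\<^sup>2)"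
    using 2 bn \<open>1 \<le> n\<close> by (intro mult_left_mono mult_right_mono) auto
  moreover have "b * n * ((n + 1) * \<tau>\<^sup>2) = \<alpha> * n * \<tau>\<^sup>2"
    using bn(1) by (metis mult.assoc mult.commute)
  ultimately have X_le: "X \<le> - \<alpha> * (\<alpha> + n) * \<tau> - b * n / 2 + \<alpha> * n * \<tau>\<^sup>2"
    unfolding X_def right_diff_distrib by linarith
  have "X \<le> - (b * n / 4)"
  proof (cases "0 \<le> \<tau>")
    case True
    then have "\<tau>\<^sup>2 \<le> \<tau>"
      using \<open>\<tau> \<le> 1\<close> by (simp add: power2_eq_square mult_left_le)
    then have "\<alpha> * n * \<tau>\<^sup>2 \<le> \<alpha> * n * \<tau>"
      using \<open>0 \<le> \<alpha> * n\<close> by (rule mult_left_mono)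
    moreover have "0 \<le> \<alpha> * \<alpha> * \<tau>"
      using True \<alpha> by simp
    moreover have "0 \<le> b * n"
      using bn \<open>1 \<le> n\<close> by simp
    moreover have "- \<alpha> * (\<alpha> + n) * \<tau> = - (\<alpha> * \<alpha> * \<tau>) - \<alpha> * n * \<tau>"
      by (simp add: algebra_simps)
    ultimately show ?thesis
      using X_le by linarith
  next
    case False
    define \<kappa> where "\<kappa> = \<alpha> / (16 * (n + 1))"
    have \<kappa>: "0 \<le> \<kappa>" "\<kappa> \<le> 1" "\<kappa> * (n + 1) = \<alpha> / 16" "- \<tau> \<le> \<kappa>"
      using \<alpha> \<open>1 \<le> n\<close> \<tau>_ge by (auto simp: \<kappa>_def field_simps)
    have "\<tau>\<^sup>2 \<le> \<kappa>"
    proof -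
      have "\<tau>\<^sup>2 = (- \<tau>) * (- \<tau>)"
        by (simp add: power2_eq_square)
      also have "\<dots> \<le> \<kappa> * 1"
        using False \<kappa> by (intro mult_mono) auto
      finally show ?thesis by simp
    qed
    then have "\<alpha> * n * \<tau>\<^sup>2 \<le> \<alpha> * n * \<kappa>"
      using \<open>0 \<le> \<alpha> * n\<close> by (rule mult_left_mono)
    moreover have "\<alpha> * (\<alpha> + n) * (- \<tau>) \<le> \<alpha> * (1 + n) * \<kappa>"
      using \<kappa> \<alpha> \<open>1 \<le> n\<close> False by (intro mult_mono) auto
    moreover have "\<alpha> * n * \<kappa> \<le> \<alpha> * (1 + n) * \<kappa>"
      using \<kappa> \<alpha> by (intro mult_right_mono mult_left_mono) auto
    moreover have "\<alpha> * (1 + n) * \<kappa> = \<alpha> * \<alpha> / 16"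
      using \<kappa>(3) by (simp add: mult_ac add.commute)
    moreover have "\<alpha> * \<alpha> / 8 \<le> b * n / 4"
    proof -
      have "\<alpha> * (n + 1) \<le> 1 / 2 * (n + 1)"
        using \<alpha> \<open>1 \<le> n\<close> by (intro mult_right_mono) auto
      also have "\<dots> \<le> 2 * n"
        using \<open>1 \<le> n\<close> by (simp add: field_simps)
      finally have "\<alpha> * (n + 1) \<le> 2 * n" .
      then have "b * (\<alpha> * (n + 1)) \<le> b * (2 * n)"
        using bn by (intro mult_left_mono) auto
      moreover have "b * (\<alpha> * (n + 1)) = \<alpha> * \<alpha>"
        using bn(1) by (simp add: mult.left_commute mult.commute)
      ultimately show ?thesis by simp
    qed
    ultimately show ?thesis
      using X_le by simp
  qed
  moreover have \<rho>1: "1 \<le> \<rho> powr (\<alpha> - 1)"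
    using powr_mono'[of "\<alpha> - 1" 0 \<rho>] \<open>0 < \<rho>\<close> \<open>\<rho> \<le> 1\<close> \<alpha> by simp
  ultimately have "X * \<rho> powr (\<alpha> - 1) \<le> - (b * n / 4) * \<rho> powr (\<alpha> - 1)"
    by (intro mult_right_mono) auto
  also have "\<dots> \<le> - (b * n / 4) * 1"
    using \<rho>1 bn \<open>1 \<le> n\<close> by (intro mult_left_mono_neg) auto
  finally have "X * \<rho> powr (\<alpha> - 1) \<le> - (b * n / 4) * 1" .
  then show ?thesis
    unfolding lap_eq by (simp add: b_def)
qed

lemma barrier_eq:
  fixes \<nu> p y :: "'a::euclidean_space"
  assumes "y \<noteq> p"
  defines "t \<equiv> (y - p) \<bullet> \<nu>" and "\<rho> \<equiv> norm (y - p)" and "n \<equiv> real DIM('a)"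
  shows "barrier \<alpha> \<nu> p y = t - t * \<rho> powr \<alpha> + \<alpha> / (n + 1) * (\<rho> * \<rho> powr \<alpha>) - \<alpha> / (n + 1) * n * (t\<^sup>2 * \<rho> powr \<alpha> / \<rho>)"
proof -
  have "0 < \<rho>"
    using assms by simp
  have q_eq: "(y - p) \<bullet> (y - p) = \<rho> powr 2"
    using \<open>0 < \<rho>\<close> by (simp add: \<rho>_def power2_norm_eq_inner[symmetric])
  have ex: "2 * (\<alpha> / 2) = \<alpha>" "2 * ((\<alpha> - 1) / 2) = \<alpha> - 1" "2 * ((1 + \<alpha>) / 2) = 1 + \<alpha>"
    by simp_all
  show ?thesis
    unfolding barrier_def Let_def q_eq powr_powr ex t_def[symmetric] n_def[symmetric]
    using \<open>0 < \<rho>\<close> by (simp add: powr_diff powr_add)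
qed

text \<open>Put A = \<rho>^\<alpha> <= 1/4. In the flat cone |t| <= b \<rho> / 16 the two negative
  corrections cost at most b \<rho> A / 16 each, so at least half of b \<rho> A survives. For t >= 0
  they cost at most 2 t A <= t / 2.\<close>

lemma barrier_bounds:
  fixes \<nu> p y :: "'a::euclidean_space"
  assumes \<nu>: "norm \<nu> = 1" and \<alpha>: "0 < \<alpha>" "\<alpha> \<le> 1 / 2" and "y \<noteq> p"
  defines "t \<equiv> (y - p) \<bullet> \<nu>" and "\<rho> \<equiv> norm (y - p)" and "b \<equiv> \<alpha> / (real DIM('a) + 1)"
  assumes \<rho>: "\<rho> powr \<alpha> \<le> 1 / 4"
  shows "barrier \<alpha> \<nu> p y \<le> 3 * \<rho>"
    and "\<bar>t\<bar> \<le> b / 16 * \<rho> \<Longrightarrow> t + b / 2 * (\<rho> * \<rho> powr \<alpha>) \<le> barrier \<alpha> \<nu> p y"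
    and "0 \<le> t \<Longrightarrow> t / 2 \<le> barrier \<alpha> \<nu> p y"
proof -
  define n where "n = real DIM('a)"
  define A where "A = \<rho> powr \<alpha>"
  have "1 \<le> n"
    using DIM_positive[where 'a='a] by (simp add: n_def Suc_le_eq)
  have "0 < \<rho>"
    using \<open>y \<noteq> p\<close> by (simp add: \<rho>_def)
  have A: "0 \<le> A" "A \<le> 1 / 4"
    using \<rho> by (auto simp: A_def)
  have b: "0 < b" "b \<le> 1" "b * n \<le> 1"
  proof -
    have "\<alpha> * n \<le> 1 * n"
      using \<alpha> \<open>1 \<le> n\<close> by (intro mult_right_mono) auto
    then have "\<alpha> * n \<le> n + 1"
      by linarith
    then show "0 < b" "b \<le> 1" "b * n \<le> 1"
      using \<alpha> \<open>1 \<le> n\<close> unfolding b_def n_def[symmetric] by (simp_all add: divide_le_eq)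
  qed
  have t\<rho>: "\<bar>t\<bar> \<le> \<rho>"
    using Cauchy_Schwarz_ineq2[of "y - p" \<nu>] \<nu> by (simp add: t_def \<rho>_def)
  have eq: "barrier \<alpha> \<nu> p y = t - t * A + b * (\<rho> * A) - b * n * (t\<^sup>2 * A / \<rho>)"
    using barrier_eq[OF \<open>y \<noteq> p\<close>] by (simp add: t_def \<rho>_def A_def b_def n_def)
  have sq: "0 \<le> b * n * (t\<^sup>2 * A / \<rho>)"
    using b A \<open>0 < \<rho>\<close> \<open>1 \<le> n\<close> by simp
  have sq_le: "t\<^sup>2 * A / \<rho> \<le> \<bar>t\<bar> * K * A" if "\<bar>t\<bar> \<le> K * \<rho>" for K
  proof -
    have "\<bar>t\<bar> * \<bar>t\<bar> \<le> \<bar>t\<bar> * (K * \<rho>)"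
      using that by (intro mult_left_mono) auto
    then have "t\<^sup>2 * A \<le> \<bar>t\<bar> * (K * \<rho>) * A"
      using A by (intro mult_right_mono) (auto simp: power2_eq_square)
    then show ?thesis
      using \<open>0 < \<rho>\<close> by (simp add: divide_le_eq mult_ac)
  qed
  show "barrier \<alpha> \<nu> p y \<le> 3 * \<rho>"
  proof -
    have "\<bar>t\<bar> * A \<le> \<rho> * 1"
      using t\<rho> A by (intro mult_mono) auto
    moreover have "- t * A \<le> \<bar>t\<bar> * A"
      using A by (intro mult_right_mono) auto
    moreover have "b * (\<rho> * A) \<le> 1 * (\<rho> * 1)"
      using b A \<open>0 < \<rho>\<close> by (intro mult_mono) auto
    ultimately show ?thesis
      using t\<rho> sq by (simp add: eq)
  qed
  show "t + b / 2 * (\<rho> * A) \<le> barrier \<alpha> \<nu> p y" if "\<bar>t\<bar> \<le> b / 16 * \<rho>"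
  proof -
    have "t * A \<le> b / 16 * (\<rho> * A)"
      using mult_right_mono[of t "b / 16 * \<rho>" A] that A by (simp add: mult.assoc)
    moreover have "b * n * (t\<^sup>2 * A / \<rho>) \<le> b / 16 * (\<rho> * A)"
    proof -
      have "b * n * (t\<^sup>2 * A / \<rho>) \<le> 1 * (t\<^sup>2 * A / \<rho>)"
        using b A \<open>0 < \<rho>\<close> by (intro mult_right_mono) auto
      also have "\<dots> \<le> \<bar>t\<bar> * (b / 16) * A"
        using sq_le[OF that] by simp
      also have "\<dots> \<le> \<rho> * (b / 16) * A"
        using t\<rho> b A by (intro mult_right_mono) auto
      finally show ?thesis by (simp add: mult_ac)
    qed
    moreover have "0 \<le> b * (\<rho> * A)"
      using b A \<open>0 < \<rho>\<close> by simp
    ultimately show ?thesis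
      unfolding eq by linarith
  qed
  show "t / 2 \<le> barrier \<alpha> \<nu> p y" if "0 \<le> t"
  proof -
    have "t * A \<le> t * (1 / 4)"
      using that A by (intro mult_left_mono)
    moreover have "b * n * (t\<^sup>2 * A / \<rho>) \<le> 1 * (t\<^sup>2 * A / \<rho>)"
      using b A \<open>0 < \<rho>\<close> by (intro mult_right_mono) auto
    moreover have "t\<^sup>2 * A / \<rho> \<le> t * A"
      using sq_le[of 1] t\<rho> that by simp
    moreover have "0 \<le> b * (\<rho> * A)"
      using b A \<open>0 < \<rho>\<close> by simp
    ultimately show ?thesis
      unfolding eq by linarith
  qed
qed

section \<open>Local geometry of the domain\<close>

text \<open>A segment from inside \<open>S\<close> to outside \<open>S\<close> meets the frontier,
  no farther from \<open>x\<close> than \<open>y\<close> is.\<close>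

lemma infdist_frontier_le_dist:
  fixes x y :: "'a::euclidean_space"
  assumes "x \<in> S" "y \<notin> S"
  shows "infdist x (frontier S) \<le> dist x y"
proof -
  have "closed_segment x y \<inter> frontier S \<noteq> {}"
    by (rule connected_Int_frontier) (use assms in auto)
  then obtain z where z: "z \<in> closed_segment x y" "z \<in> frontier S"
    by blast
  then have "infdist x (frontier S) \<le> dist x z"
    by (intro infdist_le)
  also have "\<dots> \<le> dist x y"
    using dist_in_closed_segment[OF z(1)] by (simp add: dist_commute)
  finally show ?thesis .
qed

text \<open>The mean value theorem turns the remainder into (G z - G x) . (y - x) with z on the
  segment, and the Hoelder bound applies to the gradient difference.\<close>

lemma C1_holder_fun_taylor:
  fixes g :: "'a::euclidean_space \<Rightarrow> real"
  assumes "\<And>x. (g has_derivative (\<lambda>h. G x \<bullet> h)) (at x)"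
    and holder: "\<And>x y. norm (G x - G y) \<le> C * dist x y powr \<gamma>" and "0 \<le> C" "0 < \<gamma>"
  shows "\<bar>g y - g x - G x \<bullet> (y - x)\<bar> \<le> C * dist x y powr (1 + \<gamma>)"
proof (cases "x = y")
  case False
  let ?\<phi> = "\<lambda>s. g (x + s *\<^sub>R (y - x))"
  have "(?\<phi> has_real_derivative G (x + s *\<^sub>R (y - x)) \<bullet> (y - x)) (at s)" for s
  proof -
    have "((\<lambda>s. x + s *\<^sub>R (y - x)) has_derivative (\<lambda>s. s *\<^sub>R (y - x))) (at s)"
      by (auto intro!: derivative_eq_intros)
    from has_derivative_compose[OF this assms(1)] show ?thesis
      by (rule has_derivative_imp_has_field_derivative) simp
  qed
  then obtain s where s: "0 < s" "s < 1" "?\<phi> 1 - ?\<phi> 0 = (1 - 0) * (G (x + s *\<^sub>R (y - x)) \<bullet> (y - x))"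
    using MVT2[of 0 1 ?\<phi> "\<lambda>s. G (x + s *\<^sub>R (y - x)) \<bullet> (y - x)"] by auto
  define z where "z = x + s *\<^sub>R (y - x)"
  have "dist z x \<le> dist x y"
    using s by (simp add: z_def dist_norm norm_minus_commute mult_left_le_one_le)
  have "g y - g x - G x \<bullet> (y - x) = (G z - G x) \<bullet> (y - x)"
    using s by (simp add: z_def inner_diff_left)
  also have "\<bar>\<dots>\<bar> \<le> norm (G z - G x) * norm (y - x)"
    by (rule Cauchy_Schwarz_ineq2)
  also have "\<dots> \<le> (C * dist z x powr \<gamma>) * dist x y"
    using holder[of z x] by (auto simp: dist_norm norm_minus_commute intro!: mult_right_mono)
  also have "\<dots> \<le> (C * dist x y powr \<gamma>) * dist x y"
    using \<open>dist z x \<le> dist x y\<close> assms(3,4) by (intro mult_right_mono mult_left_mono powr_mono2) auto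
  also have "\<dots> = C * dist x y powr (1 + \<gamma>)"
    using False by (simp add: powr_add)
  finally show ?thesis .
qed (use assms(3) in simp)

text \<open>All that the barrier needs to know of the boundary at \<open>p\<close>: \<nu> is an
  inner normal, and the distance to the frontier is at most \<open>M\<close> times the height above
  a surface lying M |x - p|^(1+\<gamma>) below the tangent plane. Distances being nonnegative, this
  also places \<Omega> above that surface near \<open>p\<close>. One \<open>M\<close> serves twice
  so that both constants are enlarged together.\<close>

definition graph_control :: "real \<Rightarrow> 'a::euclidean_space set \<Rightarrow> real \<Rightarrow> real \<Rightarrow> 'a \<Rightarrow> bool" where
  "graph_control \<gamma> \<Omega> M r p \<longleftrightarrow> (\<exists>\<nu>. norm \<nu> = 1 \<and>
     (\<forall>x\<in>\<Omega> \<inter> ball p r. infdist x (frontier \<Omega>) \<le> M * ((x - p) \<bullet> \<nu> + M * norm (x - p) powr (1 + \<gamma>))))"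

text \<open>Enlarging the outer factor requires a nonnegative bracket, which nonnegativity of the
  distance and M > 0 provide.\<close>

lemma graph_control_mono:
  assumes "graph_control \<gamma> \<Omega> M r p" "0 < M" "M \<le> M'" "r' \<le> r"
  shows "graph_control \<gamma> \<Omega> M' r' p"
proof -
  obtain \<nu> where \<nu>: "norm \<nu> = 1"
    "\<forall>x\<in>\<Omega> \<inter> ball p r. infdist x (frontier \<Omega>) \<le> M * ((x - p) \<bullet> \<nu> + M * norm (x - p) powr (1 + \<gamma>))"
    using assms(1) unfolding graph_control_def by blast
  have "infdist x (frontier \<Omega>) \<le> M' * ((x - p) \<bullet> \<nu> + M' * norm (x - p) powr (1 + \<gamma>))"
    if x: "x \<in> \<Omega> \<inter> ball p r'" for x
  proof -
    let ?X = "\<lambda>M. (x - p) \<bullet> \<nu> + M * norm (x - p) powr (1 + \<gamma>)"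
    have le: "infdist x (frontier \<Omega>) \<le> M * ?X M"
      using x assms(4) by (intro \<nu>(2)[rule_format]) auto
    have "0 \<le> M * ?X M"
      by (rule order_trans[OF infdist_nonneg le])
    then have "0 \<le> ?X M"
      using \<open>0 < M\<close> by (simp add: zero_le_mult_iff)
    moreover have "?X M \<le> ?X M'"
      using assms(3) by (simp add: mult_right_mono)
    ultimately have "M * ?X M \<le> M' * ?X M'"
      using assms(2,3) by (intro mult_mono) auto
    with le show ?thesis by simp
  qed
  with \<nu>(1) show ?thesis
    unfolding graph_control_def by (intro exI[of _ \<nu>]) simp
qed

text \<open>Descending from x along \<nu> by its height s above the graph leaves \<Omega>, so the
  distance to the frontier is at most s. Taylor expansion at p gives s <= (x - p) . N + C |x -
  p|^(1+\<gamma>) with N normal to the graph at p, and normalising N yields the claim. The constants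
  are uniform in p near \<open>p0\<close>, as the covering argument requires.\<close>

lemma C1_gamma_domain_local_graph_control:
  fixes \<Omega> :: "'a::euclidean_space set"
  assumes "0 < \<gamma>" "\<gamma> < 1" and dom: "C1_gamma_domain \<gamma> \<Omega>" and p0: "p0 \<in> frontier \<Omega>"
  shows "\<exists>\<rho> M. 0 < \<rho> \<and> 0 < M \<and> (\<forall>p\<in>frontier \<Omega>. dist p0 p < \<rho> \<longrightarrow> graph_control \<gamma> \<Omega> M \<rho> p)"
proof -
  have "open \<Omega>"
    using dom by (simp add: C1_gamma_domain_def)
  obtain r \<nu> g where r: "r > 0" "norm \<nu> = 1" "C1_holder_fun \<gamma> g"
    and graph: "\<Omega> \<inter> ball p0 r = {x \<in> ball p0 r. x \<bullet> \<nu> > g (x - (x \<bullet> \<nu>) *\<^sub>R \<nu>)}"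
    using dom p0 unfolding C1_gamma_domain_def by blast
  obtain G C0 where GC0: "\<forall>x. (g has_derivative (\<lambda>h. G x \<bullet> h)) (at x)"
      "\<forall>x y. norm (G x - G y) \<le> C0 * dist x y powr \<gamma>"
    using r(3) unfolding C1_holder_fun_def by auto
  note G = GC0(1)[rule_format] and C0 = GC0(2)[rule_format]
  define C where "C = \<bar>C0\<bar>"
  have "0 \<le> C"
    by (simp add: C_def)
  have holder: "norm (G x - G y) \<le> C * dist x y powr \<gamma>" for x y
  proof (rule order_trans[OF C0])
    show "C0 * dist x y powr \<gamma> \<le> C * dist x y powr \<gamma>"
      by (intro mult_right_mono) (auto simp: C_def)
  qed
  note taylor = C1_holder_fun_taylor[OF G holder \<open>0 \<le> C\<close> \<open>0 < \<gamma>\<close>]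
  \<comment> \<open>Orthogonal projection onto the hyperplane on which \<open>g\<close> is
    evaluated.\<close>
  define P where "P x = x - (x \<bullet> \<nu>) *\<^sub>R \<nu>" for x
  have mem_iff: "x \<in> \<Omega> \<longleftrightarrow> g (P x) < x \<bullet> \<nu>" if "x \<in> ball p0 r" for x
  proof -
    have "x \<in> \<Omega> \<longleftrightarrow> x \<in> \<Omega> \<inter> ball p0 r"
      using that by simp
    also have "\<dots> \<longleftrightarrow> g (P x) < x \<bullet> \<nu>"
      unfolding graph using that by (simp add: P_def)
    finally show ?thesis .
  qed
  have \<nu>\<nu>: "\<nu> \<bullet> \<nu> = 1"
    using r(2) by (simp add: norm_eq_1)
  have P_diff: "P x - P y = P (x - y)" for x y
    unfolding P_def inner_diff_left scaleR_left_diff_distrib by simp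
  have P_inner: "P a \<bullet> b = a \<bullet> b - (a \<bullet> \<nu>) * (\<nu> \<bullet> b)" for a b
    unfolding P_def inner_diff_left inner_scaleR_left by (rule refl)
  have P_self: "P a \<bullet> b = a \<bullet> P b" for a b
    using P_inner[of a b] P_inner[of b a] inner_commute[of a "P b"] inner_commute[of b a]
      inner_commute[of \<nu> b] inner_commute[of \<nu> a] by simp
  have P_\<nu>: "P a \<bullet> \<nu> = 0" for a
    by (simp add: P_inner \<nu>\<nu>)
  have P_le: "norm (P x) \<le> norm x" for x
  proof -
    have "P x \<bullet> P x = x \<bullet> P x - (x \<bullet> \<nu>) * (P x \<bullet> \<nu>)"
      using P_inner[of x "P x"] inner_commute[of \<nu> "P x"] by simp
    also have "x \<bullet> P x = x \<bullet> x - (x \<bullet> \<nu>) * (x \<bullet> \<nu>)"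
      using P_inner[of x x] P_self[of x x] inner_commute[of \<nu> x] by simp
    finally have "P x \<bullet> P x \<le> x \<bullet> x"
      unfolding P_\<nu> using zero_le_square[of "x \<bullet> \<nu>"] by linarith
    then show ?thesis
      by (simp add: norm_le)
  qed
  have g_cont: "isCont g x" for x
    by (rule has_derivative_continuous[OF G])
  \<comment> \<open>Bounds the gradient of \<open>g\<close> at the projections of all points of the
    chart, hence the length of every normal \<open>N\<close> below.\<close>
  define L where "L = norm (G (P p0)) + C * r powr \<gamma>"
  have "0 \<le> L"
    by (simp add: L_def \<open>0 \<le> C\<close>)
  have L: "norm (G (P p)) \<le> L" if "dist p0 p < r" for p
  proof -
    have "dist (P p) (P p0) \<le> r"
      using P_le[of "p - p0"] that by (simp add: dist_norm P_diff norm_minus_commute)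
    then have "C * dist (P p) (P p0) powr \<gamma> \<le> C * r powr \<gamma>"
      using \<open>0 < \<gamma>\<close> \<open>0 \<le> C\<close> by (intro mult_left_mono powr_mono2) auto
    then show ?thesis
      using holder[of "P p" "P p0"] norm_triangle_sub[of "G (P p)" "G (P p0)"] by (simp add: L_def)
  qed
  define M where "M = 1 + L + C"
  \<comment> \<open>Small enough that the endpoint of the descent, less than 2 \<rho> + \<rho> M
    away from \<open>p0\<close>, stays in the chart; \<rho> <= 1 gives |x - p|^(1+\<gamma>) <= |x -
    p|.\<close>
  define \<rho> where "\<rho> = min 1 (r / (2 * (M + 2)))"
  have "1 \<le> M"
    using \<open>0 \<le> L\<close> \<open>0 \<le> C\<close> by (simp add: M_def)
  then have \<rho>: "0 < \<rho>" "\<rho> \<le> 1" "\<rho> * (2 * (M + 2)) \<le> r"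
  proof -
    have "\<rho> \<le> r / (2 * (M + 2))"
      by (simp add: \<rho>_def)
    then show "\<rho> * (2 * (M + 2)) \<le> r"
      using \<open>1 \<le> M\<close> by (subst (asm) pos_le_divide_eq) auto
  qed (use r(1) \<open>1 \<le> M\<close> in \<open>auto simp: \<rho>_def\<close>)
  have "\<rho> * (2 * 3) \<le> \<rho> * (2 * (M + 2))"
    using \<rho> \<open>1 \<le> M\<close> by (intro mult_left_mono) auto
  then have \<rho>_r: "2 * \<rho> < r"
    using \<rho> by linarith
  show ?thesis
  proof (rule exI[of _ \<rho>], rule exI[of _ M], intro conjI ballI impI)
    fix p assume p: "p \<in> frontier \<Omega>" "dist p0 p < \<rho>"
    have p_ball: "p \<in> ball p0 r"
      using p \<rho>_r \<rho> by simp
    \<comment> \<open>A frontier point is outside the open set, hence not above the graph, and it is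
      a limit of points of \<Omega> in the chart, hence not below it.\<close>
    have p_graph: "p \<bullet> \<nu> = g (P p)"
    proof (rule antisym)
      have "p \<notin> \<Omega>"
        using p(1) \<open>open \<Omega>\<close> by (simp add: frontier_def interior_open)
      then show "p \<bullet> \<nu> \<le> g (P p)"
        using mem_iff[OF p_ball] by simp
      have "p \<in> closure (\<Omega> \<inter> ball p0 r)"
        using p(1) p_ball open_Int_closure_subset[of "ball p0 r" \<Omega>] by (auto simp: frontier_def Int_commute)
      also have "\<dots> \<subseteq> {x. g (P x) \<le> x \<bullet> \<nu>}"
      proof (rule closure_minimal)
        show "\<Omega> \<inter> ball p0 r \<subseteq> {x. g (P x) \<le> x \<bullet> \<nu>}"
          using mem_iff by (auto intro: less_imp_le)
        have "continuous_on UNIV (\<lambda>x. g (P x))"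
          unfolding P_def
          by (intro continuous_on_compose2[OF continuous_at_imp_continuous_on[of UNIV g]] continuous_intros) (auto simp: g_cont)
        then show "closed {x. g (P x) \<le> x \<bullet> \<nu>}"
          by (intro closed_Collect_le continuous_intros)
      qed
      finally show "g (P p) \<le> p \<bullet> \<nu>" by simp
    qed
    \<comment> \<open>The gradient at p of x . \<nu> - g(P x). Its component along \<nu> is 1, so
      its length is at least 1.\<close>
    define N where "N = \<nu> - P (G (P p))"
    have "N \<bullet> \<nu> = 1"
      using \<nu>\<nu> by (simp add: N_def P_def inner_diff_left)
    then have "1 \<le> norm N"
      using norm_cauchy_schwarz[of N \<nu>] r(2) by simp
    have "norm N \<le> 1 + L"
      using norm_triangle_ineq4[of \<nu> "P (G (P p))"] P_le[of "G (P p)"] L[of p] p_ball r(2) by (simp add: N_def)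
    then have "norm N \<le> M"
      using \<open>0 \<le> C\<close> by (simp add: M_def)
    have "infdist x (frontier \<Omega>) \<le> M * ((x - p) \<bullet> (N /\<^sub>R norm N) + M * norm (x - p) powr (1 + \<gamma>))"
      if x: "x \<in> \<Omega> \<inter> ball p \<rho>" for x
    proof -
      have "dist p0 x < r"
        using x p(2) \<rho>_r dist_triangle[of p0 x p] by simp
      define s where "s = x \<bullet> \<nu> - g (P x)"
      have "0 < s"
        using x mem_iff[of x] \<open>dist p0 x < r\<close> by (simp add: s_def)
      define D where "D = norm (x - p) powr (1 + \<gamma>)"
      have "0 \<le> D"
        by (simp add: D_def)
      have "C * dist (P p) (P x) powr (1 + \<gamma>) \<le> C * D"
        unfolding D_def using P_le[of "p - x"] \<open>0 \<le> C\<close> \<open>0 < \<gamma>\<close>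
        by (intro mult_left_mono powr_mono2) (auto simp: dist_norm P_diff norm_minus_commute)
      then have "- (g (P x) - g (P p) - G (P p) \<bullet> (P x - P p)) \<le> C * D"
        using taylor[of "P x" "P p"] by linarith
      have s_le: "s \<le> (x - p) \<bullet> N + C * D"
      proof -
        have "G (P p) \<bullet> (P x - P p) = (x - p) \<bullet> P (G (P p))"
          by (simp only: P_diff inner_commute[of "G (P p)"] P_self)
        moreover have "(x - p) \<bullet> N = x \<bullet> \<nu> - p \<bullet> \<nu> - (x - p) \<bullet> P (G (P p))"
          by (simp add: N_def inner_diff_right inner_diff_left)
        ultimately show ?thesis
          using p_graph \<open>- (g (P x) - g (P p) - G (P p) \<bullet> (P x - P p)) \<le> C * D\<close> unfolding s_def by linarith
      qed
      have "norm (x - p) < \<rho>"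
        using x by (simp add: dist_norm norm_minus_commute)
      have "D \<le> norm (x - p)"
        using powr_mono'[of 1 "1 + \<gamma>" "norm (x - p)"] \<open>norm (x - p) < \<rho>\<close> \<rho> \<open>0 < \<gamma>\<close>
        by (auto simp: D_def)
      have "(x - p) \<bullet> N \<le> norm (x - p) * (1 + L)"
        using norm_cauchy_schwarz[of "x - p" N] mult_left_mono[OF \<open>norm N \<le> 1 + L\<close>, of "norm (x - p)"] by simp
      moreover have "C * D \<le> C * norm (x - p)"
        using \<open>D \<le> norm (x - p)\<close> \<open>0 \<le> C\<close> by (rule mult_left_mono)
      ultimately have "s \<le> norm (x - p) * M"
        using s_le by (simp add: M_def algebra_simps)
      also have "\<dots> \<le> \<rho> * M"
        using \<open>norm (x - p) < \<rho>\<close> \<open>1 \<le> M\<close> by (intro mult_right_mono) auto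
      finally have s_small: "s \<le> \<rho> * M" .
      \<comment> \<open>The point of the graph below x: same projection, height exactly g(P x),
        hence not in \<Omega>.\<close>
      define z where "z = x - s *\<^sub>R \<nu>"
      have Pz: "P z = P x" and z\<nu>: "z \<bullet> \<nu> = x \<bullet> \<nu> - s"
        by (simp_all add: z_def P_def inner_diff_left \<nu>\<nu> algebra_simps)
      have "dist x z = s"
        using r(2) \<open>0 < s\<close> by (simp add: z_def dist_norm)
      have "z \<notin> \<Omega>"
      proof
        assume "z \<in> \<Omega>"
        have "dist p0 z \<le> dist p0 p + dist p x + dist x z"
          using dist_triangle[of p0 z p] dist_triangle[of p z x] by simp
        also have "\<dots> < \<rho> + \<rho> + \<rho> * M"
          using p(2) x s_small \<open>dist x z = s\<close> by simp
        also have "\<dots> \<le> r"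
        proof -
          have "0 \<le> \<rho> * M"
            using \<rho> \<open>1 \<le> M\<close> by simp
          then show ?thesis
            using \<rho> by (simp add: algebra_simps)
        qed
        finally have "g (P z) < z \<bullet> \<nu>"
          using mem_iff[of z] \<open>z \<in> \<Omega>\<close> by simp
        then show False
          by (simp add: Pz z\<nu> s_def)
      qed
      then have "infdist x (frontier \<Omega>) \<le> s"
        using infdist_frontier_le_dist[of x \<Omega> z] x \<open>dist x z = s\<close> by simp
      also have sN: "s \<le> norm N * ((x - p) \<bullet> (N /\<^sub>R norm N) + C * D)"
      proof -
        have "1 * (C * D) \<le> norm N * (C * D)"
          using \<open>1 \<le> norm N\<close> \<open>0 \<le> C\<close> \<open>0 \<le> D\<close> by (intro mult_right_mono) auto
        moreover have "norm N * ((x - p) \<bullet> (N /\<^sub>R norm N)) = (x - p) \<bullet> N"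
          using \<open>1 \<le> norm N\<close> by (cases "N = 0") simp_all
        ultimately show ?thesis
          unfolding distrib_left using s_le by linarith
      qed
      also have "\<dots> \<le> M * ((x - p) \<bullet> (N /\<^sub>R norm N) + M * D)"
      proof (rule mult_mono)
        have "C * D \<le> M * D"
          using \<open>0 \<le> L\<close> \<open>0 \<le> D\<close> by (intro mult_right_mono) (auto simp: M_def)
        then show "(x - p) \<bullet> (N /\<^sub>R norm N) + C * D \<le> (x - p) \<bullet> (N /\<^sub>R norm N) + M * D"
          by simp
        have "0 < norm N * ((x - p) \<bullet> (N /\<^sub>R norm N) + C * D)"
          using \<open>0 < s\<close> sN by (rule less_le_trans)
        then show "0 \<le> (x - p) \<bullet> (N /\<^sub>R norm N) + C * D"
          using \<open>1 \<le> norm N\<close> by (simp add: zero_less_mult_iff)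
      qed (use \<open>norm N \<le> M\<close> \<open>1 \<le> M\<close> in auto)
      finally show ?thesis
        by (simp add: D_def)
    qed
    moreover have "norm (N /\<^sub>R norm N) = 1"
      using \<open>1 \<le> norm N\<close> by (cases "N = 0") simp_all
    ultimately show "graph_control \<gamma> \<Omega> M \<rho> p"
      unfolding graph_control_def by (intro exI[of _ "N /\<^sub>R norm N"]) auto
  qed (use \<rho> \<open>1 \<le> M\<close> in auto)
qed

text \<open>The local lemma controls all frontier points near a centre, so finitely many balls cover
  the compact frontier, and the least radius and the largest constant serve everywhere.\<close>

lemma C1_gamma_domain_graph_control:
  fixes \<Omega> :: "'a::euclidean_space set"
  assumes "0 < \<gamma>" "\<gamma> < 1" and dom: "C1_gamma_domain \<gamma> \<Omega>" and "bounded \<Omega>"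
  obtains r M where "0 < r" "0 < M" "\<And>p. p \<in> frontier \<Omega> \<Longrightarrow> graph_control \<gamma> \<Omega> M r p"
proof -
  define ok where "ok p0 z \<longleftrightarrow> 0 < fst z \<and> 0 < snd z \<and>
      (\<forall>p\<in>frontier \<Omega>. dist p0 p < fst z \<longrightarrow> graph_control \<gamma> \<Omega> (snd z) (fst z) p)" for p0 and z :: "real \<times> real"
  have "\<exists>z. ok p0 z" if p0: "p0 \<in> frontier \<Omega>" for p0
  proof -
    obtain \<rho> M where "0 < \<rho>" "0 < M"
      and *: "\<forall>p\<in>frontier \<Omega>. dist p0 p < \<rho> \<longrightarrow> graph_control \<gamma> \<Omega> M \<rho> p"
      using C1_gamma_domain_local_graph_control[OF assms(1-3) p0] by blast
    then have "ok p0 (\<rho>, M)"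
      unfolding ok_def by simp
    then show ?thesis ..
  qed
  then have "\<forall>p0\<in>frontier \<Omega>. \<exists>z. ok p0 z"
    by simp
  then obtain z where z: "\<forall>p0\<in>frontier \<Omega>. ok p0 (z p0)"
    unfolding bchoice_iff ..
  define \<rho> where "\<rho> p0 = fst (z p0)" for p0
  define M where "M p0 = snd (z p0)" for p0
  have \<rho>M: "0 < \<rho> p0 \<and> 0 < M p0 \<and>
      (\<forall>p\<in>frontier \<Omega>. dist p0 p < \<rho> p0 \<longrightarrow> graph_control \<gamma> \<Omega> (M p0) (\<rho> p0) p)" if "p0 \<in> frontier \<Omega>" for p0
    using z that unfolding ok_def \<rho>_def M_def by simp
  have "compact (frontier \<Omega>)"
    using \<open>bounded \<Omega>\<close> by (rule compact_frontier_bounded)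
  then obtain T where T: "T \<subseteq> frontier \<Omega>" "finite T" "frontier \<Omega> \<subseteq> (\<Union>p0\<in>T. ball p0 (\<rho> p0))"
    by (rule compactE_image[where C="frontier \<Omega>" and f="\<lambda>p0. ball p0 (\<rho> p0)"]) (use \<rho>M in auto)
  \<comment> \<open>\<open>insert 1\<close> keeps \<open>Min\<close> and \<open>Max\<close> away
    from the empty set.\<close>
  define r where "r = Min (insert 1 (\<rho> ` T))"
  define M' where "M' = Max (insert 1 (M ` T))"
  show thesis
  proof (rule that[of r M'])
    show "0 < r"
      using T \<rho>M by (auto simp: r_def)
    show "0 < M'"
      unfolding M'_def using T(2) by (intro order_less_le_trans[OF zero_less_one Max_ge]) auto
    fix p assume p: "p \<in> frontier \<Omega>"
    then obtain p0 where p0: "p0 \<in> T" "dist p0 p < \<rho> p0"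
      using T(3) by auto
    then have "p0 \<in> frontier \<Omega>"
      using T(1) by auto
    have "r \<le> \<rho> p0" "M p0 \<le> M'"
      unfolding r_def M'_def using T(2) p0(1) by (auto intro: Min_le Max_ge)
    moreover have "graph_control \<gamma> \<Omega> (M p0) (\<rho> p0) p" "0 < M p0"
      using \<rho>M[OF \<open>p0 \<in> frontier \<Omega>\<close>] p p0(2) by auto
    ultimately show "graph_control \<gamma> \<Omega> M' r p"
      by (intro graph_control_mono[of \<gamma> \<Omega> "M p0" "\<rho> p0" p M' r])
  qed
qed

section \<open>The global supersolution\<close>

lemma avg_integrable_bounded:
  fixes f :: "'a::euclidean_space \<Rightarrow> real"
  assumes [measurable]: "f \<in> borel_measurable borel" and B: "\<And>y. y \<in> ball x r \<Longrightarrow> \<bar>f y\<bar> \<le> B" and "0 < r"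
  shows "integrable lborel (\<lambda>z. mollifier z * f (x + r *\<^sub>R z))"
proof (rule Bochner_Integration.integrable_bound)
  show "integrable lborel (\<lambda>z::'a. mollifier z * \<bar>B\<bar>)"
    by (simp add: integrable_mollifier)
  show "AE z in lborel. norm (mollifier z * f (x + r *\<^sub>R z)) \<le> norm (mollifier z * \<bar>B\<bar>)"
  proof (rule AE_I2)
    fix z
    show "norm (mollifier z * f (x + r *\<^sub>R z)) \<le> norm (mollifier z * \<bar>B\<bar>)"
    proof (cases "norm z < 1")
      case True
      then have "x + r *\<^sub>R z \<in> ball x r"
        using \<open>0 < r\<close> by (simp add: dist_norm)
      then have "\<bar>f (x + r *\<^sub>R z)\<bar> \<le> \<bar>B\<bar>"
        using B by force
      then show ?thesis
        using mollifier_nonneg[of z] by (simp add: abs_mult mult_left_mono)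
    qed (simp add: mollifier_eq_0)
  qed
qed measurable

lemma borel_measurable_barrier [measurable]: "barrier \<alpha> \<nu> p \<in> borel_measurable borel"
  unfolding barrier_def[abs_def] Let_def by measurable

text \<open>\<open>D\<close> stands for the distance to the frontier and 2 \<alpha> for \<gamma>.
  With A = \<rho>^\<alpha> the boundary error M \<rho> A^2 is at most \<kappa> \<rho> A, while the
  barrier holds b \<rho> A = 16 \<kappa> \<rho> A in reserve. The first conclusion is the cone
  condition of the Laplacian estimate, the second a Hopf-type lower bound, and the third lets a
  paraboloid undercut the barrier away from \<open>p\<close>.\<close>

lemma barrier_lower_bounds:
  fixes \<nu> p y :: "'a::euclidean_space"
  assumes \<nu>: "norm \<nu> = 1" and \<alpha>: "0 < \<alpha>" "\<alpha> \<le> 1 / 2" and "y \<noteq> p"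
  defines "t \<equiv> (y - p) \<bullet> \<nu>" and "\<rho> \<equiv> norm (y - p)" and "\<kappa> \<equiv> \<alpha> / (16 * (real DIM('a) + 1))"
  assumes \<rho>: "\<rho> powr \<alpha> \<le> 1 / 4" "M * \<rho> powr \<alpha> \<le> \<kappa>" and "0 < M"
    and D: "0 \<le> D" "D \<le> \<rho>" "D \<le> M * (t + M * \<rho> powr (1 + 2 * \<alpha>))"
  shows "- \<kappa> * \<rho> \<le> t"
    and "min (1 / M) (\<kappa> / 2) * D \<le> barrier \<alpha> \<nu> p y"
    and "\<kappa> / 2 * (\<rho> * \<rho> powr \<alpha>) \<le> barrier \<alpha> \<nu> p y"
proof -
  define A where "A = \<rho> powr \<alpha>"
  define b where "b = \<alpha> / (real DIM('a) + 1)"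
  note bounds = barrier_bounds[OF \<nu> \<alpha> \<open>y \<noteq> p\<close>, folded t_def \<rho>_def, OF \<rho>(1), folded b_def A_def]
  have \<kappa>: "b / 16 = \<kappa>" "0 < \<kappa>"
    using \<alpha> by (simp_all add: b_def \<kappa>_def add_pos_pos)
  have "0 < \<rho>"
    using \<open>y \<noteq> p\<close> by (simp add: \<rho>_def)
  have A: "0 \<le> A" "A \<le> 1 / 4" "M * A \<le> \<kappa>"
    using \<rho> by (auto simp: A_def)
  have pw: "\<rho> powr (1 + 2 * \<alpha>) = \<rho> * A * A"
  proof -
    have "\<rho> powr (1 + (\<alpha> + \<alpha>)) = \<rho> * A * A"
      unfolding powr_add A_def using \<open>0 < \<rho>\<close> by simp
    then show ?thesis by simp
  qed
  have err: "M * (\<rho> * A * A) \<le> \<kappa> * (\<rho> * A)"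
    using mult_right_mono[OF A(3), of "\<rho> * A"] \<open>0 < \<rho>\<close> A(1) by (simp add: mult_ac)
  have \<rho>A: "\<rho> * A \<le> \<rho>" "0 \<le> \<rho> * A"
    using A \<open>0 < \<rho>\<close> by (auto simp: mult_left_le)
  have D_le: "D / M \<le> t + M * (\<rho> * A * A)"
    using D(3) \<open>0 < M\<close> unfolding pw by (simp add: divide_le_eq mult.commute)
  moreover have "0 \<le> D / M"
    using D(1) \<open>0 < M\<close> by simp
  moreover have "\<kappa> * (\<rho> * A) \<le> \<kappa> * \<rho>"
    using \<rho>A \<kappa> by (intro mult_left_mono) auto
  ultimately show t_ge: "- \<kappa> * \<rho> \<le> t"
    using err by simp
  have "min (1 / M) (\<kappa> / 2) * D \<le> barrier \<alpha> \<nu> p y \<and> \<kappa> / 2 * (\<rho> * A) \<le> barrier \<alpha> \<nu> p y"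
  \<comment> \<open>In the flat cone the reserve b \<rho> A pays for the boundary error; above it, t
    > \<kappa> \<rho> and \<rho> >= D suffice.\<close>
  proof (cases "t \<le> \<kappa> * \<rho>")
    case True
    then have "\<bar>t\<bar> \<le> b / 16 * \<rho>"
      using t_ge by (simp add: \<kappa> abs_le_iff)
    then have W: "t + b / 2 * (\<rho> * A) \<le> barrier \<alpha> \<nu> p y"
      by (rule bounds(2))
    have b_eq: "b / 2 * (\<rho> * A) = \<kappa> * (\<rho> * A) + 7 * (\<kappa> * (\<rho> * A))"
      by (simp add: \<kappa>(1)[symmetric])
    have pos: "0 \<le> \<kappa> * (\<rho> * A)"
      using \<kappa> \<rho>A by simp
    have "min (1 / M) (\<kappa> / 2) * D \<le> 1 / M * D"
      using D(1) by (intro mult_right_mono) auto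
    then have "min (1 / M) (\<kappa> / 2) * D \<le> D / M"
      by simp
    moreover have "t + \<kappa> * (\<rho> * A) + 7 * (\<kappa> * (\<rho> * A)) \<le> barrier \<alpha> \<nu> p y"
      using W unfolding b_eq by simp
    ultimately show ?thesis
      using D_le err pos \<open>0 \<le> D / M\<close> by (intro conjI) linarith+
  next
    case False
    then have "0 \<le> t"
      using \<kappa> \<open>0 < \<rho>\<close> by (meson less_imp_le mult_nonneg_nonneg not_le order_trans)
    then have W: "t / 2 \<le> barrier \<alpha> \<nu> p y"
      by (rule bounds(3))
    have "min (1 / M) (\<kappa> / 2) * D \<le> \<kappa> / 2 * \<rho>"
      using D \<kappa> by (intro mult_mono) auto
    moreover have "\<kappa> / 2 * (\<rho> * A) \<le> \<kappa> / 2 * \<rho>"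
      using \<rho>A \<kappa> by (intro mult_left_mono) auto
    ultimately show ?thesis
      using W False by simp
  qed
  then show "min (1 / M) (\<kappa> / 2) * D \<le> barrier \<alpha> \<nu> p y"
    and "\<kappa> / 2 * (\<rho> * \<rho> powr \<alpha>) \<le> barrier \<alpha> \<nu> p y"
    by (simp_all add: A_def)
qed

lemma ball_infdist_frontier_subset:
  fixes x :: "'a::euclidean_space"
  assumes "x \<in> S" "r \<le> infdist x (frontier S)"
  shows "ball x r \<subseteq> S"
proof
  fix y assume "y \<in> ball x r"
  then show "y \<in> S"
    using infdist_frontier_le_dist[OF \<open>x \<in> S\<close>, of y] assms(2) by (cases "y \<in> S") auto
qed

text \<open>The global supersolution is an infimum of local barriers and a paraboloid.  Super-mean-value
  inequalities survive infima, so no smoothness of the infimum is needed.\<close>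

lemma C1_gamma_domain_strict_supersolution:
  fixes \<Omega> :: "'a::euclidean_space set"
  assumes "0 < \<gamma>" "\<gamma> < 1" "bounded \<Omega>" and dom: "C1_gamma_domain \<gamma> \<Omega>"
  obtains w :: "'a \<Rightarrow> real" and c C \<delta> where "0 < c" "0 < C" "0 < \<delta>" "w \<in> borel_measurable borel"
    and "\<And>x. x \<in> \<Omega> \<Longrightarrow> c * infdist x (frontier \<Omega>) \<le> w x"
    and "\<And>x. x \<in> \<Omega> \<Longrightarrow> w x \<le> C * infdist x (frontier \<Omega>)"
    and "\<And>x r. x \<in> \<Omega> \<Longrightarrow> 0 < r \<Longrightarrow> r \<le> \<delta> \<Longrightarrow> 2 * r \<le> infdist x (frontier \<Omega>) \<Longrightarrow> avg w r x \<le> w x - c * r\<^sup>2"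
proof -
  let ?F = "frontier \<Omega>"
  let ?d = "\<lambda>x. infdist x ?F"
  have "open \<Omega>" "\<Omega> \<noteq> {}"
    using dom by (auto simp: C1_gamma_domain_def)
  define \<alpha> where "\<alpha> = \<gamma> / 2"
  have \<alpha>: "0 < \<alpha>" "\<alpha> \<le> 1 / 2" "1 + \<gamma> = 1 + 2 * \<alpha>"
    using assms by (auto simp: \<alpha>_def)
  define n where "n = real DIM('a)"
  have "1 \<le> n"
    using DIM_positive[where 'a='a] by (simp add: n_def Suc_le_eq)
  define b where "b = \<alpha> / (n + 1)"
  define \<kappa> where "\<kappa> = \<alpha> / (16 * (n + 1))"
  have pos: "0 < b" "0 < \<kappa>"
    using \<alpha> \<open>1 \<le> n\<close> by (simp_all add: b_def \<kappa>_def)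
  obtain r1 M where r1: "0 < r1" and M: "0 < M" and control: "\<And>p. p \<in> ?F \<Longrightarrow> graph_control \<gamma> \<Omega> M r1 p"
    using C1_gamma_domain_graph_control[OF assms(1,2) dom assms(3)] by metis
  have "\<forall>p\<in>?F. \<exists>\<nu>. norm \<nu> = 1 \<and> (\<forall>x\<in>\<Omega> \<inter> ball p r1. ?d x \<le> M * ((x - p) \<bullet> \<nu> + M * norm (x - p) powr (1 + \<gamma>)))"
    using control unfolding graph_control_def by blast
  then obtain \<nu> where \<nu>: "\<forall>p\<in>?F. norm (\<nu> p) = 1 \<and>
      (\<forall>x\<in>\<Omega> \<inter> ball p r1. ?d x \<le> M * ((x - p) \<bullet> \<nu> p + M * norm (x - p) powr (1 + \<gamma>)))"
    unfolding bchoice_iff ..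
  define m where "m = min (1 / 4) (\<kappa> / M)"
  have m: "0 < m" "m \<le> 1 / 4" "M * m \<le> \<kappa>"
    using pos M by (auto simp: m_def min_def field_simps)
  \<comment> \<open>The power 1 / \<alpha> solves \<rho>^\<alpha> <= m for \<rho>, so distances
    below \<open>r0\<close> meet the smallness assumptions of the barrier lemmas.\<close>
  define r0 where "r0 = min (min 1 r1) (m powr (1 / \<alpha>))"
  have r0: "0 < r0" "r0 \<le> 1" "r0 \<le> r1" "r0 \<le> m powr (1 / \<alpha>)"
    using m r1 by (auto simp: r0_def)
  have pow_le: "\<rho> powr \<alpha> \<le> 1 / 4" "M * \<rho> powr \<alpha> \<le> \<kappa>" if "0 \<le> \<rho>" "\<rho> < r0" for \<rho>
  proof -
    have "\<rho> powr \<alpha> \<le> (m powr (1 / \<alpha>)) powr \<alpha>"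
      using that r0 \<alpha> by (intro powr_mono2) auto
    also have "\<dots> = m"
      using \<alpha> m by (simp add: powr_powr)
    finally have le: "\<rho> powr \<alpha> \<le> m" .
    then show "\<rho> powr \<alpha> \<le> 1 / 4"
      using m by simp
    have "M * \<rho> powr \<alpha> \<le> M * m"
      using le M by (intro mult_left_mono) auto
    then show "M * \<rho> powr \<alpha> \<le> \<kappa>"
      using m by simp
  qed
  let ?W = "\<lambda>p. barrier \<alpha> (\<nu> p) p"
  define c1 where "c1 = min (1 / M) (\<kappa> / 2)"
  have "0 < c1"
    using pos M by (simp add: c1_def)
  have notin: "p \<notin> \<Omega>" if "p \<in> ?F" for p
    using that \<open>open \<Omega>\<close> by (simp add: frontier_def interior_open)
  have W: "?W p x \<le> 3 * norm (x - p)" "c1 * ?d x \<le> ?W p x"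
      "\<kappa> / 2 * (norm (x - p) * norm (x - p) powr \<alpha>) \<le> ?W p x"
      "barrier_lap \<alpha> (\<nu> p) p x \<le> - (b * n / 4)"
    if p: "p \<in> ?F" and x: "x \<in> \<Omega>" "dist p x < r0" for p x
  proof -
    have \<nu>p: "norm (\<nu> p) = 1"
      using \<nu> p by simp
    have "x \<noteq> p"
      using notin[OF p] x by auto
    have \<rho>: "norm (x - p) < r0"
      using x by (simp add: dist_norm norm_minus_commute)
    have dp: "?d x \<le> norm (x - p)"
      using infdist_le[OF p, of x] by (simp add: dist_norm)
    have dM: "?d x \<le> M * ((x - p) \<bullet> \<nu> p + M * norm (x - p) powr (1 + 2 * \<alpha>))"
      using \<nu> p x r0 unfolding \<alpha>(3)[symmetric] by simp
    note lower = barrier_lower_bounds[OF \<nu>p \<alpha>(1,2) \<open>x \<noteq> p\<close> pow_le[OF norm_ge_zero \<rho>, unfolded \<kappa>_def n_def] M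
        infdist_nonneg dp dM, folded n_def, folded \<kappa>_def c1_def]
    show "?W p x \<le> 3 * norm (x - p)"
      by (rule barrier_bounds(1)[OF \<nu>p \<alpha>(1,2) \<open>x \<noteq> p\<close> pow_le(1)[OF norm_ge_zero \<rho>]])
    show "c1 * ?d x \<le> ?W p x" "\<kappa> / 2 * (norm (x - p) * norm (x - p) powr \<alpha>) \<le> ?W p x"
      by (rule lower(2), rule lower(3))
    show "barrier_lap \<alpha> (\<nu> p) p x \<le> - (b * n / 4)"
      using barrier_lap_le[OF \<nu>p \<alpha>(1,2) \<open>x \<noteq> p\<close>] \<rho> r0 lower(1)
      unfolding n_def[symmetric] b_def \<kappa>_def by simp
  qed
  obtain R where R: "0 < R" "\<And>x. x \<in> \<Omega> \<Longrightarrow> norm x \<le> R"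
    using \<open>bounded \<Omega>\<close> unfolding bounded_pos by auto
  have R_frontier: "norm q \<le> R" if "q \<in> ?F" for q
  proof -
    have "closure \<Omega> \<subseteq> cball 0 R"
      by (rule closure_minimal) (use R in auto)
    then show ?thesis
      using that by (auto simp: frontier_def)
  qed
  have "?F \<noteq> {}"
    using \<open>\<Omega> \<noteq> {}\<close> \<open>bounded \<Omega>\<close> not_bounded_UNIV by (intro frontier_not_empty) auto
  \<comment> \<open>A lower bound for every local barrier at points of \<Omega> whose distance from
    the centre is between r0 / 2 and r0. The choice of \<open>a\<close> makes the paraboloid a (2
    R^2 - |y|^2) at most \<open>c0\<close>, and at least a R^2 on \<Omega>.\<close>
  define c0 where "c0 = \<kappa> / 2 * (r0 / 2 * (r0 / 2) powr \<alpha>)"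
  define a where "a = c0 / (2 * R\<^sup>2)"
  have "0 < c0"
    using pos r0 by (simp add: c0_def)
  have "0 < a"
    using \<open>0 < c0\<close> R by (simp add: a_def)
  define h where "h y = a * (2 * R\<^sup>2) + - a * ((y - 0) \<bullet> (y - 0))" for y :: 'a
  have h: "a * R\<^sup>2 \<le> h x" "h x \<le> c0" if "x \<in> \<Omega>" for x
  proof -
    have "x \<bullet> x \<le> R\<^sup>2"
      using R(2)[OF that] by (simp add: power2_norm_eq_inner[symmetric] power_mono)
    then have "a * (x \<bullet> x) \<le> a * R\<^sup>2"
      using \<open>0 < a\<close> by (intro mult_left_mono) auto
    then show "a * R\<^sup>2 \<le> h x"
      by (simp add: h_def)
    have "0 \<le> a * (x \<bullet> x)"
      using \<open>0 < a\<close> by simp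
    moreover have "a * (2 * R\<^sup>2) = c0"
      using R by (simp add: a_def)
    ultimately show "h x \<le> c0"
      by (simp add: h_def)
  qed
  have h_cont: "continuous_on T h" for T
    unfolding h_def by (intro continuous_intros)
  have [measurable]: "h \<in> borel_measurable borel"
    by (rule borel_measurable_continuous_onI[OF h_cont])
  \<comment> \<open>A barrier competes only within \<open>r0\<close> of its centre, where it is
    controlled. The paraboloid keeps the family nonempty and already lies below a barrier before
    that barrier drops out.\<close>
  define S where "S x = insert (h x) ((\<lambda>p. ?W p x) ` {p \<in> ?F. dist p x < r0})" for x
  define w where "w x = (if x \<in> \<Omega> then Inf (S x) else 0)" for x
  have S_nonneg: "0 \<le> e" if "x \<in> \<Omega>" "e \<in> S x" for x e
  proof -
    have "0 \<le> h x"
      using h(1)[OF that(1)] \<open>0 < a\<close> by (meson less_imp_le mult_nonneg_nonneg order_trans zero_le_power2)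
    moreover have "0 \<le> ?W p x" if "p \<in> ?F" "dist p x < r0" for p
      using W(2)[OF that(1) \<open>x \<in> \<Omega>\<close> that(2)] \<open>0 < c1\<close> infdist_nonneg[of x ?F]
      by (meson less_imp_le mult_nonneg_nonneg order_trans)
    ultimately show ?thesis
      using that(2) by (auto simp: S_def)
  qed
  have w_le: "w x \<le> e" if "x \<in> \<Omega>" "e \<in> S x" for x e
    using that S_nonneg[OF that(1)] by (auto simp: w_def intro!: cInf_lower bdd_belowI[of _ 0])
  have w_ge: "z \<le> w x" if "x \<in> \<Omega>" "\<And>e. e \<in> S x \<Longrightarrow> z \<le> e" for x z
    using that by (auto simp: w_def S_def intro!: cInf_greatest)
  have w_bounds: "0 \<le> w x" "w x \<le> c0" if "x \<in> \<Omega>" for x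
    using w_ge[OF that, of 0] S_nonneg[OF that] w_le[OF that, of "h x"] h(2)[OF that] by (auto simp: S_def)
  have W_cont: "continuous_on T (?W p)" if "p \<in> ?F" "T \<subseteq> \<Omega>" for p T
  proof (rule continuous_on_subset)
    show "continuous_on (- {p}) (?W p)"
      using \<nu> that by (intro c2_lap_continuous[OF barrier_c2_lap]) simp
    show "T \<subseteq> - {p}"
      using that notin by auto
  qed
  have w_less_iff: "w x < z \<longleftrightarrow> (\<exists>e\<in>S x. e < z)" if "x \<in> \<Omega>" for x z
    using w_ge[OF that, of z] w_le[OF that] by (meson not_le order_le_less_trans)
  \<comment> \<open>The infimum runs over an uncountable family, but the competitors are continuous
    on open subsets of \<Omega>, so the strict sublevel sets are open inside \<Omega>.\<close>
  have w_meas: "w \<in> borel_measurable borel"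
  proof (rule borel_measurableI_less)
    fix z
    have "{x \<in> space borel. w x < z} = (\<Omega> \<inter> h -` {..<z}) \<union> (\<Union>p\<in>?F. (\<Omega> \<inter> ball p r0) \<inter> ?W p -` {..<z}) \<union>
        (if 0 < z then - \<Omega> else {})"
    proof (intro set_eqI)
      fix x
      show "x \<in> {x \<in> space borel. w x < z} \<longleftrightarrow> x \<in> (\<Omega> \<inter> h -` {..<z}) \<union>
          (\<Union>p\<in>?F. (\<Omega> \<inter> ball p r0) \<inter> ?W p -` {..<z}) \<union> (if 0 < z then - \<Omega> else {})"
      proof (cases "x \<in> \<Omega>")
        case True
        then show ?thesis
          using w_less_iff[OF True, of z] by (auto simp: S_def)
      qed (auto simp: w_def)
    qed
    also have "\<dots> \<in> sets borel"
    proof (intro sets.Un)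
      show "\<Omega> \<inter> h -` {..<z} \<in> sets borel"
        by (intro borel_open continuous_open_preimage h_cont \<open>open \<Omega>\<close>) auto
      show "(\<Union>p\<in>?F. (\<Omega> \<inter> ball p r0) \<inter> ?W p -` {..<z}) \<in> sets borel"
        by (intro borel_open open_UN ballI continuous_open_preimage W_cont open_Int \<open>open \<Omega>\<close>) auto
      show "(if 0 < z then - \<Omega> else {}) \<in> sets borel"
        using \<open>open \<Omega>\<close> by auto
    qed
    finally show "{x \<in> space borel. w x < z} \<in> sets borel" .
  qed
  define mm where "mm = mollifier_moment TYPE('a)"
  have "0 < mm"
    using mollifier_moment_pos by (simp add: mm_def)
  \<comment> \<open>The four entries serve, in order, the lower bound by the barriers, the lower
    bound by the paraboloid (the distance is at most 2 R), and the mean value gains of the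
    paraboloid and of the barriers.\<close>
  define c where "c = min (min c1 (a * R / 2)) (min (a * mm) (b * mm / 8))"
  have c: "0 < c" "c \<le> c1" "c \<le> a * R / 2" "c \<le> a * mm" "c \<le> b * mm / 8"
    using \<open>0 < c1\<close> \<open>0 < a\<close> \<open>0 < mm\<close> pos R by (auto simp: c_def)
  show thesis
  proof (rule that[of c "max 3 (c0 / r0)" "r0 / 4" w])
    fix x assume x: "x \<in> \<Omega>"
    show "c * ?d x \<le> w x"
    proof (rule w_ge[OF x])
      fix e assume "e \<in> S x"
      then consider "e = h x" | p where "p \<in> ?F" "dist p x < r0" "e = ?W p x"
        by (auto simp: S_def)
      then show "c * ?d x \<le> e"
      proof cases
        case 1
        obtain q where q: "q \<in> ?F"
          using \<open>?F \<noteq> {}\<close> by blast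
        have "?d x \<le> norm (x - q)"
          using infdist_le[OF q, of x] by (simp add: dist_norm)
        also have "\<dots> \<le> 2 * R"
          using norm_triangle_ineq4[of x q] R(2)[OF x] R_frontier[OF q] by simp
        finally have "c * ?d x \<le> (a * R / 2) * (2 * R)"
          using c \<open>0 < a\<close> R by (intro mult_mono infdist_nonneg) auto
        also have "\<dots> = a * R\<^sup>2"
          by (simp add: power2_eq_square)
        finally show ?thesis
          using h(1)[OF x] 1 by simp
      next
        case 2
        have "c * ?d x \<le> c1 * ?d x"
          using c by (intro mult_right_mono infdist_nonneg)
        then show ?thesis
          using W(2)[OF 2(1) x 2(2)] 2(3) by simp
      qed
    qed
    show "w x \<le> max 3 (c0 / r0) * ?d x"
    proof (cases "?d x < r0")
      case True
      \<comment> \<open>The barrier at a nearest frontier point turns the bound 3 |x - q| into a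
        multiple of the distance.\<close>
      obtain q where q: "q \<in> ?F" "?d x = dist x q"
        using infdist_attains_inf[OF frontier_closed \<open>?F \<noteq> {}\<close>] by blast
      have "w x \<le> ?W q x"
        using q True by (intro w_le[OF x]) (auto simp: S_def dist_commute)
      also have "\<dots> \<le> 3 * norm (x - q)"
        using q True by (intro W(1)[OF q(1) x]) (simp add: dist_commute)
      also have "\<dots> = 3 * ?d x"
        using q by (simp add: dist_norm)
      also have "\<dots> \<le> max 3 (c0 / r0) * ?d x"
        by (intro mult_right_mono infdist_nonneg) auto
      finally show ?thesis .
    next
      case False
      have "w x \<le> c0 / r0 * r0"
        using w_bounds(2)[OF x] r0 by simp
      also have "\<dots> \<le> max 3 (c0 / r0) * ?d x"
        using False r0 \<open>0 < c0\<close> by (intro mult_mono) auto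
      finally show ?thesis .
    qed
  next
    fix x r assume x: "x \<in> \<Omega>" and r: "0 < r" "r \<le> r0 / 4" "2 * r \<le> ?d x"
    \<comment> \<open>\<open>avg_superharmonic\<close> wants a closed ball of radius larger than r;
      any radius below 2 r keeps it inside \<Omega>.\<close>
    define R' where "R' = 3 / 2 * r"
    have R': "r < R'" "R' < 2 * r"
      using r by (auto simp: R'_def)
    have sub: "cball x R' \<subseteq> \<Omega>"
      using ball_infdist_frontier_subset[OF x r(3)] R' by fastforce
    have sub_r: "ball x r \<subseteq> \<Omega>" "cball x r \<subseteq> \<Omega>"
      using sub R' by fastforce+
    have int_w: "integrable lborel (\<lambda>z. mollifier z * w (x + r *\<^sub>R z))"
      by (rule avg_integrable_bounded[OF w_meas _ r(1), where B=c0]) (use sub_r w_bounds in force)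
    have h_case: "avg w r x + c * r\<^sup>2 \<le> h x"
    proof -
      have "avg w r x \<le> avg h r x"
        by (rule avg_mono[OF int_w avg_integrable_continuous[OF _ h_cont r(1)] _ r(1)])
           (use sub_r in \<open>auto simp: S_def intro!: w_le\<close>)
      also have "\<dots> \<le> h x - (2 * n * a) * mollifier_moment TYPE('a) / (2 * real DIM('a)) * r\<^sup>2"
      proof (rule avg_superharmonic[OF _ \<open>open \<Omega>\<close> sub r(1) R'(1)])
        show "c2_lap \<Omega> h (\<lambda>y. 0 + - a * (2 * real DIM('a)))"
          unfolding h_def by (intro c2_lap_add c2_lap_cmult c2_lap_const c2_lap_square_dist)
      qed (simp_all add: n_def)
      also have "\<dots> = h x - a * mm * r\<^sup>2"
        using \<open>1 \<le> n\<close> by (simp add: n_def mm_def)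
      also have "\<dots> \<le> h x - c * r\<^sup>2"
        using c by (simp add: mult_right_mono)
      finally show ?thesis by simp
    qed
    have "avg w r x + c * r\<^sup>2 \<le> w x"
    proof (rule w_ge[OF x])
      fix e assume "e \<in> S x"
      then consider "e = h x" | p where "p \<in> ?F" "dist p x < r0" "e = ?W p x"
        by (auto simp: S_def)
      then show "avg w r x + c * r\<^sup>2 \<le> e"
      proof cases
        case 1
        then show ?thesis
          using h_case by simp
      next
        case p: 2
        show ?thesis
        \<comment> \<open>If p is within r0 / 2, the averaging ball, of radius at most r0 / 4, lies
          where the barrier of p competes, so w is below that barrier on it. Otherwise the barrier
          at x is at least c0 >= h x, and the paraboloid case applies.\<close>
        proof (cases "dist p x < r0 / 2")
          case True
          let ?O = "\<Omega> \<inter> ball p r0"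
          have "cball x R' \<subseteq> ball p r0"
          proof
            fix y assume "y \<in> cball x R'"
            then show "y \<in> ball p r0"
              using True dist_triangle[of p y x] R' r by simp
          qed
          then have sub_O: "cball x R' \<subseteq> ?O"
            using sub by simp
          have "avg w r x \<le> avg (?W p) r x"
          proof (rule avg_mono[OF int_w avg_integrable_continuous[OF borel_measurable_barrier W_cont[OF p(1) sub_r(2)] r(1)] _ r(1)])
            fix y assume "y \<in> ball x r"
            then have "y \<in> cball x R'"
              using R' by simp
            then have "y \<in> ?O"
              using sub_O by (rule rev_subsetD)
            then show "w y \<le> ?W p y"
              using p(1) by (intro w_le) (auto simp: S_def)
          qed
          also have "\<dots> \<le> ?W p x - (b * n / 4) * mollifier_moment TYPE('a) / (2 * real DIM('a)) * r\<^sup>2"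
          proof (rule avg_superharmonic[OF _ _ sub_O r(1) R'(1) borel_measurable_barrier])
            show "c2_lap ?O (?W p) (barrier_lap \<alpha> (\<nu> p) p)"
              using \<nu> p(1) notin[OF p(1)] by (intro c2_lap_subset[OF barrier_c2_lap]) auto
            show "barrier_lap \<alpha> (\<nu> p) p y \<le> - (b * n / 4)" if "y \<in> ?O" for y
              using that by (intro W(4)[OF p(1)]) auto
          qed (use \<open>open \<Omega>\<close> in auto)
          also have "\<dots> = ?W p x - b * mm / 8 * r\<^sup>2"
            using \<open>1 \<le> n\<close> by (simp add: n_def mm_def)
          also have "\<dots> \<le> ?W p x - c * r\<^sup>2"
            using mult_right_mono[OF c(5), of "r\<^sup>2"] by simp
          finally show ?thesis
            using p by simp
        next
          case False
          then have "r0 / 2 \<le> norm (x - p)"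
            by (simp add: dist_norm norm_minus_commute)
          then have "r0 / 2 * (r0 / 2) powr \<alpha> \<le> norm (x - p) * norm (x - p) powr \<alpha>"
            using r0 \<alpha> by (intro mult_mono powr_mono2) auto
          then have "c0 \<le> \<kappa> / 2 * (norm (x - p) * norm (x - p) powr \<alpha>)"
            unfolding c0_def using pos by (intro mult_left_mono) auto
          then show ?thesis
            using h_case h(2)[OF x] W(3)[OF p(1) x p(2)] p(3) by simp
        qed
      qed
    qed
    then show "avg w r x \<le> w x - c * r\<^sup>2"
      by simp
  qed (use c r0 w_meas in auto)
qed

section \<open>Weakly subharmonic functions and their averages\<close>

lemma borel_measurable_avg [measurable]:
  fixes f :: "'a::euclidean_space \<Rightarrow> real"
  assumes [measurable]: "f \<in> borel_measurable borel"
  shows "avg f r \<in> borel_measurable borel"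
  unfolding avg_def[abs_def] by measurable

text \<open>The L^1 norms in x are bounded uniformly in z and the mollifier has mass 1, which is the
  iterated condition for Fubini.\<close>

lemma integrable_mollifier_pair:
  fixes H :: "'a::euclidean_space \<Rightarrow> 'a \<Rightarrow> real"
  assumes [measurable]: "case_prod H \<in> borel_measurable (lborel \<Otimes>\<^sub>M lborel)"
    and int: "\<And>z. integrable lborel (H z)" and K: "\<And>z. (LINT x|lborel. \<bar>H z x\<bar>) \<le> K"
  shows "integrable (lborel \<Otimes>\<^sub>M lborel) (\<lambda>(z, x). mollifier z * H z x)"
proof (rule lborel_pair.Fubini_integrable)
  have "0 \<le> K"
    using K[of undefined] by (rule order_trans[rotated]) simp
  have "integrable lborel (\<lambda>z. mollifier z * (LINT x|lborel. \<bar>H z x\<bar>))"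
  proof (rule Bochner_Integration.integrable_bound[where f="\<lambda>z. mollifier z * K"])
    show "AE z in lborel. norm (mollifier z * (LINT x|lborel. \<bar>H z x\<bar>)) \<le> norm (mollifier z * K)"
      using K \<open>0 \<le> K\<close> by (intro AE_I2) (simp add: abs_mult mult_left_mono)
  qed (simp_all add: integrable_mollifier)
  then show "integrable lborel (\<lambda>z. LINT x|lborel. norm (case (z, x) of (z, x) \<Rightarrow> mollifier z * H z x))"
    by (simp add: abs_mult mollifier_nonneg)
  show "AE z in lborel. integrable lborel (\<lambda>x. case (z, x) of (z, x) \<Rightarrow> mollifier z * H z x)"
    using int by simp
qed measurable

text \<open>Fubini, translation by r z, and evenness of the mollifier. Integrability of
  \<open>U\<close> and boundedness of \<zeta> make the double integrals absolutely
  convergent.\<close>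

lemma avg_self_adjoint:
  fixes U \<zeta> :: "'a::euclidean_space \<Rightarrow> real"
  assumes [measurable]: "U \<in> borel_measurable borel" "\<zeta> \<in> borel_measurable borel"
    and U: "integrable lborel U" and B: "\<And>x. \<bar>\<zeta> x\<bar> \<le> B"
  shows "integrable lborel (\<lambda>x. \<zeta> x * avg U r x)" and "integrable lborel (\<lambda>x. U x * avg \<zeta> r x)"
    and "(LINT x|lborel. \<zeta> x * avg U r x) = (LINT x|lborel. U x * avg \<zeta> r x)"
proof -
  have U_shift: "integrable lborel (\<lambda>x. U (x + v))" "(LINT x|lborel. \<bar>U (x + v)\<bar>) = (LINT x|lborel. \<bar>U x\<bar>)" for v
    using lborel_integrable_affine[of U 1 v] lborel_integral_affine[of "\<lambda>x. \<bar>U x\<bar>" 1 v] U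
    by (simp_all add: add.commute)
  have bound: "\<bar>\<zeta> y * U x\<bar> \<le> B * \<bar>U x\<bar>" for x y
    using B[of y] by (simp add: abs_mult mult_right_mono)
  have bound': "norm (\<zeta> y * U x) \<le> norm (B * \<bar>U x\<bar>)" for x y
    using order_trans[OF bound abs_ge_self] by (simp only: real_norm_def)
  have int1: "integrable lborel (\<lambda>x. \<zeta> x * U (x + r *\<^sub>R z))" for z
    by (rule Bochner_Integration.integrable_bound[OF integrable_mult_right[OF integrable_abs[OF U_shift(1)[of "r *\<^sub>R z"]], of B]])
       (measurable, rule AE_I2, rule bound')
  have int2: "integrable lborel (\<lambda>x. \<zeta> (x - r *\<^sub>R z) * U x)" for z
    by (rule Bochner_Integration.integrable_bound[OF integrable_mult_right[OF integrable_abs[OF U], of B]])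
       (measurable, rule AE_I2, rule bound')
  have 1: "integrable (lborel \<Otimes>\<^sub>M lborel) (\<lambda>(z, x). mollifier z * (\<zeta> x * U (x + r *\<^sub>R z)))"
  proof (rule integrable_mollifier_pair[OF _ int1])
    fix z
    have "(LINT x|lborel. \<bar>\<zeta> x * U (x + r *\<^sub>R z)\<bar>) \<le> (LINT x|lborel. B * \<bar>U (x + r *\<^sub>R z)\<bar>)"
      by (rule integral_mono[OF integrable_abs[OF int1] integrable_mult_right[OF integrable_abs[OF U_shift(1)]]]) (rule bound)
    then show "(LINT x|lborel. \<bar>\<zeta> x * U (x + r *\<^sub>R z)\<bar>) \<le> B * (LINT x|lborel. \<bar>U x\<bar>)"
      by (simp add: U_shift)
  qed measurable
  have 2: "integrable (lborel \<Otimes>\<^sub>M lborel) (\<lambda>(z, x). mollifier z * (\<zeta> (x - r *\<^sub>R z) * U x))"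
  proof (rule integrable_mollifier_pair[OF _ int2])
    fix z
    have "(LINT x|lborel. \<bar>\<zeta> (x - r *\<^sub>R z) * U x\<bar>) \<le> (LINT x|lborel. B * \<bar>U x\<bar>)"
      by (rule integral_mono[OF integrable_abs[OF int2] integrable_mult_right[OF integrable_abs[OF U]]]) (rule bound)
    then show "(LINT x|lborel. \<bar>\<zeta> (x - r *\<^sub>R z) * U x\<bar>) \<le> B * (LINT x|lborel. \<bar>U x\<bar>)"
      by simp
  qed measurable
  have eq1: "(LINT z|lborel. mollifier z * (\<zeta> x * U (x + r *\<^sub>R z))) = \<zeta> x * avg U r x" for x
    unfolding avg_def by (subst integral_mult_right_zero[symmetric]) (simp add: mult_ac)
  have eq2: "(LINT z|lborel. mollifier z * (\<zeta> (x - r *\<^sub>R z) * U x)) = U x * avg \<zeta> r x" for x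
  proof -
    have "(LINT z|lborel. mollifier z * (\<zeta> (x - r *\<^sub>R z) * U x)) =
        \<bar>-1\<bar> ^ DIM('a) * (LINT z|lborel. mollifier (0 + (-1) *\<^sub>R z) * (\<zeta> (x - r *\<^sub>R (0 + (-1) *\<^sub>R z)) * U x))"
      by (intro lborel_integral_affine) auto
    also have "\<dots> = (LINT z|lborel. U x * (mollifier z * \<zeta> (x + r *\<^sub>R z)))"
      by (simp add: mollifier_minus mult_ac)
    finally show ?thesis
      by (simp add: avg_def)
  qed
  show "integrable lborel (\<lambda>x. \<zeta> x * avg U r x)"
    using lborel_pair.integrable_snd[OF 1] by (simp add: eq1)
  show "integrable lborel (\<lambda>x. U x * avg \<zeta> r x)"
    using lborel_pair.integrable_snd[OF 2] by (simp add: eq2)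
  have "(LINT x|lborel. \<zeta> x * avg U r x) = (LINT z|lborel. LINT x|lborel. mollifier z * (\<zeta> x * U (x + r *\<^sub>R z)))"
    using lborel_pair.Fubini_integral[OF 1] by (simp only: eq1)
  also have "\<dots> = (LINT z|lborel. LINT x|lborel. mollifier z * (\<zeta> (x - r *\<^sub>R z) * U x))"
  proof (rule Bochner_Integration.integral_cong[OF refl])
    fix z
    show "(LINT x|lborel. mollifier z * (\<zeta> x * U (x + r *\<^sub>R z))) = (LINT x|lborel. mollifier z * (\<zeta> (x - r *\<^sub>R z) * U x))"
      using lborel_integral_affine[of "\<lambda>x. mollifier z * (\<zeta> (x - r *\<^sub>R z) * U x)" 1 "r *\<^sub>R z"]
      by (auto simp: add.commute)
  qed
  also have "\<dots> = (LINT x|lborel. U x * avg \<zeta> r x)"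
    using lborel_pair.Fubini_integral[OF 2] by (simp only: eq2)
  finally show "(LINT x|lborel. \<zeta> x * avg U r x) = (LINT x|lborel. U x * avg \<zeta> r x)" .
qed

text \<open>The set is closed because a point of the closure outside the open set lies on the
  frontier, at distance 0 from it.\<close>

lemma compact_infdist_frontier_ge:
  fixes S :: "'a::euclidean_space set"
  assumes "bounded S" "open S" "0 < e"
  shows "compact {x \<in> S. e \<le> infdist x (frontier S)}"
proof -
  have "{x \<in> S. e \<le> infdist x (frontier S)} = closure S \<inter> {x. e \<le> infdist x (frontier S)}"
  proof (intro set_eqI iffI)
    fix x assume x: "x \<in> closure S \<inter> {x. e \<le> infdist x (frontier S)}"
    have "x \<in> S"
    proof (rule ccontr)
      assume "x \<notin> S"
      then have "x \<in> frontier S"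
        using x \<open>open S\<close> by (simp add: frontier_def interior_open)
      then show False
        using x \<open>0 < e\<close> by simp
    qed
    then show "x \<in> {x \<in> S. e \<le> infdist x (frontier S)}"
      using x by simp
  qed (use closure_subset in auto)
  also have "compact \<dots>"
    using \<open>bounded S\<close> by (intro compact_Int_closed closed_Collect_le continuous_intros) auto
  finally show ?thesis .
qed

lemma infdist_frontier_pos:
  fixes S :: "'a::euclidean_space set"
  assumes "bounded S" "open S" "x \<in> S"
  shows "0 < infdist x (frontier S)"
proof -
  have "frontier S \<noteq> {}"
    using assms not_bounded_UNIV by (intro frontier_not_empty) auto
  moreover have "x \<notin> frontier S"
    using assms by (simp add: frontier_def interior_open)
  ultimately show ?thesis
    by (simp add: infdist_pos_not_in_closed)
qed

text \<open>By inner regularity the set where g < 0 is exhausted, up to measure e, by a compact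
  subset. There a negative function has nonnegative integral, so the compact set is null and the
  whole set has measure at most e.\<close>

lemma AE_nonneg_if_compact_integrals_nonneg:
  fixes g :: "'a::euclidean_space \<Rightarrow> real"
  assumes [measurable]: "g \<in> borel_measurable borel" "N \<in> sets borel" and "bounded N"
    and int: "integrable lborel g"
    and nonneg: "\<And>K. compact K \<Longrightarrow> K \<subseteq> N \<Longrightarrow> 0 \<le> (LINT x|lborel. indicator K x * g x)"
  shows "AE x in lborel. x \<in> N \<longrightarrow> 0 \<le> g x"
proof -
  define Z where "Z = {x \<in> N. g x < 0}"
  have [measurable]: "Z \<in> sets borel"
    unfolding Z_def by measurable
  have small: "emeasure lebesgue Z \<le> ennreal e" if "0 < e" for e
  proof -
    have "Z \<in> sets lebesgue"
      by simp
    from this \<open>0 < e\<close> obtain T where T: "closed T" "T \<subseteq> Z" "emeasure lebesgue (Z - T) < ennreal e"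
      by (rule sets_lebesgue_inner_closed)
    have "bounded T"
      by (rule bounded_subset[OF \<open>bounded N\<close>]) (use T(2) in \<open>auto simp: Z_def\<close>)
    then have "compact T"
      using T(1) by (simp add: compact_eq_bounded_closed)
    have [measurable]: "T \<in> sets borel"
      using T(1) by simp
    have intT: "integrable lborel (\<lambda>x. indicator T x * - g x)"
      using integrable_mult_indicator[of T lborel "\<lambda>x. - g x"] int by simp
    have nonnegT: "0 \<le> indicator T x * - g x" for x
      using T(2) by (auto simp: indicator_def Z_def)
    have "0 \<le> (LINT x|lborel. indicator T x * g x)"
      using T(2) by (intro nonneg \<open>compact T\<close>) (auto simp: Z_def)
    moreover have "0 \<le> (LINT x|lborel. indicator T x * - g x)"
      using nonnegT by (intro Bochner_Integration.integral_nonneg)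
    ultimately have "(LINT x|lborel. indicator T x * - g x) = 0"
      by simp
    then have "AE x in lborel. indicator T x * - g x = 0"
      using integral_nonneg_eq_0_iff_AE[OF intT] nonnegT by simp
    then have "AE x in lborel. x \<notin> T"
    proof eventually_elim
      case (elim x)
      then show ?case
        using T(2) by (auto simp: Z_def)
    qed
    then have "T \<in> null_sets lborel"
      by (subst (asm) AE_iff_null_sets[symmetric]) auto
    then have "T \<in> null_sets lebesgue"
      by (rule null_sets_completionI)
    then have "emeasure lebesgue ((Z - T) \<union> T) = emeasure lebesgue (Z - T)"
      by (intro emeasure_Un_null_set) auto
    moreover have "(Z - T) \<union> T = Z"
      using T(2) by auto
    ultimately have "emeasure lebesgue Z = emeasure lebesgue (Z - T)"
      by simp
    then show ?thesis
      using T(3) by simp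
  qed
  have "emeasure lebesgue Z \<le> 0"
  proof (rule ennreal_le_epsilon)
    show "emeasure lebesgue Z \<le> 0 + ennreal e" if "0 < e" for e
      using small[OF that] by simp
  qed
  then have "emeasure lborel Z = 0"
    by (simp add: emeasure_completion)
  then have "Z \<in> null_sets lborel"
    by (intro null_setsI) auto
  then have "AE x in lborel. x \<notin> Z"
    by (rule AE_not_in)
  then show ?thesis
    by eventually_elim (auto simp: Z_def not_less)
qed

lemma avg_const: "avg (\<lambda>_. k) r x = k"
  using integral_mollifier[where 'a='a] by (simp add: avg_def)

text \<open>The averages increase with the radius, but a pointwise limit at radius 0 would call for
  Lebesgue points of \<open>U\<close>. Instead the inequality is integrated against a continuous
  \<zeta>, self-adjointness moves the small-radius average onto \<zeta>, and there the limit is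
  elementary. Letting \<zeta> decrease to indicators of compact sets recovers the inequality almost
  everywhere.\<close>

lemma weakly_subharmonic_imp_AE_le_avg:
  fixes \<Omega> :: "'a::euclidean_space set" and U :: "'a \<Rightarrow> real"
  assumes "open \<Omega>" "bounded \<Omega>" and [measurable]: "U \<in> borel_measurable borel"
    and int: "\<And>K. compact K \<Longrightarrow> K \<subseteq> \<Omega> \<Longrightarrow> integrable lborel (\<lambda>y. indicator K y * U y)"
    and sub: "\<And>x t. 0 < t \<Longrightarrow> cball x t \<subseteq> \<Omega> \<Longrightarrow> 0 \<le> (LINT y|lborel. U y * laplacian (bump x t) y)"
    and "0 < r"
  shows "AE x in lborel. x \<in> \<Omega> \<longrightarrow> 2 * r < infdist x (frontier \<Omega>) \<longrightarrow> U x \<le> avg U r x"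
proof -
  let ?d = "\<lambda>x. infdist x (frontier \<Omega>)"
  have d_tri: "\<bar>?d x - ?d y\<bar> \<le> dist x y" for x y
    by (rule infdist_triangle_abs)
  \<comment> \<open>\<open>U\<close> need not be integrable on all of \<Omega>, so it is cut off.
    The margins are 2 r for the conclusion, 3/2 r for the support of \<zeta> and 5/4 r for the balls
    around it, which leaves r / 4 here.\<close>
  define K' where "K' = {x \<in> \<Omega>. r / 4 \<le> ?d x}"
  have K': "compact K'" "K' \<subseteq> \<Omega>"
    using compact_infdist_frontier_ge[OF assms(2,1), of "r / 4"] \<open>0 < r\<close> by (auto simp: K'_def)
  define U1 where "U1 y = indicator K' y * U y" for y
  have [measurable]: "K' \<in> sets borel"
    using K'(1) by (simp add: borel_compact)
  have U1_meas [measurable]: "U1 \<in> borel_measurable borel"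
    unfolding U1_def[abs_def] by measurable
  have U1_int: "integrable lborel U1"
    unfolding U1_def[abs_def] by (rule int[OF K'])
  have U1_eq: "U1 y = U y" if "x \<in> \<Omega>" "3 / 2 * r \<le> ?d x" "y \<in> cball x (5 / 4 * r)" for x y
  proof -
    have "y \<in> \<Omega>"
      using ball_infdist_frontier_subset[OF that(1,2)] that(3) \<open>0 < r\<close> by auto
    moreover have "r / 4 \<le> ?d y"
      using d_tri[of x y] that by auto
    ultimately show ?thesis
      by (simp add: U1_def K'_def)
  qed
  have avg_le: "avg U1 s x \<le> avg U1 r x" if "x \<in> \<Omega>" "3 / 2 * r \<le> ?d x" "0 < s" "s \<le> r" for x s
  proof -
    have "avg U s x \<le> avg U r x"
    proof (rule avg_mono_radius[where R="5 / 4 * r"])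
      have sub_\<Omega>: "cball x (5 / 4 * r) \<subseteq> \<Omega>"
        using ball_infdist_frontier_subset[OF that(1,2)] \<open>0 < r\<close> by auto
      then show "integrable lborel (\<lambda>y. indicator (cball x (5 / 4 * r)) y * U y)"
        by (intro int) auto
      show "0 \<le> (LINT y|lborel. U y * laplacian (bump x t) y)" if "0 < t" "t < 5 / 4 * r" for t
        using sub_\<Omega> that by (intro sub) auto
    qed (use that \<open>0 < r\<close> in auto)
    moreover have "avg U1 s x = avg U s x" "avg U1 r x = avg U r x"
      using that \<open>0 < r\<close> by (auto intro!: avg_cong U1_eq[OF that(1,2)])
    ultimately show ?thesis by simp
  qed
  define g where "g x = avg U1 r x - U1 x" for x
  have g_meas [measurable]: "g \<in> borel_measurable borel"
    unfolding g_def[abs_def] by measurable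
  have g_int: "integrable lborel g"
    unfolding g_def using avg_self_adjoint(1)[OF U1_meas _ U1_int, of "\<lambda>_. 1" 1 r] U1_int
    by (intro Bochner_Integration.integrable_diff) auto
  have weak: "0 \<le> (LINT x|lborel. \<zeta> x * g x)"
    if \<zeta>: "continuous_on UNIV \<zeta>" "\<And>x. 0 \<le> \<zeta> x" "\<And>x. \<zeta> x \<le> 1"
      and supp: "\<And>x. \<zeta> x \<noteq> 0 \<Longrightarrow> x \<in> \<Omega> \<and> 3 / 2 * r \<le> ?d x" for \<zeta> :: "'a \<Rightarrow> real"
  proof -
    have [measurable]: "\<zeta> \<in> borel_measurable borel"
      using \<zeta>(1) by (rule borel_measurable_continuous_onI)
    have \<zeta>_abs: "\<bar>\<zeta> x\<bar> \<le> 1" for x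
      using \<zeta>(2,3)[of x] by simp
    note adj = avg_self_adjoint[OF U1_meas _ U1_int \<zeta>_abs]
    have avg_\<zeta>: "\<bar>avg \<zeta> s x\<bar> \<le> 1" if "0 < s" for s x
    proof -
      have int_\<zeta>: "integrable lborel (\<lambda>z. mollifier z * \<zeta> (x + s *\<^sub>R z))"
        by (rule avg_integrable_bounded[OF _ _ that, of _ _ 1]) (use \<zeta>_abs in auto)
      have int_c: "integrable lborel (\<lambda>z::'a. mollifier z * k)" for k
        by (simp add: integrable_mollifier)
      have "avg \<zeta> s x \<le> avg (\<lambda>_. 1) s x" "avg (\<lambda>_. 0) s x \<le> avg \<zeta> s x"
        using \<zeta>(2,3) that by (intro avg_mono int_\<zeta> int_c; simp)+
      then show ?thesis
        by (simp add: avg_const)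
    qed
    have le: "(LINT x|lborel. U1 x * avg \<zeta> (r / Suc k) x) \<le> (LINT x|lborel. \<zeta> x * avg U1 r x)" for k
    proof -
      have "(LINT x|lborel. U1 x * avg \<zeta> (r / Suc k) x) = (LINT x|lborel. \<zeta> x * avg U1 (r / Suc k) x)"
        by (rule adj(3)[symmetric]) measurable
      also have "\<dots> \<le> (LINT x|lborel. \<zeta> x * avg U1 r x)"
      proof (rule integral_mono[OF adj(1) adj(1)])
        fix x
        show "\<zeta> x * avg U1 (r / Suc k) x \<le> \<zeta> x * avg U1 r x"
        proof (cases "\<zeta> x = 0")
          case False
          have "r / Suc k \<le> r"
            using \<open>0 < r\<close> by (simp add: divide_le_eq mult_le_cancel_left1)
          then show ?thesis
            using supp[OF False] \<zeta>(2)[of x] \<open>0 < r\<close> by (intro mult_left_mono avg_le) auto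
        qed simp
      qed measurable
      finally show ?thesis .
    qed
    have "(\<lambda>k. LINT x|lborel. U1 x * avg \<zeta> (r / Suc k) x) \<longlonglongrightarrow> (LINT x|lborel. U1 x * \<zeta> x)"
    proof (rule integral_dominated_convergence[where w="\<lambda>x. \<bar>U1 x\<bar>"])
      show "AE x in lborel. (\<lambda>k. U1 x * avg \<zeta> (r / Suc k) x) \<longlonglongrightarrow> U1 x * \<zeta> x"
      proof (intro AE_I2 tendsto_mult tendsto_const)
        fix x
        have "isCont \<zeta> x"
          using \<zeta>(1) by (simp add: continuous_on_eq_continuous_at)
        then show "(\<lambda>k. avg \<zeta> (r / Suc k) x) \<longlonglongrightarrow> \<zeta> x"
          by (intro avg_tendsto[where B=1] \<zeta>_abs \<open>0 < r\<close>) measurable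
      qed
      show "AE x in lborel. norm (U1 x * avg \<zeta> (r / Suc k) x) \<le> \<bar>U1 x\<bar>" for k
      proof (rule AE_I2)
        fix x
        have "\<bar>U1 x\<bar> * \<bar>avg \<zeta> (r / Suc k) x\<bar> \<le> \<bar>U1 x\<bar> * 1"
          using avg_\<zeta>[of "r / Suc k" x] \<open>0 < r\<close> by (intro mult_left_mono) auto
        then show "norm (U1 x * avg \<zeta> (r / Suc k) x) \<le> \<bar>U1 x\<bar>"
          by (simp add: abs_mult)
      qed
      show "integrable lborel (\<lambda>x. \<bar>U1 x\<bar>)"
        using U1_int by (rule integrable_abs)
    qed measurable
    then have lim: "(LINT x|lborel. U1 x * \<zeta> x) \<le> (LINT x|lborel. \<zeta> x * avg U1 r x)"
      using le by (intro LIMSEQ_le_const2) auto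
    have int_U\<zeta>: "integrable lborel (\<lambda>x. U1 x * \<zeta> x)"
    proof (rule Bochner_Integration.integrable_bound[OF U1_int])
      show "AE x in lborel. norm (U1 x * \<zeta> x) \<le> norm (U1 x)"
        using \<zeta>_abs by (intro AE_I2) (simp add: abs_mult mult_left_le)
    qed measurable
    have "(LINT x|lborel. \<zeta> x * g x) = (LINT x|lborel. \<zeta> x * avg U1 r x - U1 x * \<zeta> x)"
      by (simp add: g_def right_diff_distrib mult.commute)
    also have "\<dots> = (LINT x|lborel. \<zeta> x * avg U1 r x) - (LINT x|lborel. U1 x * \<zeta> x)"
      by (rule Bochner_Integration.integral_diff[OF adj(1) int_U\<zeta>]) measurable
    finally show ?thesis
      using lim by simp
  qed
  define N where "N = {x \<in> \<Omega>. 2 * r < ?d x}"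
  have N_eq: "N = \<Omega> \<inter> {x. 2 * r < ?d x}"
    by (auto simp: N_def)
  have "open N"
    unfolding N_eq by (intro open_Int \<open>open \<Omega>\<close> open_Collect_less continuous_intros)
  have "AE x in lborel. x \<in> N \<longrightarrow> 0 \<le> g x"
  proof (rule AE_nonneg_if_compact_integrals_nonneg[OF _ _ _ g_int])
    show "g \<in> borel_measurable borel"
      by (rule g_meas)
    show "N \<in> sets borel"
      using \<open>open N\<close> by simp
    show "bounded N"
      using \<open>bounded \<Omega>\<close> by (rule bounded_subset) (auto simp: N_def)
    fix K assume K: "compact K" "K \<subseteq> N"
    show "0 \<le> (LINT x|lborel. indicator K x * g x)"
    proof (cases "K = {}")
      case False
      have "closed K"
        using K(1) by (rule compact_imp_closed)
      \<comment> \<open>Starting the slopes at 2 / r keeps the points with \<zeta> j nonzero within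
        r / 2 of \<open>K\<close>, hence at distance at least 3/2 r from the frontier.\<close>
      define j0 where "j0 = nat \<lceil>2 / r\<rceil>"
      define \<zeta> where "\<zeta> j x = max 0 (1 - real (j + j0) * infdist x K)" for j x
      have j0: "2 / r \<le> real (j + j0)" for j
        by (simp add: j0_def) linarith
      have \<zeta>_cont: "continuous_on UNIV (\<zeta> j)" for j
        unfolding \<zeta>_def by (intro continuous_intros)
      have [measurable]: "K \<in> sets borel" "\<zeta> j \<in> borel_measurable borel" for j
        using \<open>closed K\<close> borel_measurable_continuous_onI[OF \<zeta>_cont] by auto
      have \<zeta>_nonneg: "0 \<le> \<zeta> j x" for j x
        by (simp add: \<zeta>_def)
      have \<zeta>_le: "\<zeta> j x \<le> 1" for j x
        by (simp add: \<zeta>_def infdist_nonneg)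
      have \<zeta>_supp: "x \<in> \<Omega> \<and> 3 / 2 * r \<le> ?d x" if "\<zeta> j x \<noteq> 0" for j x
      proof -
        have "real (j + j0) * infdist x K < 1"
          using that by (auto simp: \<zeta>_def max_def split: if_splits)
        moreover have "2 / r * infdist x K \<le> real (j + j0) * infdist x K"
          using j0 by (intro mult_right_mono infdist_nonneg)
        ultimately have "2 / r * infdist x K < 1"
          by simp
        then have "infdist x K < r / 2"
          using \<open>0 < r\<close> by (simp add: field_simps)
        obtain y where y: "y \<in> K" "infdist x K = dist x y"
          using infdist_attains_inf[OF \<open>closed K\<close> False, of x] by auto
        have yN: "y \<in> \<Omega>" "2 * r < ?d y"
          using y K(2) by (auto simp: N_def)
        have "x \<in> ball y (2 * r)"
          using y \<open>infdist x K < r / 2\<close> \<open>0 < r\<close> by (simp add: dist_commute)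
        then have "x \<in> \<Omega>"
          using ball_infdist_frontier_subset[OF yN(1), of "2 * r"] yN(2) by auto
        moreover have "3 / 2 * r \<le> ?d x"
          using d_tri[of x y] yN(2) y \<open>infdist x K < r / 2\<close> by auto
        ultimately show ?thesis ..
      qed
      have "(\<lambda>j. LINT x|lborel. \<zeta> j x * g x) \<longlonglongrightarrow> (LINT x|lborel. indicator K x * g x)"
      proof (rule integral_dominated_convergence[where w="\<lambda>x. \<bar>g x\<bar>"])
        show "AE x in lborel. (\<lambda>j. \<zeta> j x * g x) \<longlonglongrightarrow> indicator K x * g x"
        proof (intro AE_I2 tendsto_mult tendsto_const)
          fix x
          show "(\<lambda>j. \<zeta> j x) \<longlonglongrightarrow> indicator K x"
          proof (cases "x \<in> K")
            case True
            then show ?thesis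
              by (simp add: \<zeta>_def)
          next
            case x: False
            then have "0 < infdist x K"
              using \<open>closed K\<close> False by (simp add: infdist_pos_not_in_closed)
            then obtain m where m: "1 < real m * infdist x K"
              using reals_Archimedean3[of "infdist x K"] by auto
            have "\<zeta> j x = 0" if "m \<le> j" for j
            proof -
              have "real m * infdist x K \<le> real (j + j0) * infdist x K"
                using that by (intro mult_right_mono infdist_nonneg) auto
              then show ?thesis
                using m by (simp add: \<zeta>_def)
            qed
            then have "\<forall>\<^sub>F j in sequentially. \<zeta> j x = 0"
              unfolding eventually_sequentially by auto
            then show ?thesis
              using x by (simp add: tendsto_eventually)
          qed
        qed
        show "AE x in lborel. norm (\<zeta> j x * g x) \<le> \<bar>g x\<bar>" for j
          using \<zeta>_nonneg \<zeta>_le by (intro AE_I2) (simp add: abs_mult mult_left_le_one_le)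
        show "integrable lborel (\<lambda>x. \<bar>g x\<bar>)"
          using g_int by (rule integrable_abs)
        show "(\<lambda>x. indicator K x * g x) \<in> borel_measurable lborel"
          by measurable
        show "(\<lambda>x. \<zeta> j x * g x) \<in> borel_measurable lborel" for j
          by measurable
      qed
      then show ?thesis
        using weak[OF \<zeta>_cont \<zeta>_nonneg \<zeta>_le \<zeta>_supp] by (intro LIMSEQ_le_const) auto
    qed simp
  qed
  then show ?thesis
  proof eventually_elim
    case (elim x)
    show ?case
    proof (intro impI)
      assume x: "x \<in> \<Omega>" "2 * r < ?d x"
      then have "3 / 2 * r \<le> ?d x"
        using \<open>0 < r\<close> by simp
      then have "avg U1 r x = avg U r x" "U1 x = U x"
        using U1_eq[OF x(1)] \<open>0 < r\<close> by (auto intro!: avg_cong)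
      then show "U x \<le> avg U r x"
        using elim x by (simp add: N_def g_def)
    qed
  qed
qed

section \<open>The boundary strip\<close>

text \<open>The integrals are extended nonnegative ones because \<open>V\<close> may fail to be
  integrable up to the boundary; the comparison itself is done with real integrals of a compactly
  supported cutoff.\<close>

lemma boundary_strip_estimate:
  fixes \<Omega> :: "'a::euclidean_space set" and V :: "'a \<Rightarrow> real"
  assumes \<gamma>: "0 < \<gamma>" "\<gamma> < 1" and "bounded \<Omega>" and dom: "C1_gamma_domain \<gamma> \<Omega>"
    and [measurable]: "V \<in> borel_measurable borel" and V_nonneg: "\<And>x. 0 \<le> V x"
    and int: "\<And>K. compact K \<Longrightarrow> K \<subseteq> \<Omega> \<Longrightarrow> integrable lborel (\<lambda>y. indicator K y * V y)"
    and sub: "\<And>r. 0 < r \<Longrightarrow>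
      AE x in lborel. x \<in> \<Omega> \<longrightarrow> 2 * r < infdist x (frontier \<Omega>) \<longrightarrow> V x \<le> avg V r x"
  shows "\<exists>k \<epsilon>1. 0 < \<epsilon>1 \<and> (\<forall>\<epsilon>. 0 < \<epsilon> \<and> \<epsilon> < \<epsilon>1 \<longrightarrow>
      (\<integral>\<^sup>+x. ennreal (V x) * indicator {x \<in> \<Omega>. \<epsilon> \<le> infdist x (frontier \<Omega>)} x \<partial>lborel) \<le>
      ennreal k * (ennreal (1 / \<epsilon>) *
        (\<integral>\<^sup>+x. ennreal (V x) * indicator {x \<in> \<Omega>. infdist x (frontier \<Omega>) < \<epsilon>} x \<partial>lborel)))"
proof -
  let ?d = "\<lambda>x. infdist x (frontier \<Omega>)"
  have "open \<Omega>" "\<Omega> \<noteq> {}"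
    using dom by (auto simp: C1_gamma_domain_def)
  have [measurable]: "?d \<in> borel_measurable borel" "\<Omega> \<in> sets borel"
    using \<open>open \<Omega>\<close> by (auto intro!: borel_measurable_continuous_onI continuous_intros)
  have d_tri: "\<bar>?d x - ?d y\<bar> \<le> dist x y" for x y
    by (rule infdist_triangle_abs)
  obtain w :: "'a \<Rightarrow> real" and c C \<delta> where pos: "0 < c" "0 < C" "0 < \<delta>"
    and w_meas [measurable]: "w \<in> borel_measurable borel"
    and w_ge: "\<And>x. x \<in> \<Omega> \<Longrightarrow> c * ?d x \<le> w x" and w_le: "\<And>x. x \<in> \<Omega> \<Longrightarrow> w x \<le> C * ?d x"
    and w_avg: "\<And>x r. x \<in> \<Omega> \<Longrightarrow> 0 < r \<Longrightarrow> r \<le> \<delta> \<Longrightarrow> 2 * r \<le> ?d x \<Longrightarrow> avg w r x \<le> w x - c * r\<^sup>2"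
  proof (rule C1_gamma_domain_strict_supersolution[OF \<gamma> \<open>bounded \<Omega>\<close> dom])
    fix w :: "'a \<Rightarrow> real" and c C \<delta>
    assume "0 < c" "0 < C" "0 < \<delta>" "w \<in> borel_measurable borel"
      and "\<And>x. x \<in> \<Omega> \<Longrightarrow> c * ?d x \<le> w x" "\<And>x. x \<in> \<Omega> \<Longrightarrow> w x \<le> C * ?d x"
      and "\<And>x r. x \<in> \<Omega> \<Longrightarrow> 0 < r \<Longrightarrow> r \<le> \<delta> \<Longrightarrow> 2 * r \<le> ?d x \<Longrightarrow> avg w r x \<le> w x - c * r\<^sup>2"
    then show thesis
      by (rule that)
  qed
  have "c \<le> C"
  proof -
    obtain x where x: "x \<in> \<Omega>"
      using \<open>\<Omega> \<noteq> {}\<close> by auto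
    have "c * ?d x \<le> C * ?d x"
      using w_ge[OF x] w_le[OF x] by simp
    then show ?thesis
      using infdist_frontier_pos[OF \<open>bounded \<Omega>\<close> \<open>open \<Omega>\<close> x] by simp
  qed
  obtain D where D: "\<And>x. x \<in> \<Omega> \<Longrightarrow> ?d x \<le> D"
  proof -
    have "compact (?d ` closure \<Omega>)"
      using \<open>bounded \<Omega>\<close> by (intro compact_continuous_image continuous_intros) (simp add: compact_closure)
    then obtain D where D: "\<forall>z\<in>?d ` closure \<Omega>. norm z \<le> D"
      using compact_imp_bounded bounded_iff by metis
    have "?d x \<le> D" if "x \<in> \<Omega>" for x
    proof -
      have "norm (?d x) \<le> D"
        using D closure_subset that by auto
      then show ?thesis
        by simp
    qed
    then show ?thesis
      by (rule that)
  qed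
  \<comment> \<open>For r = c eps / (4 C) the ratio 2 C eps / (c r^2) of loss to gain equals k /
    eps.\<close>
  define k where "k = 32 * C ^ 3 / c ^ 3"
  have estimate: "(\<integral>\<^sup>+x. ennreal (V x) * indicator {x \<in> \<Omega>. \<epsilon> \<le> ?d x} x \<partial>lborel) \<le>
      ennreal k * (ennreal (1 / \<epsilon>) * (\<integral>\<^sup>+x. ennreal (V x) * indicator {x \<in> \<Omega>. ?d x < \<epsilon>} x \<partial>lborel))"
    if \<epsilon>: "0 < \<epsilon>" "\<epsilon> < 4 * C * \<delta> / c" for \<epsilon>
  proof -
    \<comment> \<open>Two demands fix e and r. Since 4 r <= eps, a ball of radius r around a point
      at distance at least eps stays at distance eps / 2, where w >= c eps / 2 = e, so the
      truncation is inactive on it. Since e = 2 C r, positivity of \<eta> forces the distance above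
      2 r, where V <= A_r V is known.\<close>
    define e where "e = c * \<epsilon> / 2"
    define r where "r = c * \<epsilon> / (4 * C)"
    have e_r: "e = C * (2 * r)"
      using pos by (simp add: e_def r_def)
    have r: "0 < r" "r \<le> \<delta>" "4 * r \<le> \<epsilon>"
    proof -
      show "0 < r"
        using pos \<epsilon> by (simp add: r_def)
      show "r \<le> \<delta>"
        using pos \<epsilon> by (simp add: r_def field_simps)
      have "c * \<epsilon> \<le> C * \<epsilon>"
        using \<open>c \<le> C\<close> \<epsilon> by (intro mult_right_mono) auto
      then show "4 * r \<le> \<epsilon>"
        using pos by (simp add: r_def field_simps)
    qed
    define \<eta> where "\<eta> x = (if x \<in> \<Omega> then max (w x - e) 0 else 0)" for x
    have [measurable]: "\<eta> \<in> borel_measurable borel"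
      unfolding \<eta>_def[abs_def] by measurable
    have "0 < e"
      using pos \<epsilon> by (simp add: e_def)
    have \<eta>_nonneg: "0 \<le> \<eta> x" for x
      by (simp add: \<eta>_def)
    have \<eta>_le: "\<eta> x \<le> C * ?d x" for x
    proof -
      have "0 \<le> C * ?d x"
        using pos infdist_nonneg[of x "frontier \<Omega>"] by simp
      then show ?thesis
        using w_le[of x] \<open>0 < e\<close> by (auto simp: \<eta>_def)
    qed
    have \<eta>_bound: "\<bar>\<eta> x\<bar> \<le> C * \<bar>D\<bar>" for x
    proof (cases "x \<in> \<Omega>")
      case True
      have "C * ?d x \<le> C * \<bar>D\<bar>"
        using D[OF True] pos by (intro mult_left_mono) auto
      then show ?thesis
        using \<eta>_le[of x] \<eta>_nonneg[of x] by simp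
    qed (use pos in \<open>simp add: \<eta>_def\<close>)
    have \<eta>_supp: "x \<in> \<Omega>" "2 * r < ?d x" if "\<eta> x \<noteq> 0" for x
    proof -
      show "x \<in> \<Omega>"
        using that by (simp add: \<eta>_def split: if_splits)
      then have "e < w x"
        using that by (simp add: \<eta>_def max_def split: if_splits)
      then have "C * (2 * r) < C * ?d x"
        using w_le[OF \<open>x \<in> \<Omega>\<close>] by (simp add: e_r)
      then show "2 * r < ?d x"
        using pos by simp
    qed
    \<comment> \<open>Contains the ball of radius r around every point with \<eta> nonzero, so the
      cutoff does not change the averages there.\<close>
    define K' where "K' = {x \<in> \<Omega>. r \<le> ?d x}"
    have K': "compact K'" "K' \<subseteq> \<Omega>"
      using compact_infdist_frontier_ge[OF \<open>bounded \<Omega>\<close> \<open>open \<Omega>\<close> r(1)] by (auto simp: K'_def)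
    have [measurable]: "K' \<in> sets borel"
      using K'(1) by (simp add: borel_compact)
    define V1 where "V1 y = indicator K' y * V y" for y
    have V1_meas [measurable]: "V1 \<in> borel_measurable borel"
      unfolding V1_def[abs_def] by measurable
    have V1_int: "integrable lborel V1"
      unfolding V1_def[abs_def] by (rule int[OF K'])
    have V1_nonneg: "0 \<le> V1 x" for x
      using V_nonneg[of x] by (simp add: V1_def)
    note adj = avg_self_adjoint[OF V1_meas _ V1_int \<eta>_bound]
    have int_V\<eta>: "integrable lborel (\<lambda>x. V1 x * \<eta> x)"
    proof (rule Bochner_Integration.integrable_bound[OF integrable_mult_right[OF V1_int, of "C * \<bar>D\<bar>"]])
      show "AE x in lborel. norm (V1 x * \<eta> x) \<le> norm (C * \<bar>D\<bar> * V1 x)"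
      proof (rule AE_I2)
        fix x
        have "\<bar>V1 x\<bar> * \<bar>\<eta> x\<bar> \<le> \<bar>V1 x\<bar> * (C * \<bar>D\<bar>)"
          using \<eta>_bound by (intro mult_left_mono) auto
        then show "norm (V1 x * \<eta> x) \<le> norm (C * \<bar>D\<bar> * V1 x)"
          using pos by (simp add: abs_mult mult_ac)
      qed
    qed measurable
    have "(LINT x|lborel. V1 x * \<eta> x) \<le> (LINT x|lborel. \<eta> x * avg V1 r x)"
    proof (rule integral_mono_AE[OF int_V\<eta> adj(1)])
      show "AE x in lborel. V1 x * \<eta> x \<le> \<eta> x * avg V1 r x"
        using sub[OF r(1)]
      proof eventually_elim
        case (elim x)
        show ?case
        proof (cases "\<eta> x = 0")
          case False
          note x = \<eta>_supp[OF False]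
          have "V1 y = V y" if "y \<in> ball x r" for y
          proof -
            have "y \<in> \<Omega>"
              using ball_infdist_frontier_subset[OF x(1), of r] x(2) r(1) that by auto
            moreover have "r \<le> ?d y"
              using d_tri[of x y] that x(2) by auto
            ultimately show ?thesis
              by (simp add: V1_def K'_def)
          qed
          then have "avg V1 r x = avg V r x" "V1 x = V x"
            using r(1) by (auto intro!: avg_cong)
          then have "V1 x \<le> avg V1 r x"
            using elim x by simp
          then have "\<eta> x * V1 x \<le> \<eta> x * avg V1 r x"
            using \<eta>_nonneg by (rule mult_left_mono)
          then show ?thesis
            by (simp only: mult.commute[of "V1 x"])
        qed simp
      qed
    qed measurable
    also have "\<dots> = (LINT x|lborel. V1 x * avg \<eta> r x)"
      by (rule adj(3)) measurable
    finally have le: "(LINT x|lborel. V1 x * \<eta> x) \<le> (LINT x|lborel. V1 x * avg \<eta> r x)" .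
    define near far where "near x = V1 x * indicator {x \<in> \<Omega>. ?d x < \<epsilon>} x"
      and "far x = V1 x * indicator {x \<in> \<Omega>. \<epsilon> \<le> ?d x} x" for x
    have int_near: "integrable lborel near" and int_far: "integrable lborel far"
      using integrable_real_mult_indicator[OF _ V1_int] unfolding near_def[abs_def] far_def[abs_def]
      by measurable
    have int_\<eta>: "integrable lborel (\<lambda>z. mollifier z * \<eta> (x + r *\<^sub>R z))" for x
      by (rule avg_integrable_bounded[OF _ \<eta>_bound r(1)]) measurable
    have int_const: "integrable lborel (\<lambda>z::'a. mollifier z * b)" for b
      by (simp add: integrable_mollifier)
    \<comment> \<open>Off \<open>K'\<close> both sides vanish. In the strip the average of \<eta> is
      bounded outright, since its ball stays at distance at most 2 eps; beyond it \<eta> is w - e on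
      the ball and the strict supersolution inequality applies.\<close>
    have pointwise: "V1 x * avg \<eta> r x \<le> V1 x * \<eta> x + (2 * C * \<epsilon>) * near x - (c * r\<^sup>2) * far x" for x
    proof (cases "x \<in> K'")
      case True
      then have x: "x \<in> \<Omega>" "r \<le> ?d x"
        by (auto simp: K'_def)
      show ?thesis
      proof (cases "?d x < \<epsilon>")
        case True
        have "avg \<eta> r x \<le> avg (\<lambda>_. 2 * C * \<epsilon>) r x"
        proof (rule avg_mono[OF int_\<eta> int_const _ r(1)])
          fix y assume "y \<in> ball x r"
          then have "?d y \<le> 2 * \<epsilon>"
            using d_tri[of x y] True r by auto
          then have "C * ?d y \<le> C * (2 * \<epsilon>)"
            using pos by (intro mult_left_mono) auto
          then show "\<eta> y \<le> 2 * C * \<epsilon>"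
            using \<eta>_le[of y] by simp
        qed
        then have "avg \<eta> r x \<le> \<eta> x + 2 * C * \<epsilon>"
          using \<eta>_nonneg[of x] by (simp add: avg_const)
        then have "V1 x * avg \<eta> r x \<le> V1 x * (\<eta> x + 2 * C * \<epsilon>)"
          using V1_nonneg by (intro mult_left_mono)
        then show ?thesis
          using True x by (simp add: near_def far_def algebra_simps)
      next
        case False
        have "2 * r \<le> ?d x"
          using False r by simp
        have w_e: "y \<in> \<Omega> \<and> e \<le> w y" if "y \<in> ball x r" for y
        proof -
          have y: "y \<in> \<Omega>"
            using ball_infdist_frontier_subset[OF x] that by auto
          have "\<epsilon> / 2 \<le> ?d y"
            using d_tri[of x y] that False r by auto
          then have "c * (\<epsilon> / 2) \<le> c * ?d y"
            using pos by (intro mult_left_mono) auto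
          then show ?thesis
            using w_ge[OF y] y by (simp add: e_def)
        qed
        have \<eta>_eq: "\<eta> y = w y - e" if "y \<in> ball x r" for y
          using w_e[OF that] by (simp add: \<eta>_def)
        have "avg \<eta> r x = avg (\<lambda>y. w y - e) r x"
          by (rule avg_cong[OF \<eta>_eq r(1)])
        also have "\<dots> = avg w r x - e"
        proof -
          have "integrable lborel (\<lambda>z. mollifier z * w (x + r *\<^sub>R z))"
          proof (rule avg_integrable_bounded[OF w_meas _ r(1)])
            show "\<bar>w y\<bar> \<le> C * \<bar>D\<bar> + e" if "y \<in> ball x r" for y
              using \<eta>_bound[of y] \<eta>_eq[OF that] w_e[OF that] \<open>0 < e\<close> by simp
          qed
          then have "avg (\<lambda>y. w y - e) r x = avg w r x - avg (\<lambda>_. e) r x"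
            unfolding avg_def right_diff_distrib
            by (rule Bochner_Integration.integral_diff[OF _ int_const])
          then show ?thesis
            by (simp add: avg_const)
        qed
        also have "\<dots> \<le> \<eta> x - c * r\<^sup>2"
          using w_avg[OF x(1) r(1,2) \<open>2 * r \<le> ?d x\<close>] \<eta>_eq[of x] r(1) by simp
        finally have "V1 x * avg \<eta> r x \<le> V1 x * (\<eta> x - c * r\<^sup>2)"
          using V1_nonneg by (intro mult_left_mono)
        then show ?thesis
          using False x by (simp add: near_def far_def algebra_simps)
      qed
    qed (simp add: V1_def near_def far_def)
    have "(LINT x|lborel. V1 x * avg \<eta> r x) \<le>
        (LINT x|lborel. V1 x * \<eta> x + (2 * C * \<epsilon>) * near x - (c * r\<^sup>2) * far x)"
      by (rule integral_mono[OF adj(2) _ pointwise]) (measurable, use int_V\<eta> int_near int_far in simp)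
    also have "\<dots> = (LINT x|lborel. V1 x * \<eta> x) + (2 * C * \<epsilon>) * integral\<^sup>L lborel near - (c * r\<^sup>2) * integral\<^sup>L lborel far"
      using int_V\<eta> int_near int_far by simp
    finally have "(c * r\<^sup>2) * integral\<^sup>L lborel far \<le> (2 * C * \<epsilon>) * integral\<^sup>L lborel near"
      using le by simp
    then have "integral\<^sup>L lborel far \<le> (2 * C * \<epsilon>) * integral\<^sup>L lborel near / (c * r\<^sup>2)"
      using pos r by (simp add: pos_le_divide_eq mult.commute)
    also have "\<dots> = k * (1 / \<epsilon> * integral\<^sup>L lborel near)"
      using pos \<epsilon> by (simp add: k_def r_def field_simps power2_eq_square power3_eq_cube)
    finally have main: "integral\<^sup>L lborel far \<le> k * (1 / \<epsilon> * integral\<^sup>L lborel near)" .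
    have "(\<integral>\<^sup>+x. ennreal (V x) * indicator {x \<in> \<Omega>. \<epsilon> \<le> ?d x} x \<partial>lborel) = (\<integral>\<^sup>+x. ennreal (far x) \<partial>lborel)"
      using r by (intro nn_integral_cong) (auto simp: far_def V1_def K'_def indicator_def)
    also have "\<dots> = ennreal (integral\<^sup>L lborel far)"
      using V1_nonneg by (intro nn_integral_eq_integral[OF int_far]) (simp add: far_def)
    also have "\<dots> \<le> ennreal (k * (1 / \<epsilon> * integral\<^sup>L lborel near))"
      using main by (rule ennreal_leI)
    also have "\<dots> = ennreal k * (ennreal (1 / \<epsilon>) * ennreal (integral\<^sup>L lborel near))"
    proof -
      have "0 \<le> k" "0 \<le> 1 / \<epsilon>"
        using pos \<epsilon> by (auto simp: k_def)
      then show ?thesis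
        by (simp only: ennreal_mult')
    qed
    also have "ennreal (integral\<^sup>L lborel near) = (\<integral>\<^sup>+x. ennreal (near x) \<partial>lborel)"
      using V1_nonneg by (intro nn_integral_eq_integral[OF int_near, symmetric]) (simp add: near_def)
    also have "\<dots> \<le> (\<integral>\<^sup>+x. ennreal (V x) * indicator {x \<in> \<Omega>. ?d x < \<epsilon>} x \<partial>lborel)"
      using V_nonneg by (intro nn_integral_mono) (auto simp: near_def V1_def indicator_def)
    finally show ?thesis
      by (simp add: mult_left_mono)
  qed
  show ?thesis
    using estimate pos by (intro exI[of _ k] exI[of _ "4 * C * \<delta> / c"]) auto
qed

section \<open>From the strip estimate to the sign of \<open>u\<close>\<close>

theorem theoremB1:
  fixes \<Omega> :: "'a::euclidean_space set" and u :: "'a \<Rightarrow> real" and \<gamma> :: real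
  assumes "0 < \<gamma>" "\<gamma> < 1"
    and "bounded \<Omega>" "C1_gamma_domain \<gamma> \<Omega>"
    and "L1_loc \<Omega> u"
    and "\<And>\<eta>. test_fun \<Omega> \<eta> \<Longrightarrow> (\<forall>x. \<eta> x \<ge> 0) \<Longrightarrow>
           (LINT x:\<Omega>|lebesgue. u x * (- laplacian \<eta> x)) \<le> 0"
    and "((\<lambda>\<epsilon>. ennreal (1 / \<epsilon>) *
            (\<integral>\<^sup>+ x \<in> {x \<in> \<Omega>. infdist x (frontier \<Omega>) < \<epsilon>}. ennreal (max (u x) 0) \<partial>lebesgue))
          \<longlongrightarrow> 0) (at_right 0)"
  shows "AE x in lebesgue. x \<in> \<Omega> \<longrightarrow> u x \<le> 0"
proof -
  let ?d = "\<lambda>x. infdist x (frontier \<Omega>)"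
  have "open \<Omega>"
    using assms(4) by (simp add: C1_gamma_domain_def)
  have [measurable]: "?d \<in> borel_measurable borel" "\<Omega> \<in> sets borel"
    using \<open>open \<Omega>\<close> by (auto intro!: borel_measurable_continuous_onI continuous_intros)
  note d_pos = infdist_frontier_pos[OF assms(3) \<open>open \<Omega>\<close>]
  have u_int: "integrable lebesgue (\<lambda>x. indicator K x *\<^sub>R u x)" if "compact K" "K \<subseteq> \<Omega>" for K
    using assms(5) that unfolding L1_loc_def set_integrable_def by simp
  have exhaust: "\<forall>\<^sub>F j in sequentially. 1 / real (Suc j) \<le> ?d x" if "x \<in> \<Omega>" for x
  proof -
    have "(\<lambda>j. 1 / real (Suc j)) \<longlonglongrightarrow> 0"
      by (rule LIMSEQ_Suc[OF lim_const_over_n])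
    then have "\<forall>\<^sub>F j in sequentially. 1 / real (Suc j) < ?d x"
      by (rule order_tendstoD(2)) (rule d_pos[OF that])
    then show ?thesis
      by (rule eventually_mono) simp
  qed
  \<comment> \<open>Integrability is known on compact subsets only, so measurability on \<Omega> is
    obtained along the exhaustion by the sets at distance at least 1 / (j + 1).\<close>
  have u_meas: "(\<lambda>x. indicator \<Omega> x * u x) \<in> borel_measurable lebesgue"
  proof (rule borel_measurable_LIMSEQ_real)
    let ?K = "\<lambda>j. {x \<in> \<Omega>. 1 / real (Suc j) \<le> ?d x}"
    show "(\<lambda>x. indicator (?K j) x *\<^sub>R u x) \<in> borel_measurable lebesgue" for j
      by (intro borel_measurable_integrable u_int compact_infdist_frontier_ge assms(3) \<open>open \<Omega>\<close>) auto
    fix x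
    show "(\<lambda>j. indicator (?K j) x *\<^sub>R u x) \<longlonglongrightarrow> indicator \<Omega> x * u x"
    proof (cases "x \<in> \<Omega>")
      case True
      have "\<forall>\<^sub>F j in sequentially. indicator (?K j) x *\<^sub>R u x = indicator \<Omega> x * u x"
        using exhaust[OF True] by (rule eventually_mono) (use True in simp)
      then show ?thesis
        by (rule tendsto_eventually)
    qed simp
  qed
  \<comment> \<open>The averages are taken over \<open>lborel\<close>, so \<open>u\<close> is
    replaced by a Borel representative; multiplying by the indicator again makes \<open>U\<close>
    vanish everywhere off \<Omega>, not just almost everywhere.\<close>
  obtain v where v [measurable]: "v \<in> borel_measurable lborel"
    and v_eq: "AE x in lborel. indicator \<Omega> x * u x = v x"
    using completion_ex_borel_measurable_real[OF u_meas] by auto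
  define U where "U x = indicator \<Omega> x * v x" for x
  have U_meas [measurable]: "U \<in> borel_measurable borel"
    using v unfolding U_def[abs_def] by measurable
  have U_eq: "AE x in lborel. indicator \<Omega> x * u x = U x"
    using v_eq by eventually_elim (auto simp: U_def indicator_def)
  have U_eq': "AE x in lebesgue. indicator \<Omega> x * u x = U x"
    by (rule AE_completion[OF U_eq])
  have U_meas': "U \<in> borel_measurable lebesgue"
    by (rule measurable_completion) measurable
  have U_int: "integrable lborel (\<lambda>y. indicator K y * U y)" if K: "compact K" "K \<subseteq> \<Omega>" for K
  proof -
    have [measurable]: "K \<in> sets borel"
      using K(1) by (simp add: borel_compact)
    have meas: "(\<lambda>y. indicator K y * U y) \<in> borel_measurable lborel"
      by measurable
    have "integrable lebesgue (\<lambda>x. indicator K x *\<^sub>R u x) \<longleftrightarrow> integrable lebesgue (\<lambda>y. indicator K y * U y)"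
    proof (rule integrable_cong_AE)
      show "(\<lambda>x. indicator K x *\<^sub>R u x) \<in> borel_measurable lebesgue"
        by (rule borel_measurable_integrable[OF u_int[OF K]])
      show "(\<lambda>y. indicator K y * U y) \<in> borel_measurable lebesgue"
        by (rule measurable_completion[OF meas])
      show "AE x in lebesgue. indicator K x *\<^sub>R u x = indicator K x * U x"
        using U_eq' by eventually_elim (use K(2) in \<open>auto simp: indicator_def\<close>)
    qed
    then have "integrable lebesgue (\<lambda>y. indicator K y * U y)"
      using u_int[OF K] by simp
    then show ?thesis
      using integrable_completion[OF meas] by simp
  qed
  have U_sub: "0 \<le> (LINT y|lborel. U y * laplacian (bump x t) y)" if "0 < t" "cball x t \<subseteq> \<Omega>" for x t
  proof -
    have [measurable]: "laplacian (bump x t) \<in> borel_measurable borel"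
      unfolding laplacian_bump_eq_trace[abs_def]
      by (intro borel_measurable_continuous_onI continuous_on_sum continuous_on_inner
          continuous_on_bump_hess continuous_on_const)
    have lap_meas: "laplacian (bump x t) \<in> borel_measurable lebesgue"
      by (rule measurable_completion) measurable
    have meas: "(\<lambda>y. U y * laplacian (bump x t) y) \<in> borel_measurable lborel"
      by measurable
    have "(LINT y:\<Omega>|lebesgue. u y * (- laplacian (bump x t) y)) =
        (LINT y|lebesgue. - (U y * laplacian (bump x t) y))"
      unfolding set_lebesgue_integral_def
    proof (rule integral_cong_AE)
      have "(\<lambda>y. (indicator \<Omega> y * u y) * (- laplacian (bump x t) y)) \<in> borel_measurable lebesgue"
        by (intro borel_measurable_times u_meas borel_measurable_uminus lap_meas)
      then show "(\<lambda>y. indicator \<Omega> y *\<^sub>R (u y * (- laplacian (bump x t) y))) \<in> borel_measurable lebesgue"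
        by (simp add: mult.assoc)
      show "(\<lambda>y. - (U y * laplacian (bump x t) y)) \<in> borel_measurable lebesgue"
        by (intro borel_measurable_times U_meas' borel_measurable_uminus lap_meas)
      show "AE y in lebesgue. indicator \<Omega> y *\<^sub>R (u y * (- laplacian (bump x t) y)) = - (U y * laplacian (bump x t) y)"
        using U_eq' by eventually_elim (auto simp: indicator_def split: if_splits)
    qed
    also have "\<dots> = - (LINT y|lborel. U y * laplacian (bump x t) y)"
      by (simp add: integral_completion[OF meas])
    finally show ?thesis
      using assms(6)[OF bump_test_fun[OF that]] flat_exp_0_nonneg by (simp add: bump_def)
  qed
  define V where "V x = max (U x) 0" for x
  have V_meas [measurable]: "V \<in> borel_measurable borel"
    unfolding V_def[abs_def] by measurable
  have V_nonneg: "0 \<le> V x" for x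
    by (simp add: V_def)
  have V_int: "integrable lborel (\<lambda>y. indicator K y * V y)" if K: "compact K" "K \<subseteq> \<Omega>" for K
  proof (rule Bochner_Integration.integrable_bound[OF U_int[OF K]])
    have "K \<in> sets borel"
      using K(1) by (simp add: borel_compact)
    then show "(\<lambda>y. indicator K y * V y) \<in> borel_measurable lborel"
      by measurable
    show "AE x in lborel. norm (indicator K x * V x) \<le> norm (indicator K x * U x)"
      by (intro AE_I2) (auto simp: V_def indicator_def)
  qed
  \<comment> \<open>The average of \<open>V\<close> dominates both the average of \<open>U\<close>
    and 0, hence the positive part of \<open>U\<close> at the centre.\<close>
  have V_sub: "AE x in lborel. x \<in> \<Omega> \<longrightarrow> 2 * r < ?d x \<longrightarrow> V x \<le> avg V r x" if r: "0 < r" for r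
  proof -
    have "AE x in lborel. x \<in> \<Omega> \<longrightarrow> 2 * r < ?d x \<longrightarrow> U x \<le> avg U r x"
      by (rule weakly_subharmonic_imp_AE_le_avg[OF \<open>open \<Omega>\<close> assms(3) U_meas U_int U_sub r])
    then show ?thesis
    proof eventually_elim
      case (elim x)
      show ?case
      proof (intro impI)
        assume x: "x \<in> \<Omega>" "2 * r < ?d x"
        have sub: "cball x r \<subseteq> \<Omega>"
          using ball_infdist_frontier_subset[OF x(1), of "2 * r"] x(2) r by auto
        have int_ball: "integrable lborel (\<lambda>y. indicator (ball x r) y * W y)"
          if W: "W \<in> borel_measurable borel" "integrable lborel (\<lambda>y. indicator (cball x r) y * W y)" for W :: "'a \<Rightarrow> real"
          by (rule Bochner_Integration.integrable_bound[OF W(2)]) (use W(1) in \<open>auto simp: indicator_def\<close>)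
        have "avg U r x \<le> avg V r x"
          using sub by (intro avg_mono avg_integrable int_ball U_meas V_meas r U_int V_int) (auto simp: V_def)
        moreover have "0 \<le> avg V r x"
          unfolding avg_def by (intro Bochner_Integration.integral_nonneg mult_nonneg_nonneg mollifier_nonneg V_nonneg)
        ultimately show "V x \<le> avg V r x"
          using elim x by (simp add: V_def)
      qed
    qed
  qed
  obtain k \<epsilon>1 where "0 < \<epsilon>1" and est: "\<And>\<epsilon>. 0 < \<epsilon> \<Longrightarrow> \<epsilon> < \<epsilon>1 \<Longrightarrow>
      (\<integral>\<^sup>+x. ennreal (V x) * indicator {x \<in> \<Omega>. \<epsilon> \<le> ?d x} x \<partial>lborel) \<le>
      ennreal k * (ennreal (1 / \<epsilon>) * (\<integral>\<^sup>+x. ennreal (V x) * indicator {x \<in> \<Omega>. ?d x < \<epsilon>} x \<partial>lborel))"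
    using boundary_strip_estimate[OF assms(1-4) V_meas V_nonneg V_int V_sub] by auto
  have strip_eq: "(\<integral>\<^sup>+ x \<in> {x \<in> \<Omega>. ?d x < \<epsilon>}. ennreal (max (u x) 0) \<partial>lebesgue) =
      (\<integral>\<^sup>+x. ennreal (V x) * indicator {x \<in> \<Omega>. ?d x < \<epsilon>} x \<partial>lborel)" for \<epsilon>
    unfolding nn_integral_completion
  proof (rule nn_integral_cong_AE)
    show "AE x in lborel. ennreal (max (u x) 0) * indicator {x \<in> \<Omega>. ?d x < \<epsilon>} x =
        ennreal (V x) * indicator {x \<in> \<Omega>. ?d x < \<epsilon>} x"
      using U_eq by eventually_elim (auto simp: V_def indicator_def)
  qed
  \<comment> \<open>The integral over the points at distance at least \<open>e\<close> does not
    depend on \<epsilon>; for every small \<epsilon> below \<open>e\<close> the strip estimate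
    bounds it by a quantity that tends to 0.\<close>
  have "AE x in lborel. ennreal (V x) * indicator {x \<in> \<Omega>. e \<le> ?d x} x = 0" if "0 < e" for e
  proof -
    have "(\<integral>\<^sup>+x. ennreal (V x) * indicator {x \<in> \<Omega>. e \<le> ?d x} x \<partial>lborel) \<le> ennreal k * 0"
    proof (rule tendsto_lowerbound)
      show "((\<lambda>\<epsilon>. ennreal k * (ennreal (1 / \<epsilon>) *
          (\<integral>\<^sup>+ x \<in> {x \<in> \<Omega>. ?d x < \<epsilon>}. ennreal (max (u x) 0) \<partial>lebesgue))) \<longlongrightarrow> ennreal k * 0) (at_right 0)"
        by (rule ennreal_tendsto_cmult[OF _ assms(7)]) simp
      show "\<forall>\<^sub>F \<epsilon> in at_right 0. (\<integral>\<^sup>+x. ennreal (V x) * indicator {x \<in> \<Omega>. e \<le> ?d x} x \<partial>lborel) \<le>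
          ennreal k * (ennreal (1 / \<epsilon>) * (\<integral>\<^sup>+ x \<in> {x \<in> \<Omega>. ?d x < \<epsilon>}. ennreal (max (u x) 0) \<partial>lebesgue))"
        unfolding eventually_at_right_field
      proof (intro exI[of _ "min \<epsilon>1 e"] conjI allI impI)
        show "0 < min \<epsilon>1 e"
          using \<open>0 < \<epsilon>1\<close> \<open>0 < e\<close> by simp
        fix \<epsilon> assume \<epsilon>: "0 < \<epsilon>" "\<epsilon> < min \<epsilon>1 e"
        have "(\<integral>\<^sup>+x. ennreal (V x) * indicator {x \<in> \<Omega>. e \<le> ?d x} x \<partial>lborel) \<le>
            (\<integral>\<^sup>+x. ennreal (V x) * indicator {x \<in> \<Omega>. \<epsilon> \<le> ?d x} x \<partial>lborel)"
          using \<epsilon> by (intro nn_integral_mono mult_left_mono) (auto simp: indicator_def)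
        also have "\<dots> \<le> ennreal k * (ennreal (1 / \<epsilon>) *
            (\<integral>\<^sup>+x. ennreal (V x) * indicator {x \<in> \<Omega>. ?d x < \<epsilon>} x \<partial>lborel))"
          using \<epsilon> by (intro est) auto
        finally show "(\<integral>\<^sup>+x. ennreal (V x) * indicator {x \<in> \<Omega>. e \<le> ?d x} x \<partial>lborel) \<le>
            ennreal k * (ennreal (1 / \<epsilon>) * (\<integral>\<^sup>+ x \<in> {x \<in> \<Omega>. ?d x < \<epsilon>}. ennreal (max (u x) 0) \<partial>lebesgue))"
          by (simp only: strip_eq)
      qed
    qed simp
    then have "(\<integral>\<^sup>+x. ennreal (V x) * indicator {x \<in> \<Omega>. e \<le> ?d x} x \<partial>lborel) = 0"
      by simp
    then show ?thesis
      by (subst (asm) nn_integral_0_iff_AE) measurable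
  qed
  then have "AE x in lborel. \<forall>j. ennreal (V x) * indicator {x \<in> \<Omega>. 1 / real (Suc j) \<le> ?d x} x = 0"
    unfolding AE_all_countable by simp
  with U_eq have "AE x in lborel. x \<in> \<Omega> \<longrightarrow> u x \<le> 0"
  proof eventually_elim
    case (elim x)
    show ?case
    proof
      assume x: "x \<in> \<Omega>"
      then obtain j where j: "1 / real (Suc j) \<le> ?d x"
        using exhaust[OF x] unfolding eventually_sequentially by auto
      have "ennreal (V x) * indicator {x \<in> \<Omega>. 1 / real (Suc j) \<le> ?d x} x = 0"
        using elim(2) by (rule spec)
      then have "V x \<le> 0"
        using j x by (simp add: ennreal_eq_0_iff)
      then show "u x \<le> 0"
        using elim(1) x by (simp add: V_def)
    qed
  qed
  then show ?thesis
    by (rule AE_completion)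
qed

end
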